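(* Let $k\in l_2(X)$ with $\check k\in L^\infty(G)$ and $|\check k|=1$ a.e. on $G$. Then: (i) $W_k$ is left invertible on $l_2(X_+)$ if and only if $\operatorname{dist}_{L^\infty}(\check k,H^\infty(G))<1$, and $W_k$ is right invertible if and only if $\operatorname{dist}_{L^\infty}(\overline{\check k},H^\infty(G))<1$; (ii) $W_k$ is invertible on $l_2(X_+)$ if and only if there exists an invertible element $\psi$ of $H^\infty(G)$ with $\|\check k-\psi\|_{L^\infty(G)}<1$.
   Context: $X$ is a discrete linearly ordered abelian group with positive cone $X_+$; $G$ is its compact dual group with normalized Haar measure. $\check k(x)=\sum_{\xi\in X}k(\xi)\xi(x)$; $W_kg=1_{X_+}(k\ast g)$ on $l_2(X_+)$. $H^\infty(G)=\{f\in L^\infty(G):\widehat f(\chi)=0\ \forall\chi\notin X_+\}$ with the $L^\infty$ norm, where $\widehat f(\xi)=\int_Gf(x)\overline{\xi(x)}dx$; $\operatorname{dist}_{L^\infty}(f,H^\infty(G))=\inf_{h\in H^\infty(G)}\|f-h\|_{L^\infty}$. *)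

theory Defs
  imports "HOL-Probability.Probability"
begin

text \<open>X is a linearly ordered abelian group (type class linordered_ab_group_add),
  regarded as a discrete group.  Its positive cone is X_+ = {x. 0 <= x}.\<close>

definition posCone :: "'x::linordered_ab_group_add set" where
  "posCone = {x. 0 \<le> x}"

definition chars :: "('x::linordered_ab_group_add \<Rightarrow> complex) set" where
  "chars = {\<gamma>. (\<forall>a b. \<gamma> (a + b) = \<gamma> a * \<gamma> b) \<and> (\<forall>a. cmod (\<gamma> a) = 1)}"

text \<open>Normalized Haar measure on G: a translation-invariant probability measure on G,
  with the sigma-algebra generated by the evaluation maps (the trace of the product
  sigma-algebra, i.e. the Baire sets of the compact group G).\<close>
definition haar :: "('x::linordered_ab_group_add \<Rightarrow> complex) measure \<Rightarrow> bool" where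
  "haar \<mu> \<longleftrightarrow> prob_space \<mu> \<and> space \<mu> = chars \<and>
     sets \<mu> = sets (restrict_space (Pi\<^sub>M UNIV (\<lambda>_. (borel :: complex measure))) chars) \<and>
     (\<forall>c\<in>chars. distr \<mu> \<mu> (\<lambda>\<gamma> x. c x * \<gamma> x) = \<mu>)"

definition l2space :: "'x set \<Rightarrow> ('x \<Rightarrow> complex) set" where
  "l2space A = {g. (\<lambda>x. (cmod (g x))\<^sup>2) summable_on UNIV \<and> (\<forall>x. x \<notin> A \<longrightarrow> g x = 0)}"

definition l2norm :: "('x \<Rightarrow> complex) \<Rightarrow> real" where
  "l2norm g = sqrt (infsum (\<lambda>x. (cmod (g x))\<^sup>2) UNIV)"

definition conv :: "('x::ab_group_add \<Rightarrow> complex) \<Rightarrow> ('x \<Rightarrow> complex) \<Rightarrow> 'x \<Rightarrow> complex" where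
  "conv k g x = infsum (\<lambda>\<xi>. k \<xi> * g (x - \<xi>)) UNIV"

definition wienerHopf :: "('x::linordered_ab_group_add \<Rightarrow> complex) \<Rightarrow> ('x \<Rightarrow> complex) \<Rightarrow> 'x \<Rightarrow> complex" where
  "wienerHopf k g = (\<lambda>x. if x \<in> posCone then conv k g x else 0)"

definition bounded_op :: "'x set \<Rightarrow> (('x \<Rightarrow> complex) \<Rightarrow> ('x \<Rightarrow> complex)) \<Rightarrow> bool" where
  "bounded_op A T \<longleftrightarrow> (\<forall>g\<in>l2space A. T g \<in> l2space A) \<and>
     (\<forall>g\<in>l2space A. \<forall>h\<in>l2space A. \<forall>c. T (\<lambda>x. c * g x + h x) = (\<lambda>x. c * T g x + T h x)) \<and>
     (\<exists>C. \<forall>g\<in>l2space A. l2norm (T g) \<le> C * l2norm g)"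

definition left_invertible_op :: "'x set \<Rightarrow> (('x \<Rightarrow> complex) \<Rightarrow> ('x \<Rightarrow> complex)) \<Rightarrow> bool" where
  "left_invertible_op A T \<longleftrightarrow> bounded_op A T \<and>
     (\<exists>L. bounded_op A L \<and> (\<forall>g\<in>l2space A. L (T g) = g))"

definition right_invertible_op :: "'x set \<Rightarrow> (('x \<Rightarrow> complex) \<Rightarrow> ('x \<Rightarrow> complex)) \<Rightarrow> bool" where
  "right_invertible_op A T \<longleftrightarrow> bounded_op A T \<and>
     (\<exists>R. bounded_op A R \<and> (\<forall>g\<in>l2space A. T (R g) = g))"

definition invertible_op :: "'x set \<Rightarrow> (('x \<Rightarrow> complex) \<Rightarrow> ('x \<Rightarrow> complex)) \<Rightarrow> bool" where
  "invertible_op A T \<longleftrightarrow> bounded_op A T \<and>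
     (\<exists>S. bounded_op A S \<and> (\<forall>g\<in>l2space A. S (T g) = g) \<and> (\<forall>g\<in>l2space A. T (S g) = g))"

definition Linf :: "('g) measure \<Rightarrow> ('g \<Rightarrow> complex) set" where
  "Linf \<mu> = {f. f \<in> borel_measurable \<mu> \<and> (\<exists>C. AE \<gamma> in \<mu>. cmod (f \<gamma>) \<le> C)}"

definition linf_norm :: "'g measure \<Rightarrow> ('g \<Rightarrow> complex) \<Rightarrow> ereal" where
  "linf_norm \<mu> f = esssup \<mu> (\<lambda>\<gamma>. ereal (cmod (f \<gamma>)))"

definition fourier :: "('x \<Rightarrow> complex) measure \<Rightarrow> (('x \<Rightarrow> complex) \<Rightarrow> complex) \<Rightarrow> 'x \<Rightarrow> complex" where
  "fourier \<mu> f \<xi> = (\<integral>\<gamma>. f \<gamma> * cnj (\<gamma> \<xi>) \<partial>\<mu>)"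

definition Hinf :: "('x::linordered_ab_group_add \<Rightarrow> complex) measure \<Rightarrow> (('x \<Rightarrow> complex) \<Rightarrow> complex) set" where
  "Hinf \<mu> = {f \<in> Linf \<mu>. \<forall>c. c \<notin> posCone \<longrightarrow> fourier \<mu> f c = 0}"

definition dist_Hinf :: "('x::linordered_ab_group_add \<Rightarrow> complex) measure \<Rightarrow> (('x \<Rightarrow> complex) \<Rightarrow> complex) \<Rightarrow> ereal" where
  "dist_Hinf \<mu> f = (INF h\<in>Hinf \<mu>. linf_norm \<mu> (\<lambda>\<gamma>. f \<gamma> - h \<gamma>))"

text \<open>f is (a representative of) k-check = sum_xi k(xi) xi, the series converging in L^2(G)
  (unconditionally, along finite subsets of X).\<close>
definition is_check :: "('x \<Rightarrow> complex) measure \<Rightarrow> ('x \<Rightarrow> complex) \<Rightarrow> (('x \<Rightarrow> complex) \<Rightarrow> complex) \<Rightarrow> bool" where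
  "is_check \<mu> k f \<longleftrightarrow> f \<in> borel_measurable \<mu> \<and> integrable \<mu> (\<lambda>\<gamma>. (cmod (f \<gamma>))\<^sup>2) \<and>
     ((\<lambda>F. \<integral>\<gamma>. (cmod (f \<gamma> - (\<Sum>\<xi>\<in>F. k \<xi> * \<gamma> \<xi>)))\<^sup>2 \<partial>\<mu>) \<longlongrightarrow> 0) (finite_subsets_at_top UNIV)"

end

theory Submission
  imports Defs
begin

text \<open>
  Under the Fourier transform, \<open>W\<^sub>k\<close> becomes the Toeplitz operator \<open>T f = P (\<phi> f)\<close> on the Hardy
  space \<open>H\<^sup>2\<close>, where \<open>\<phi>\<close> is the unimodular function \<open>kc\<close>. If \<open>h \<in> H\<^sup>\<infinity>\<close> is within distance less than 1 of \<open>\<phi>\<close>, the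
  operator with symbol \<open>cnj h \<cdot> \<phi>\<close> differs from the identity by a contraction and factors through \<open>T\<close>.
  Conversely, since \<open>\<bar>\<phi>\<bar> = 1\<close>, a lower bound for \<open>T\<close> says that the Hankel operator \<open>H f = \<phi> f - P (\<phi> f)\<close>
  has norm less than 1, and Nehari's theorem provides \<open>h\<close>. Nehari's theorem is proved without
  duality: for \<open>\<lambda> > 1\<close> close to 1 let \<open>p \<in> H\<^sup>2\<close> solve \<open>p - \<lambda> H\<^sup>* H p = 1\<close> and put \<open>b = H p\<close>. The function
  \<open>\<bar>p\<bar>\<^sup>2 - \<lambda> \<bar>b\<bar>\<^sup>2\<close> has no Fourier coefficients other than the constant one, so it is a positive constant,
  and \<open>h = P (\<phi> p) / p\<close> satisfies \<open>\<phi> - h = b / p\<close>. It is analytic because \<open>p\<close> is outer: replacing \<open>p\<close>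
  by its outer factor would otherwise contradict the minimizing property of \<open>p\<close>.
\<close>

section \<open>Characters separate points\<close>

text \<open>The order on \<open>X\<close> is arbitrary, so there is no disc to extend functions
  into: analyticity means only that Fourier coefficients vanish off the cone. Every step is
  therefore an argument about frequencies or about Hilbert space geometry, and outerness of
  \<open>p\<close> is proved by comparing energies instead of looking for zeros.
  \<open>\<mu>\<close> is known only through translation invariance and the sigma-algebra of
  evaluations. Orthogonality of the characters then rests on characters of \<open>X\<close>
  separating points, and completeness of the Fourier system on a uniqueness theorem adapted to that
  sigma-algebra. If \<open>\<kappa>\<close> bounds the squared norm of the Hankel operator,
  \<open>\<lambda> \<kappa> < 1\<close> makes \<open>1 - \<lambda> H\<^sup>* H\<close> positive
  definite, which gives \<open>p\<close> and its uniqueness, while \<open>\<lambda> > 1\<close>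
  turns \<open>\<lambda> \<bar>b\<bar>\<^sup>2 \<le> \<bar>p\<bar>\<^sup>2\<close> into a distance
  below 1. For two-sided invertibility, the \<open>h\<close> supplied by Nehari's theorem is itself
  invertible: injectivity of the Toeplitz operator with symbol \<open>cnj \<phi>\<close> forces
  \<open>h f = 1\<close> for an explicit \<open>f\<close>.\<close>

definition nat_mult :: "nat \<Rightarrow> 'x::ab_group_add \<Rightarrow> 'x" where
  "nat_mult n x = (\<Sum>i<n. x)"

lemma nat_mult_0 [simp]: "nat_mult 0 x = 0"
  and nat_mult_Suc [simp]: "nat_mult (Suc n) x = nat_mult n x + x"
  by (simp_all add: nat_mult_def)

lemma nat_mult_add: "nat_mult (m + n) x = nat_mult m x + nat_mult n x"
  by (induction n) (simp_all add: algebra_simps)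

text \<open>Multiples of a positive element stay positive, so an ordered group has no torsion. This
  leaves the value of a character at a nonzero element free to choose.\<close>

lemma nat_mult_eq_0_iff:
  fixes x :: "'x::linordered_ab_group_add"
  assumes "x \<noteq> 0"
  shows "nat_mult n x = 0 \<longleftrightarrow> n = 0"
proof -
  have pos: "nat_mult (Suc n) y > 0" if "y > 0" for n and y :: 'x
    using that by (induction n) (auto intro: add_pos_pos)
  have neg: "nat_mult n (- y) = - nat_mult n y" for n and y :: 'x
    by (induction n) simp_all
  have "nat_mult (Suc m) x \<noteq> 0" for m
  proof (cases "x > 0")
    case True
    then show ?thesis using pos[of x m] by simp
  next
    case False
    with assms have "- x > 0" by simp
    from pos[OF this, of m] have "- nat_mult (Suc m) x > 0" unfolding neg .
    then have "nat_mult (Suc m) x < 0" by (simp only: neg_0_less_iff_less)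
    then show ?thesis by (rule less_imp_neq)
  qed
  then show ?thesis by (cases n) auto
qed

text \<open>A partial character is the graph of a character of a subgroup.\<close>

definition partial_char :: "('x::ab_group_add \<times> complex) set \<Rightarrow> bool" where
  "partial_char R \<longleftrightarrow> (0, 1) \<in> R \<and>
     (\<forall>a w b u. (a, w) \<in> R \<longrightarrow> (b, u) \<in> R \<longrightarrow> (a - b, w / u) \<in> R) \<and>
     (\<forall>w. (0, w) \<in> R \<longrightarrow> w = 1) \<and> (\<forall>a w. (a, w) \<in> R \<longrightarrow> cmod w = 1)"

lemma partial_charD:
  assumes "partial_char R"
  shows "(0, 1) \<in> R" "\<And>a w b u. (a, w) \<in> R \<Longrightarrow> (b, u) \<in> R \<Longrightarrow> (a - b, w / u) \<in> R"
    "\<And>w. (0, w) \<in> R \<Longrightarrow> w = 1" "\<And>a w. (a, w) \<in> R \<Longrightarrow> cmod w = 1"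
  using assms unfolding partial_char_def by blast+

lemma partial_char_uminus:
  "partial_char R \<Longrightarrow> (b, u) \<in> R \<Longrightarrow> (- b, 1 / u) \<in> R"
  using partial_charD(2)[of R 0 1 b u] partial_charD(1)[of R] by simp

lemma partial_char_add:
  "partial_char R \<Longrightarrow> (a, w) \<in> R \<Longrightarrow> (b, u) \<in> R \<Longrightarrow> (a + b, w * u) \<in> R"
  using partial_charD(2)[of R a w "- b" "1 / u"] partial_char_uminus[of R b u] by simp

lemma partial_char_unique:
  assumes "partial_char R" "(a, w) \<in> R" "(a, u) \<in> R"
  shows "w = u"
proof -
  have "(0, w / u) \<in> R" using partial_charD(2)[OF assms] by simp
  then have "w / u = 1" by (rule partial_charD(3)[OF assms(1)])
  \<comment> \<open>Division by zero yields 0, so \<open>u = 0\<close> contradicts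
    \<open>w / u = 1\<close>.\<close>
  then show ?thesis by (cases "u = 0") auto
qed

lemma partial_char_nat_mult:
  "partial_char R \<Longrightarrow> (a, w) \<in> R \<Longrightarrow> (nat_mult n a, w ^ n) \<in> R"
  by (induction n) (auto simp: partial_charD partial_char_add power_Suc2 simp del: power_Suc)

text \<open>The larger graph is generated by \<open>R\<close> and \<open>(x, z)\<close>, with
  integer multiples of \<open>x\<close> written as differences of natural ones. Only
  well-definedness is at stake, and only at 0: a relation between \<open>a\<close> and multiples of
  \<open>x\<close> puts a natural multiple of \<open>x\<close> into the domain of \<open>R\<close>
  (after an inversion if necessary), where \<open>compat\<close> fixes the value.\<close>

lemma partial_char_extend:
  assumes R: "partial_char R" and z: "cmod z = 1"
    and compat: "\<And>d w. (nat_mult d x, w) \<in> R \<Longrightarrow> w = z ^ d"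
  obtains R' where "partial_char R'" "R \<subseteq> R'" "(x, z) \<in> R'"
proof
  define R' where "R' = {(a + nat_mult n x - nat_mult m x, w * z ^ n / z ^ m) | a w n m. (a, w) \<in> R}"
  have z0: "z \<noteq> 0" using z by auto
  have mem: "(a + nat_mult n x - nat_mult m x, w * z ^ n / z ^ m) \<in> R'" if "(a, w) \<in> R" for a w n m
    using that unfolding R'_def by blast
  have one: "w * z ^ n / z ^ m = 1" if aw: "(a, w) \<in> R" and eq: "a + nat_mult n x - nat_mult m x = 0"
    for a w n m
  proof (cases "n \<le> m")
    case True
    then obtain d where d: "m = d + n" by (metis le_add_diff_inverse2)
    from eq have "a = nat_mult d x" by (simp add: d nat_mult_add)
    with aw compat have "w = z ^ d" by blast
    then show ?thesis using z0 by (simp add: d power_add)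
  next
    case False
    then obtain d where d: "n = d + m" by (metis le_add_diff_inverse2 nat_le_linear)
    from eq have "nat_mult d x = - a" by (simp add: d nat_mult_add add_eq_0_iff algebra_simps)
    with partial_char_uminus[OF R aw] have "1 / w = z ^ d" by (intro compat) simp
    moreover have "w \<noteq> 0" using partial_charD(4)[OF R aw] by auto
    ultimately show ?thesis using z0 by (simp add: d power_add field_simps)
  qed
  show "partial_char R'"
    unfolding partial_char_def
  proof (intro conjI allI impI)
    show "(0, 1) \<in> R'" using mem[OF partial_charD(1)[OF R], of 0 0] by simp
  next
    fix a w b u assume "(a, w) \<in> R'" "(b, u) \<in> R'"
    then obtain a' w' n m b' u' n' m' where
      *: "(a', w') \<in> R" "a = a' + nat_mult n x - nat_mult m x" "w = w' * z ^ n / z ^ m"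
      "(b', u') \<in> R" "b = b' + nat_mult n' x - nat_mult m' x" "u = u' * z ^ n' / z ^ m'"
      unfolding R'_def by auto
    have "(a' - b' + nat_mult (n + m') x - nat_mult (m + n') x,
      w' / u' * z ^ (n + m') / z ^ (m + n')) \<in> R'"
      by (rule mem) (rule partial_charD(2)[OF R *(1,4)])
    also have "a' - b' + nat_mult (n + m') x - nat_mult (m + n') x = a - b"
      by (simp add: * nat_mult_add algebra_simps)
    also have "w' / u' * z ^ (n + m') / z ^ (m + n') = w / u"
      by (simp add: * power_add mult_ac)
    finally show "(a - b, w / u) \<in> R'" .
  next
    fix w assume "(0, w) \<in> R'"
    then obtain a' w' n m where "(a', w') \<in> R" "0 = a' + nat_mult n x - nat_mult m x"
      "w = w' * z ^ n / z ^ m"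
      unfolding R'_def by auto
    then show "w = 1" using one[of a' w' n m] by simp
  next
    fix a w assume "(a, w) \<in> R'"
    then show "cmod w = 1" unfolding R'_def
      using z partial_charD(4)[OF R] by (auto simp: norm_mult norm_divide norm_power)
  qed
  show "R \<subseteq> R'" using mem[of _ _ 0 0] by auto
  show "(x, z) \<in> R'" using mem[OF partial_charD(1)[OF R], of 1 0] by simp
qed

text \<open>Divisibility of the circle group. The natural multiples of \<open>x\<close> in the
  domain are the multiples of the least positive one, so a root of the value there serves all of
  them; if there is no positive one, \<open>z = 1\<close> will do.\<close>

lemma partial_char_compatible_root:
  assumes R: "partial_char R"
  obtains z where "cmod z = 1" "\<And>d w. (nat_mult d x, w) \<in> R \<Longrightarrow> w = z ^ d"
proof (cases "\<exists>d>0. nat_mult d x \<in> Domain R")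
  case False
  show ?thesis
  proof (rule that[of 1])
    fix d w assume dw: "(nat_mult d x, w) \<in> R"
    then have "nat_mult d x \<in> Domain R" by (rule DomainI)
    with False have "d = 0" by auto
    with dw show "w = 1 ^ d" using partial_charD(3)[OF R] by simp
  qed simp
next
  case True
  define d0 where "d0 = (LEAST d. d > 0 \<and> nat_mult d x \<in> Domain R)"
  have d0: "d0 > 0" "nat_mult d0 x \<in> Domain R"
    using LeastI_ex[OF True] unfolding d0_def by auto
  have least: "d = 0" if "d < d0" "nat_mult d x \<in> Domain R" for d
    using not_less_Least[of d "\<lambda>d. d > 0 \<and> nat_mult d x \<in> Domain R"] that unfolding d0_def by auto
  from d0(2) obtain w0 where w0: "(nat_mult d0 x, w0) \<in> R" by (rule DomainE)
  have cw0: "cmod w0 = 1" using partial_charD(4)[OF R w0] .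
  obtain z where zd: "z ^ d0 = w0"
    using exists_complex_root[of d0 w0] d0(1) by auto
  have "cmod z ^ d0 = 1 ^ d0" using zd cw0 by (simp flip: norm_power)
  then have cz: "cmod z = 1" using d0(1) by (intro power_eq_imp_eq_base[of _ d0 1]) auto
  show ?thesis
  proof (rule that[of z])
    show "cmod z = 1" by (rule cz)
    fix d w assume dw: "(nat_mult d x, w) \<in> R"
    \<comment> \<open>Division with remainder by the minimal exponent: the remainder again leads
      into the domain, so by minimality it is 0.\<close>
    define q r where "q = d div d0" and "r = d mod d0"
    have d: "d = d0 * q + r" by (simp add: q_def r_def)
    have m: "nat_mult (d0 * q) x = nat_mult q (nat_mult d0 x)"
      by (induction q) (simp_all add: nat_mult_add add.commute)
    have q: "(nat_mult (d0 * q) x, w0 ^ q) \<in> R"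
      unfolding m by (rule partial_char_nat_mult[OF R w0])
    have "(nat_mult d x - nat_mult (d0 * q) x, w / w0 ^ q) \<in> R"
      by (rule partial_charD(2)[OF R dw q])
    then have "(nat_mult r x, w / w0 ^ q) \<in> R" by (simp add: d nat_mult_add)
    then have "nat_mult r x \<in> Domain R" by (rule DomainI)
    with least[of r] d0(1) have "r = 0" by (simp add: r_def)
    with d have "d = d0 * q" by simp
    with partial_char_unique[OF R dw, of "w0 ^ q"] q zd
    show "w = z ^ d" by (simp add: power_mult)
  qed
qed

text \<open>Since \<open>x\<close> has infinite order, the value -1 may be prescribed at
  \<open>x\<close>. A maximal extension exists by Zorn's lemma and is defined everywhere, because at
  any further point a compatible root allows one more extension.\<close>

lemma chars_separate:
  fixes x :: "'x::linordered_ab_group_add"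
  assumes "x \<noteq> 0"
  obtains c where "c \<in> chars" "c x \<noteq> 1"
proof -
  have triv: "partial_char {(0::'x, 1::complex)}"
    unfolding partial_char_def by auto
  obtain R0 where R0: "partial_char R0" "(x, - 1) \<in> R0"
  proof (rule partial_char_extend[OF triv, of "- 1" x])
    show "w = (- 1) ^ d" if "(nat_mult d x, w) \<in> {(0, 1)}" for d w
      using that nat_mult_eq_0_iff[OF assms] by auto
  qed auto
  define \<A> where "\<A> = {R. partial_char R \<and> R0 \<subseteq> R}"
  have "\<exists>M\<in>\<A>. \<forall>R\<in>\<A>. M \<subseteq> R \<longrightarrow> R = M"
  proof (rule subset_Zorn)
    fix C assume chain: "subset.chain \<A> C"
    show "\<exists>U\<in>\<A>. \<forall>X\<in>C. X \<subseteq> U"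
    proof (cases "C = {}")
      case True
      then show ?thesis using R0 by (auto simp: \<A>_def)
    next
      case False
      have C: "partial_char R" "R0 \<subseteq> R" if "R \<in> C" for R
        using chain that by (auto simp: subset.chain_def \<A>_def)
      have lin: "R \<subseteq> R' \<or> R' \<subseteq> R" if "R \<in> C" "R' \<in> C" for R R'
        using chain that by (meson subset_chain_def)
      have "partial_char (\<Union>C)"
        unfolding partial_char_def
      proof (intro conjI allI impI)
        show "(0, 1) \<in> \<Union>C" using False partial_charD(1)[OF C(1)] by blast
      next
        fix a w b u assume "(a, w) \<in> \<Union>C" "(b, u) \<in> \<Union>C"
        then obtain R R' where "R \<in> C" "(a, w) \<in> R" "R' \<in> C" "(b, u) \<in> R'" by auto
        then show "(a - b, w / u) \<in> \<Union>C"
          using lin[of R R'] partial_charD(2)[OF C(1), of R a w b u] partial_charD(2)[OF C(1), of R' a w b u]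
          by blast
      next
        fix w assume "(0, w) \<in> \<Union>C"
        then show "w = 1" using partial_charD(3)[OF C(1)] by blast
      next
        fix a w assume "(a, w) \<in> \<Union>C"
        then show "cmod w = 1" using partial_charD(4)[OF C(1)] by blast
      qed
      moreover have "R0 \<subseteq> \<Union>C" using False C(2) by blast
      ultimately show ?thesis by (intro bexI[of _ "\<Union>C"]) (auto simp: \<A>_def)
    qed
  qed
  then obtain M where M: "partial_char M" "R0 \<subseteq> M"
    and max: "\<And>R. partial_char R \<Longrightarrow> M \<subseteq> R \<Longrightarrow> R = M"
    unfolding \<A>_def by auto
  have total: "\<exists>w. (a, w) \<in> M" for a
  proof -
    obtain z where "cmod z = 1" "\<And>d w. (nat_mult d a, w) \<in> M \<Longrightarrow> w = z ^ d"
      using partial_char_compatible_root[OF M(1)] by blast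
    then obtain R' where "partial_char R'" "M \<subseteq> R'" "(a, z) \<in> R'"
      using partial_char_extend[OF M(1)] by blast
    with max show ?thesis by blast
  qed
  define c where "c a = (THE w. (a, w) \<in> M)" for a
  have c: "(a, w) \<in> M \<longleftrightarrow> c a = w" for a w
  proof -
    obtain w' where w': "(a, w') \<in> M" using total by blast
    then have "c a = w'"
      unfolding c_def using partial_char_unique[OF M(1)] by blast
    then show ?thesis using w' partial_char_unique[OF M(1)] by blast
  qed
  show ?thesis
  proof (rule that)
    have "c (a + b) = c a * c b" for a b
      using partial_char_add[OF M(1), of a "c a" b "c b"] c by blast
    moreover have "cmod (c a) = 1" for a using partial_charD(4)[OF M(1)] c by blast
    ultimately show "c \<in> chars" by (simp add: chars_def)
    have "(x, - 1) \<in> M" using R0(2) M(2) by blast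
    then show "c x \<noteq> 1" using c by auto
  qed
qed

section \<open>Square-integrable functions\<close>

text \<open>The elements are functions, not classes modulo null sets. Hence \<open>norm2\<close> is
  only a seminorm, and identities obtained from it hold almost everywhere.\<close>

definition L2 :: "'g measure \<Rightarrow> ('g \<Rightarrow> complex) set" where
  "L2 M = {f \<in> borel_measurable M. integrable M (\<lambda>x. (cmod (f x))\<^sup>2)}"

definition norm2 :: "'g measure \<Rightarrow> ('g \<Rightarrow> complex) \<Rightarrow> real" where
  "norm2 M f = sqrt (\<integral>x. (cmod (f x))\<^sup>2 \<partial>M)"

definition ip2 :: "'g measure \<Rightarrow> ('g \<Rightarrow> complex) \<Rightarrow> ('g \<Rightarrow> complex) \<Rightarrow> complex" where
  "ip2 M f g = (\<integral>x. f x * cnj (g x) \<partial>M)"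

lemma L2_measurable [measurable_dest]: "f \<in> L2 M \<Longrightarrow> f \<in> borel_measurable M"
  and L2_integrable_sq: "f \<in> L2 M \<Longrightarrow> integrable M (\<lambda>x. (cmod (f x))\<^sup>2)"
  by (simp_all add: L2_def)

lemma borel_measurable_cnj [measurable (raw)]:
  "f \<in> borel_measurable M \<Longrightarrow> (\<lambda>x. cnj (f x)) \<in> borel_measurable M"
  by (rule borel_measurable_continuous_on[where f = cnj]) (auto intro: continuous_intros)

lemma L2_mult_integrable:
  assumes f: "f \<in> L2 M" and g: "g \<in> L2 M"
  shows "integrable M (\<lambda>x. f x * g x)"
proof (rule Bochner_Integration.integrable_bound)
  show "integrable M (\<lambda>x. (cmod (f x))\<^sup>2 + (cmod (g x))\<^sup>2)"
    using f g by (intro Bochner_Integration.integrable_add L2_integrable_sq)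
  show "(\<lambda>x. f x * g x) \<in> borel_measurable M" using f g by (auto simp: L2_def)
  have "norm (f x * g x) \<le> norm ((cmod (f x))\<^sup>2 + (cmod (g x))\<^sup>2)" for x
  proof -
    have "2 * cmod (f x) * cmod (g x) \<le> (cmod (f x))\<^sup>2 + (cmod (g x))\<^sup>2"
      by (rule sum_squares_bound)
    moreover have "0 \<le> cmod (f x) * cmod (g x)" by simp
    ultimately show ?thesis unfolding norm_mult real_norm_def by linarith
  qed
  then show "AE x in M. norm (f x * g x) \<le> norm ((cmod (f x))\<^sup>2 + (cmod (g x))\<^sup>2)" by simp
qed

lemma L2_cnj: "f \<in> L2 M \<Longrightarrow> (\<lambda>x. cnj (f x)) \<in> L2 M"
  by (auto simp: L2_def)

lemma ip2_integrable: "f \<in> L2 M \<Longrightarrow> g \<in> L2 M \<Longrightarrow> integrable M (\<lambda>x. f x * cnj (g x))"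
  by (intro L2_mult_integrable L2_cnj)

lemma L2_bounded_mult:
  assumes f: "f \<in> L2 M" and psi: "\<psi> \<in> borel_measurable M" "AE x in M. cmod (\<psi> x) \<le> C"
  shows "(\<lambda>x. \<psi> x * f x) \<in> L2 M"
proof -
  have "integrable M (\<lambda>x. (cmod (\<psi> x * f x))\<^sup>2)"
  proof (rule Bochner_Integration.integrable_bound)
    show "integrable M (\<lambda>x. C\<^sup>2 * (cmod (f x))\<^sup>2)" using L2_integrable_sq[OF f] by simp
    show "(\<lambda>x. (cmod (\<psi> x * f x))\<^sup>2) \<in> borel_measurable M" using f psi(1) by measurable
    show "AE x in M. norm ((cmod (\<psi> x * f x))\<^sup>2) \<le> norm (C\<^sup>2 * (cmod (f x))\<^sup>2)"
      using psi(2)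
    proof eventually_elim
      case (elim x)
      then have "(cmod (\<psi> x))\<^sup>2 \<le> C\<^sup>2" by (intro power_mono) auto
      then show ?case by (simp add: norm_mult power_mult_distrib mult_right_mono)
    qed
  qed
  then show ?thesis using f psi(1) by (auto simp: L2_def)
qed

lemma L2_cmult: "f \<in> L2 M \<Longrightarrow> (\<lambda>x. c * f x) \<in> L2 M"
  by (rule L2_bounded_mult[where C = "cmod c"]) auto

lemma L2_add:
  assumes "f \<in> L2 M" "g \<in> L2 M"
  shows "(\<lambda>x. f x + g x) \<in> L2 M"
proof -
  have "integrable M (\<lambda>x. (cmod (f x))\<^sup>2 + (cmod (g x))\<^sup>2 + 2 * Re (f x * cnj (g x)))"
    using assms by (intro Bochner_Integration.integrable_add L2_integrable_sq integrable_mult_right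
      integrable_Re ip2_integrable)
  moreover have "(cmod (f x + g x))\<^sup>2 = (cmod (f x))\<^sup>2 + (cmod (g x))\<^sup>2 + 2 * Re (f x * cnj (g x))" for x
    unfolding cmod_power2 by (simp add: power2_eq_square algebra_simps)
  ultimately show ?thesis using assms by (auto simp: L2_def)
qed

lemma L2_diff: "f \<in> L2 M \<Longrightarrow> g \<in> L2 M \<Longrightarrow> (\<lambda>x. f x - g x) \<in> L2 M"
  using L2_add[of f M "\<lambda>x. - 1 * g x"] L2_cmult[of g M "- 1"] by simp

lemma norm2_nonneg [simp]: "0 \<le> norm2 M f"
  by (simp add: norm2_def)

lemma norm2_sq: "(norm2 M f)\<^sup>2 = (\<integral>x. (cmod (f x))\<^sup>2 \<partial>M)"
  by (simp add: norm2_def)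

lemma norm2_cong_AE:
  assumes "f \<in> borel_measurable M" "g \<in> borel_measurable M" "AE x in M. f x = g x"
  shows "norm2 M f = norm2 M g"
  unfolding norm2_def using assms by (auto intro!: integral_cong_AE)

lemma ip2_cong_AE:
  assumes "f \<in> borel_measurable M" "g \<in> borel_measurable M" "f' \<in> borel_measurable M"
    "g' \<in> borel_measurable M" "AE x in M. f x = f' x" "AE x in M. g x = g' x"
  shows "ip2 M f g = ip2 M f' g'"
  unfolding ip2_def using assms by (auto intro!: integral_cong_AE)

lemma norm2_eq_0_iff:
  assumes "f \<in> L2 M"
  shows "norm2 M f = 0 \<longleftrightarrow> (AE x in M. f x = 0)"
  unfolding norm2_def using integral_nonneg_eq_0_iff_AE[OF L2_integrable_sq[OF assms]] by simp

lemma norm2_cmult: "norm2 M (\<lambda>x. c * f x) = cmod c * norm2 M f"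
  by (simp add: norm2_def norm_mult power_mult_distrib real_sqrt_mult)

lemma norm2_uminus: "norm2 M (\<lambda>x. - f x) = norm2 M f"
  by (simp add: norm2_def)

lemma norm2_diff_commute: "norm2 M (\<lambda>x. f x - g x) = norm2 M (\<lambda>x. g x - f x)"
  by (simp add: norm2_def norm_minus_commute)

lemma norm2_mono:
  assumes "f \<in> borel_measurable M" "g \<in> L2 M" "AE x in M. cmod (f x) \<le> C * cmod (g x)" "0 \<le> C"
  shows "norm2 M f \<le> C * norm2 M g"
proof -
  have "(\<integral>x. (cmod (f x))\<^sup>2 \<partial>M) \<le> (\<integral>x. C\<^sup>2 * (cmod (g x))\<^sup>2 \<partial>M)"
  proof (rule integral_mono_AE')
    show "integrable M (\<lambda>x. C\<^sup>2 * (cmod (g x))\<^sup>2)" using L2_integrable_sq[OF assms(2)] by simp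
    show "AE x in M. (cmod (f x))\<^sup>2 \<le> C\<^sup>2 * (cmod (g x))\<^sup>2"
      using assms(3)
    proof eventually_elim
      case (elim x)
      then show ?case using power_mono[OF elim, of 2] by (simp add: power_mult_distrib)
    qed
  qed simp
  then have "norm2 M f \<le> sqrt (C\<^sup>2 * (norm2 M g)\<^sup>2)"
    unfolding norm2_sq by (simp add: norm2_def del: real_sqrt_power)
  then show ?thesis using assms(4) by (simp add: real_sqrt_mult)
qed

lemma norm2_bounded_mult:
  assumes "f \<in> L2 M" "\<psi> \<in> borel_measurable M" "AE x in M. cmod (\<psi> x) \<le> C" "0 \<le> C"
  shows "norm2 M (\<lambda>x. \<psi> x * f x) \<le> C * norm2 M f"
proof (rule norm2_mono)
  show "AE x in M. cmod (\<psi> x * f x) \<le> C * cmod (f x)"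
    using assms(3) by eventually_elim (simp add: norm_mult mult_right_mono)
qed (use assms in measurable)

lemma norm2_Cauchy_Schwarz:
  assumes f: "f \<in> L2 M" and g: "g \<in> L2 M"
  shows "cmod (\<integral>x. f x * g x \<partial>M) \<le> norm2 M f * norm2 M g"
proof -
  define I where "I = (\<integral>x. cmod (f x) * cmod (g x) \<partial>M)"
  have int: "integrable M (\<lambda>x. cmod (f x) * cmod (g x))"
    using integrable_norm[OF L2_mult_integrable[OF f g]] by (simp add: norm_mult)
  have I0: "I \<ge> 0" unfolding I_def by simp
  note [measurable] = L2_measurable[OF f] L2_measurable[OF g]
  have "(\<integral>\<^sup>+x. ennreal (cmod (f x)) * ennreal (cmod (g x)) \<partial>M)\<^sup>2 \<le>
    (\<integral>\<^sup>+x. (ennreal (cmod (f x)))\<^sup>2 \<partial>M) * (\<integral>\<^sup>+x. (ennreal (cmod (g x)))\<^sup>2 \<partial>M)"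
    by (intro Cauchy_Schwarz_nn_integral) measurable
  also have "(\<integral>\<^sup>+x. ennreal (cmod (f x)) * ennreal (cmod (g x)) \<partial>M) = ennreal I"
    unfolding I_def by (subst nn_integral_eq_integral[symmetric, OF int]) (auto simp: ennreal_mult)
  also have "(\<integral>\<^sup>+x. (ennreal (cmod (f x)))\<^sup>2 \<partial>M) = ennreal ((norm2 M f)\<^sup>2)"
    unfolding norm2_sq
    by (subst nn_integral_eq_integral[symmetric, OF L2_integrable_sq[OF f]]) (auto simp: ennreal_power)
  also have "(\<integral>\<^sup>+x. (ennreal (cmod (g x)))\<^sup>2 \<partial>M) = ennreal ((norm2 M g)\<^sup>2)"
    unfolding norm2_sq
    by (subst nn_integral_eq_integral[symmetric, OF L2_integrable_sq[OF g]]) (auto simp: ennreal_power)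
  finally have "I\<^sup>2 \<le> (norm2 M f)\<^sup>2 * (norm2 M g)\<^sup>2"
    using I0 by (simp add: ennreal_power ennreal_mult[symmetric])
  then have "I \<le> norm2 M f * norm2 M g"
    by (metis mult_nonneg_nonneg norm2_nonneg power2_le_imp_le power_mult_distrib)
  moreover have "cmod (\<integral>x. f x * g x \<partial>M) \<le> I"
    unfolding I_def using integral_norm_bound[of M "\<lambda>x. f x * g x"] by (simp add: norm_mult)
  ultimately show ?thesis by linarith
qed

lemma norm2_cnj: "norm2 M (\<lambda>x. cnj (f x)) = norm2 M f"
  by (simp add: norm2_def)

lemma ip2_Cauchy_Schwarz:
  "f \<in> L2 M \<Longrightarrow> g \<in> L2 M \<Longrightarrow> cmod (ip2 M f g) \<le> norm2 M f * norm2 M g"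
  using norm2_Cauchy_Schwarz[of f M "\<lambda>x. cnj (g x)"] by (simp add: ip2_def L2_cnj norm2_cnj)

lemma ip2_self: "ip2 M f f = of_real ((norm2 M f)\<^sup>2)"
  unfolding ip2_def norm2_sq by (simp add: complex_norm_square[symmetric] flip: of_real_power)

lemma ip2_commute: "ip2 M g f = cnj (ip2 M f g)"
  unfolding ip2_def by (subst Bochner_Integration.integral_cnj[symmetric]) (simp add: mult.commute)

lemma ip2_add_left: "f \<in> L2 M \<Longrightarrow> f' \<in> L2 M \<Longrightarrow> g \<in> L2 M \<Longrightarrow>
    ip2 M (\<lambda>x. f x + f' x) g = ip2 M f g + ip2 M f' g"
  unfolding ip2_def by (simp add: ring_distribs ip2_integrable Bochner_Integration.integral_add)

lemma ip2_diff_left: "f \<in> L2 M \<Longrightarrow> f' \<in> L2 M \<Longrightarrow> g \<in> L2 M \<Longrightarrow>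
    ip2 M (\<lambda>x. f x - f' x) g = ip2 M f g - ip2 M f' g"
  unfolding ip2_def by (simp add: ring_distribs ip2_integrable Bochner_Integration.integral_diff)

lemma ip2_cmult_left: "ip2 M (\<lambda>x. c * f x) g = c * ip2 M f g"
  unfolding ip2_def by (simp add: mult.assoc)

lemma ip2_diff_right: "f \<in> L2 M \<Longrightarrow> g \<in> L2 M \<Longrightarrow> g' \<in> L2 M \<Longrightarrow>
    ip2 M f (\<lambda>x. g x - g' x) = ip2 M f g - ip2 M f g'"
  unfolding ip2_def by (simp add: ring_distribs ip2_integrable Bochner_Integration.integral_add Bochner_Integration.integral_diff)

lemma ip2_add_right: "f \<in> L2 M \<Longrightarrow> g \<in> L2 M \<Longrightarrow> g' \<in> L2 M \<Longrightarrow>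
    ip2 M f (\<lambda>x. g x + g' x) = ip2 M f g + ip2 M f g'"
  unfolding ip2_def by (simp add: ring_distribs ip2_integrable Bochner_Integration.integral_add Bochner_Integration.integral_diff)

lemma ip2_cmult_right: "ip2 M f (\<lambda>x. c * g x) = cnj c * ip2 M f g"
  unfolding ip2_def by (simp add: mult.left_commute)

lemma norm2_diff_sq:
  assumes "f \<in> L2 M" "g \<in> L2 M"
  shows "(norm2 M (\<lambda>x. f x - g x))\<^sup>2 = (norm2 M f)\<^sup>2 - 2 * Re (ip2 M f g) + (norm2 M g)\<^sup>2"
proof -
  have "complex_of_real ((norm2 M (\<lambda>x. f x - g x))\<^sup>2) = ip2 M (\<lambda>x. f x - g x) (\<lambda>x. f x - g x)"
    by (rule ip2_self[symmetric])
  also have "\<dots> = ip2 M f f - ip2 M g f - (ip2 M f g - ip2 M g g)"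
    using assms by (simp add: ip2_diff_left ip2_diff_right L2_diff)
  finally have "(norm2 M (\<lambda>x. f x - g x))\<^sup>2 = Re (ip2 M f f - ip2 M g f - (ip2 M f g - ip2 M g g))"
    by (metis Re_complex_of_real)
  then show ?thesis by (simp add: ip2_self ip2_commute[of M g f])
qed

lemma norm2_add_sq:
  assumes "f \<in> L2 M" "g \<in> L2 M"
  shows "(norm2 M (\<lambda>x. f x + g x))\<^sup>2 = (norm2 M f)\<^sup>2 + 2 * Re (ip2 M f g) + (norm2 M g)\<^sup>2"
  using norm2_diff_sq[OF assms(1) L2_cmult[OF assms(2), of "- 1"]]
  by (simp add: ip2_cmult_right[of M f "- 1", simplified] norm2_uminus)

lemma norm2_triangle:
  assumes "f \<in> L2 M" "g \<in> L2 M"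
  shows "norm2 M (\<lambda>x. f x + g x) \<le> norm2 M f + norm2 M g"
proof (rule power2_le_imp_le)
  have "Re (ip2 M f g) \<le> norm2 M f * norm2 M g"
    using ip2_Cauchy_Schwarz[OF assms] complex_Re_le_cmod order_trans by blast
  then show "(norm2 M (\<lambda>x. f x + g x))\<^sup>2 \<le> (norm2 M f + norm2 M g)\<^sup>2"
    unfolding norm2_add_sq[OF assms] by (simp add: power2_sum)
qed simp

lemma norm2_diff_triangle:
  assumes "f \<in> L2 M" "g \<in> L2 M" "h \<in> L2 M"
  shows "norm2 M (\<lambda>x. f x - h x) \<le> norm2 M (\<lambda>x. f x - g x) + norm2 M (\<lambda>x. g x - h x)"
  using norm2_triangle[OF L2_diff[OF assms(1,2)] L2_diff[OF assms(2,3)]] by simp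

lemma norm2_le_diff:
  assumes "f \<in> L2 M" "g \<in> L2 M"
  shows "norm2 M f \<le> norm2 M g + norm2 M (\<lambda>x. f x - g x)"
  using norm2_triangle[OF assms(2) L2_diff[OF assms]] by simp

lemma ip2_tendsto:
  assumes f: "f \<in> L2 M" "\<And>n. s n \<in> L2 M" and g: "g \<in> L2 M"
    and lim: "((\<lambda>n. norm2 M (\<lambda>x. f x - s n x)) \<longlongrightarrow> 0) F"
  shows "((\<lambda>n. ip2 M (s n) g) \<longlongrightarrow> ip2 M f g) F"
proof -
  have "((\<lambda>n. ip2 M f g - ip2 M (s n) g) \<longlongrightarrow> 0) F"
  proof (rule Lim_null_comparison)
    have "cmod (ip2 M f g - ip2 M (s n) g) \<le> norm2 M (\<lambda>x. f x - s n x) * norm2 M g" for n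
      using ip2_Cauchy_Schwarz[OF L2_diff[OF f(1) f(2)] g, of n] by (simp add: ip2_diff_left f g)
    then show "\<forall>\<^sub>F n in F. cmod (ip2 M f g - ip2 M (s n) g) \<le> norm2 M (\<lambda>x. f x - s n x) * norm2 M g"
      by simp
    show "((\<lambda>n. norm2 M (\<lambda>x. f x - s n x) * norm2 M g) \<longlongrightarrow> 0) F"
      using tendsto_mult_right[OF lim, of "norm2 M g"] by simp
  qed
  from tendsto_diff[OF tendsto_const[of "ip2 M f g"] this] show ?thesis by simp
qed

section \<open>Completeness of L2 over a probability space\<close>

lemma (in finite_measure) L2_bounded:
  assumes "f \<in> borel_measurable M" "AE x in M. cmod (f x) \<le> C"
  shows "f \<in> L2 M"
proof -
  have "(\<lambda>x. 1) \<in> L2 M" by (simp add: L2_def)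
  from L2_bounded_mult[OF this assms] show ?thesis by simp
qed

lemma (in finite_measure) L2_integrable: "f \<in> L2 M \<Longrightarrow> integrable M f"
  using L2_mult_integrable[OF _ L2_bounded[of "\<lambda>x. 1" 1], of f] by simp

lemma (in prob_space) norm_integral_le_norm2:
  assumes "f \<in> L2 M"
  shows "(\<integral>x. cmod (f x) \<partial>M) \<le> norm2 M f"
proof -
  have f': "(\<lambda>x. of_real (cmod (f x))) \<in> L2 M"
    using assms by (auto simp: L2_def)
  have "cmod (\<integral>x. complex_of_real (cmod (f x)) * 1 \<partial>M) \<le> norm2 M (\<lambda>x. of_real (cmod (f x))) * norm2 M (\<lambda>x. 1)"
    by (rule norm2_Cauchy_Schwarz[OF f']) (rule L2_bounded[of _ 1], auto)
  then show ?thesis by (simp add: norm2_def prob_space)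
qed

text \<open>On a probability space the L1 norm is at most the L2 norm, so the increments have
  summable L1 norms. Their moduli then sum to a finite value almost everywhere, and the telescoping
  series converges.\<close>

lemma (in prob_space) L2_fast_Cauchy_AE_convergent:
  assumes s: "\<And>k. s k \<in> L2 M" and fast: "\<And>k. norm2 M (\<lambda>x. s (Suc k) x - s k x) \<le> (1/2) ^ k"
  shows "AE x in M. convergent (\<lambda>k. s k x)"
proof -
  note [measurable] = L2_measurable[OF s]
  have d: "(\<lambda>x. s (Suc k) x - s k x) \<in> L2 M" for k by (intro L2_diff s)
  have int: "integrable M (\<lambda>x. cmod (s (Suc k) x - s k x))" for k
    by (intro integrable_norm L2_integrable d)
  have "(\<integral>\<^sup>+x. (\<Sum>k. ennreal (cmod (s (Suc k) x - s k x))) \<partial>M) =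
      (\<Sum>k. \<integral>\<^sup>+x. ennreal (cmod (s (Suc k) x - s k x)) \<partial>M)"
    by (intro nn_integral_suminf) measurable
  also have "\<dots> = (\<Sum>k. ennreal (\<integral>x. cmod (s (Suc k) x - s k x) \<partial>M))"
    using nn_integral_eq_integral[OF int] by simp
  also have "\<dots> \<le> (\<Sum>k. ennreal ((1/2) ^ k))"
  proof (intro suminf_le ennreal_leI)
    show "(\<integral>x. cmod (s (Suc k) x - s k x) \<partial>M) \<le> (1/2) ^ k" for k
      using norm_integral_le_norm2[OF d] fast order_trans by blast
  qed auto
  also have "\<dots> < \<infinity>"
    by (subst suminf_ennreal2) (auto intro!: summable_geometric)
  finally have "(\<integral>\<^sup>+x. (\<Sum>k. ennreal (cmod (s (Suc k) x - s k x))) \<partial>M) \<noteq> \<infinity>" by simp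
  then have "AE x in M. (\<Sum>k. ennreal (cmod (s (Suc k) x - s k x))) \<noteq> \<infinity>"
    by (intro nn_integral_PInf_AE) measurable
  then show ?thesis
  proof eventually_elim
    case (elim x)
    then have "summable (\<lambda>k. cmod (s (Suc k) x - s k x))"
      by (intro summable_suminf_not_top) auto
    then have "summable (\<lambda>k. s (Suc k) x - s k x)" by (rule summable_norm_cancel)
    then have "convergent (\<lambda>k. s k x - s 0 x)"
      by (simp add: summable_iff_convergent sum_lessThan_telescope[of "\<lambda>k. s k x"])
    from convergent_add[OF this convergent_const[of "s 0 x"]] show ?case by simp
  qed
qed

text \<open>The limit is taken pointwise along a rapidly converging subsequence; Fatou's lemma then
  controls its distance to every late member of the full sequence.\<close>

lemma (in prob_space) L2_complete:
  assumes s: "\<And>n. s n \<in> L2 M"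
    and Cauchy: "\<And>e. e > 0 \<Longrightarrow> \<exists>N. \<forall>m\<ge>N. \<forall>n\<ge>N. norm2 M (\<lambda>x. s m x - s n x) \<le> e"
  obtains f where "f \<in> L2 M" "(\<lambda>n. norm2 M (\<lambda>x. f x - s n x)) \<longlonglongrightarrow> 0"
proof -
  have "\<exists>N. \<forall>k. \<forall>m\<ge>N k. \<forall>n\<ge>N k. norm2 M (\<lambda>x. s m x - s n x) \<le> (1/2) ^ k"
    by (intro choice allI Cauchy) simp
  then obtain N :: "nat \<Rightarrow> nat"
    where N: "\<And>k m n. m \<ge> N k \<Longrightarrow> n \<ge> N k \<Longrightarrow> norm2 M (\<lambda>x. s m x - s n x) \<le> (1/2) ^ k"
    by blast
  \<comment> \<open>Summing the \<open>N i\<close> makes the indices monotone and at least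
    \<open>N k\<close>; the extra \<open>k\<close> makes them unbounded.\<close>
  define r where "r k = (\<Sum>i\<le>k. N i) + k" for k
  have r: "r k \<ge> N k" "r (Suc k) \<ge> r k" "r k \<ge> k" for k
    unfolding r_def by (auto intro: trans_le_add1 member_le_sum)
  note [measurable] = L2_measurable[OF s]
  define f where "f x = lim (\<lambda>k. s (r k) x)" for x
  have [measurable]: "f \<in> borel_measurable M" unfolding f_def by measurable
  have "AE x in M. convergent (\<lambda>k. s (r k) x)"
    using r by (intro L2_fast_Cauchy_AE_convergent s N) (auto intro: order_trans)
  then have lim: "AE x in M. (\<lambda>k. s (r k) x) \<longlonglongrightarrow> f x"
    unfolding f_def by (simp add: convergent_LIMSEQ_iff)
  have bound: "(\<integral>\<^sup>+x. ennreal ((cmod (f x - s n x))\<^sup>2) \<partial>M) \<le> ennreal (e\<^sup>2)"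
    if K: "\<forall>m\<ge>K. \<forall>n\<ge>K. norm2 M (\<lambda>x. s m x - s n x) \<le> e" and n: "n \<ge> K" for e K n
  proof -
    have e0: "0 \<le> e" using K norm2_nonneg order_trans by blast
    have "(\<integral>\<^sup>+x. ennreal ((cmod (f x - s n x))\<^sup>2) \<partial>M) =
      (\<integral>\<^sup>+x. liminf (\<lambda>k. ennreal ((cmod (s (r k) x - s n x))\<^sup>2)) \<partial>M)"
    proof (rule nn_integral_cong_AE)
      show "AE x in M. ennreal ((cmod (f x - s n x))\<^sup>2) = liminf (\<lambda>k. ennreal ((cmod (s (r k) x - s n x))\<^sup>2))"
        using lim
      proof eventually_elim
        case (elim x)
        then have "(\<lambda>k. ennreal ((cmod (s (r k) x - s n x))\<^sup>2)) \<longlonglongrightarrow> ennreal ((cmod (f x - s n x))\<^sup>2)"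
          by (intro tendsto_ennrealI tendsto_intros)
        then show ?case by (intro lim_imp_Liminf[symmetric]) simp_all
      qed
    qed
    also have "\<dots> \<le> liminf (\<lambda>k. \<integral>\<^sup>+x. ennreal ((cmod (s (r k) x - s n x))\<^sup>2) \<partial>M)"
      by (rule nn_integral_liminf) measurable
    also have "\<dots> \<le> limsup (\<lambda>k. \<integral>\<^sup>+x. ennreal ((cmod (s (r k) x - s n x))\<^sup>2) \<partial>M)"
      by (rule Liminf_le_Limsup) simp
    also have "\<dots> \<le> ennreal (e\<^sup>2)"
    proof (rule Limsup_bounded)
      show "\<forall>\<^sub>F k in sequentially. (\<integral>\<^sup>+x. ennreal ((cmod (s (r k) x - s n x))\<^sup>2) \<partial>M) \<le> ennreal (e\<^sup>2)"
        unfolding eventually_sequentially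
      proof (intro exI allI impI)
        fix k assume "k \<ge> K"
        then have "norm2 M (\<lambda>x. s (r k) x - s n x) \<le> e" using K n r(3)[of k] by auto
        then have "(norm2 M (\<lambda>x. s (r k) x - s n x))\<^sup>2 \<le> e\<^sup>2" by (intro power_mono) auto
        then show "(\<integral>\<^sup>+x. ennreal ((cmod (s (r k) x - s n x))\<^sup>2) \<partial>M) \<le> ennreal (e\<^sup>2)"
          using nn_integral_eq_integral[OF L2_integrable_sq[OF L2_diff[OF s s]]]
          by (simp add: norm2_sq ennreal_leI)
      qed
    qed
    finally show ?thesis .
  qed
  have diff: "(\<lambda>x. f x - s n x) \<in> L2 M \<and> norm2 M (\<lambda>x. f x - s n x) \<le> e"
    if K: "\<forall>m\<ge>K. \<forall>n\<ge>K. norm2 M (\<lambda>x. s m x - s n x) \<le> e" and n: "n \<ge> K" for e K n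
  proof -
    have e0: "0 \<le> e" using K norm2_nonneg order_trans by blast
    have int: "integrable M (\<lambda>x. (cmod (f x - s n x))\<^sup>2)"
      using bound[OF K n] by (intro integrableI_nonneg) (auto simp: less_top[symmetric] top_unique)
    have "ennreal ((norm2 M (\<lambda>x. f x - s n x))\<^sup>2) \<le> ennreal (e\<^sup>2)"
      using bound[OF K n] nn_integral_eq_integral[OF int] by (simp add: norm2_sq)
    then have "(norm2 M (\<lambda>x. f x - s n x))\<^sup>2 \<le> e\<^sup>2" by simp
    then show ?thesis using int e0 by (auto simp: L2_def dest: power2_le_imp_le)
  qed
  show ?thesis
  proof (rule that)
    obtain K where "\<forall>m\<ge>K. \<forall>n\<ge>K. norm2 M (\<lambda>x. s m x - s n x) \<le> 1" using Cauchy[of 1] by auto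
    from diff[OF this, of K] have "(\<lambda>x. f x - s K x) \<in> L2 M" by simp
    from L2_add[OF this s[of K]] show "f \<in> L2 M" by simp
    show "(\<lambda>n. norm2 M (\<lambda>x. f x - s n x)) \<longlonglongrightarrow> 0"
    proof (rule LIMSEQ_I)
      fix e :: real assume "e > 0"
      then obtain K where K: "\<forall>m\<ge>K. \<forall>n\<ge>K. norm2 M (\<lambda>x. s m x - s n x) \<le> e / 2"
        using Cauchy[of "e / 2"] by auto
      show "\<exists>K. \<forall>n\<ge>K. norm (norm2 M (\<lambda>x. f x - s n x) - 0) < e"
        using diff[OF K] \<open>e > 0\<close> by (intro exI[of _ K]) fastforce
    qed
  qed
qed

section \<open>Orthogonal projections and fixed points in L2\<close>

lemma norm2_parallelogram:
  assumes "f \<in> L2 M" "g \<in> L2 M"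
  shows "(norm2 M (\<lambda>x. f x - g x))\<^sup>2 =
    2 * (norm2 M f)\<^sup>2 + 2 * (norm2 M g)\<^sup>2 - 4 * (norm2 M (\<lambda>x. (f x + g x) / 2))\<^sup>2"
proof -
  have "norm2 M (\<lambda>x. (f x + g x) / 2) = norm2 M (\<lambda>x. f x + g x) / 2"
    using norm2_cmult[of M "1/2" "\<lambda>x. f x + g x"] by (simp add: norm_divide)
  then show ?thesis by (simp only:) (simp add: norm2_diff_sq norm2_add_sq assms power_divide field_simps)
qed

text \<open>\<open>D\<close> need not be closed, so the nearest point to \<open>p\<close> may lie
  outside it. The result is therefore the orthogonal remainder \<open>v\<close> together with a
  minimizing sequence in \<open>D\<close>; later arguments use the concrete form of its
  members.\<close>

lemma (in prob_space) L2_projection: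
  assumes D: "D \<subseteq> L2 M" "D \<noteq> {}" and lin: "\<And>c d e. d \<in> D \<Longrightarrow> e \<in> D \<Longrightarrow> (\<lambda>x. c * d x + e x) \<in> D"
    and p: "p \<in> L2 M"
  obtains v m where "v \<in> L2 M" "\<And>n. m n \<in> D" "(\<lambda>n. norm2 M (\<lambda>x. v x - (p x - m n x))) \<longlonglongrightarrow> 0"
    "\<And>d. d \<in> D \<Longrightarrow> ip2 M v d = 0"
proof -
  define \<delta> where "\<delta> = (INF d\<in>D. (norm2 M (\<lambda>x. p x - d x))\<^sup>2)"
  have bdd: "bdd_below ((\<lambda>d. (norm2 M (\<lambda>x. p x - d x))\<^sup>2) ` D)" by (rule bdd_belowI[of _ 0]) auto
  have \<delta>_le: "\<delta> \<le> (norm2 M (\<lambda>x. p x - d x))\<^sup>2" if "d \<in> D" for d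
    unfolding \<delta>_def using that by (intro cINF_lower bdd)
  have \<delta>0: "0 \<le> \<delta>" unfolding \<delta>_def using D(2) by (intro cINF_greatest) auto
  have "\<exists>d\<in>D. (norm2 M (\<lambda>x. p x - d x))\<^sup>2 < \<delta> + 1 / real (Suc n)" for n
    using cINF_less_iff[OF D(2) bdd, of "\<delta> + 1 / real (Suc n)"] unfolding \<delta>_def[symmetric] by simp
  then obtain m where m: "\<And>n. m n \<in> D" "\<And>n. (norm2 M (\<lambda>x. p x - m n x))\<^sup>2 < \<delta> + 1 / real (Suc n)"
    by metis
  have pm: "(\<lambda>x. p x - d x) \<in> L2 M" if "d \<in> D" for d using p D(1) that by (intro L2_diff) auto
  have dist: "(norm2 M (\<lambda>x. (p x - m i x) - (p x - m j x)))\<^sup>2 \<le> 2 / real (Suc i) + 2 / real (Suc j)" for i j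
  proof -
    \<comment> \<open>This is the zero element of \<open>D\<close>; with it the midpoint of
      \<open>m i\<close> and \<open>m j\<close> is obtained from the single closure rule
      \<open>lin\<close>.\<close>
    have "(\<lambda>x. - 1 * m j x + m j x) \<in> D" by (intro lin m)
    then have "(\<lambda>x. 1/2 * m i x + (1/2 * m j x + (- 1 * m j x + m j x))) \<in> D" by (intro lin m)
    then have "\<delta> \<le> (norm2 M (\<lambda>x. p x - (1/2 * m i x + 1/2 * m j x)))\<^sup>2" using \<delta>_le by simp
    also have "(\<lambda>x. p x - (1/2 * m i x + 1/2 * m j x)) = (\<lambda>x. ((p x - m i x) + (p x - m j x)) / 2)"
      by (auto simp: field_simps)
    finally show ?thesis
      using norm2_parallelogram[OF pm[OF m(1)[of i]] pm[OF m(1)[of j]]] m(2)[of i] m(2)[of j] by auto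
  qed
  obtain v where v: "v \<in> L2 M" "(\<lambda>n. norm2 M (\<lambda>x. v x - (p x - m n x))) \<longlonglongrightarrow> 0"
  proof (rule L2_complete[of "\<lambda>n x. p x - m n x"])
    show "(\<lambda>x. p x - m n x) \<in> L2 M" for n by (rule pm[OF m(1)])
    fix e :: real assume e: "e > 0"
    obtain N where N: "4 / e\<^sup>2 < real N" using reals_Archimedean2 by blast
    show "\<exists>N. \<forall>i\<ge>N. \<forall>j\<ge>N. norm2 M (\<lambda>x. (p x - m i x) - (p x - m j x)) \<le> e"
    proof (intro exI[of _ N] allI impI)
      fix i j assume ij: "i \<ge> N" "j \<ge> N"
      have "2 / real (Suc k) \<le> e\<^sup>2 / 2" if "k \<ge> N" for k
      proof -
        have "4 / e\<^sup>2 \<le> real (Suc k)" using N that by simp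
        then have "4 \<le> real (Suc k) * e\<^sup>2" using e by (simp add: divide_le_eq)
        then show ?thesis by (simp add: field_simps)
      qed
      from this[OF ij(1)] this[OF ij(2)] dist[of i j]
      have "(norm2 M (\<lambda>x. (p x - m i x) - (p x - m j x)))\<^sup>2 \<le> e\<^sup>2" by linarith
      then show "norm2 M (\<lambda>x. (p x - m i x) - (p x - m j x)) \<le> e" using e by (auto dest: power2_le_imp_le)
    qed
  qed
  have v_le: "norm2 M v \<le> sqrt \<delta>"
  proof (rule LIMSEQ_le)
    show "(\<lambda>n. norm2 M v) \<longlonglongrightarrow> norm2 M v" by simp
    show "(\<lambda>n. sqrt (\<delta> + 1 / real (Suc n)) + norm2 M (\<lambda>x. v x - (p x - m n x))) \<longlonglongrightarrow> sqrt \<delta>"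
      using tendsto_add[OF tendsto_real_sqrt[OF tendsto_add[OF tendsto_const[of \<delta>] lim_1_over_n[THEN LIMSEQ_Suc]]] v(2)]
      by simp
    have "norm2 M v \<le> sqrt (\<delta> + 1 / real (Suc n)) + norm2 M (\<lambda>x. v x - (p x - m n x))" for n
      using norm2_le_diff[OF v(1) pm[OF m(1)[of n]]] real_le_rsqrt[OF less_imp_le[OF m(2)[of n]]] by linarith
    then show "\<exists>N. \<forall>n\<ge>N. norm2 M v \<le> sqrt (\<delta> + 1 / real (Suc n)) + norm2 M (\<lambda>x. v x - (p x - m n x))" by blast
  qed
  \<comment> \<open>\<open>v\<close> need not have the form \<open>p - d\<close>, so minimality is
    transferred to it by approximation.\<close>
  have ge_\<delta>: "sqrt \<delta> \<le> norm2 M (\<lambda>x. v x - c * d x)" if d: "d \<in> D" for c d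
  proof (rule LIMSEQ_le)
    show "(\<lambda>n. sqrt \<delta>) \<longlonglongrightarrow> sqrt \<delta>" by simp
    show "(\<lambda>n. norm2 M (\<lambda>x. v x - c * d x) + norm2 M (\<lambda>x. v x - (p x - m n x))) \<longlonglongrightarrow> norm2 M (\<lambda>x. v x - c * d x)"
      using tendsto_add[OF tendsto_const v(2)] by simp
    have "sqrt \<delta> \<le> norm2 M (\<lambda>x. v x - c * d x) + norm2 M (\<lambda>x. v x - (p x - m n x))" for n
    proof -
      have 1: "(\<lambda>x. c * d x + m n x) \<in> D" by (intro lin d m)
      have 2: "(\<lambda>x. v x - c * d x) \<in> L2 M" using v(1) d D(1) by (intro L2_diff L2_cmult) auto
      have "sqrt \<delta> \<le> norm2 M (\<lambda>x. p x - (c * d x + m n x))"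
        using \<delta>_le[OF 1] by (intro real_le_lsqrt) auto
      also have "\<dots> \<le> norm2 M (\<lambda>x. v x - c * d x) +
          norm2 M (\<lambda>x. (p x - (c * d x + m n x)) - (v x - c * d x))"
        by (rule norm2_le_diff[OF pm[OF 1] 2])
      also have "norm2 M (\<lambda>x. (p x - (c * d x + m n x)) - (v x - c * d x)) = norm2 M (\<lambda>x. (p x - m n x) - v x)"
        by (simp add: algebra_simps)
      finally show ?thesis by (simp add: norm2_diff_commute[of M v])
    qed
    then show "\<exists>N. \<forall>n\<ge>N. sqrt \<delta> \<le> norm2 M (\<lambda>x. v x - c * d x) + norm2 M (\<lambda>x. v x - (p x - m n x))" by blast
  qed
  show ?thesis
  proof (rule that[OF v(1) m(1) v(2)])
    fix d assume d: "d \<in> D"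
    define a where "a = ip2 M v d"
    \<comment> \<open>For this step length the quadratic term of the perturbed distance is less than
      half the linear gain unless \<open>a = 0\<close>. The summand 1 in the denominator covers
      \<open>norm2 M d = 0\<close>.\<close>
    define t where "t = 1 / ((norm2 M d)\<^sup>2 + 1)"
    have t: "t > 0" "t * (norm2 M d)\<^sup>2 < 1"
      unfolding t_def by (auto simp: add_pos_nonneg add_nonneg_pos divide_less_eq)
    have dL: "d \<in> L2 M" using d D(1) by auto
    have "norm2 M v \<le> norm2 M (\<lambda>x. v x - (of_real t * a) * d x)"
      using v_le ge_\<delta>[OF d] order_trans by blast
    then have "(norm2 M v)\<^sup>2 \<le> (norm2 M (\<lambda>x. v x - (of_real t * a) * d x))\<^sup>2"
      by (intro power_mono) auto
    also have "\<dots> = (norm2 M v)\<^sup>2 - 2 * Re (cnj (of_real t * a) * a) + (cmod (of_real t * a) * norm2 M d)\<^sup>2"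
      by (simp add: norm2_diff_sq v(1) L2_cmult dL ip2_cmult_right norm2_cmult a_def)
    also have "Re (cnj (of_real t * a) * a) = t * (cmod a)\<^sup>2"
      unfolding cmod_power2 by (simp add: power2_eq_square algebra_simps)
    also have "(cmod (of_real t * a) * norm2 M d)\<^sup>2 = t * (cmod a)\<^sup>2 * (t * (norm2 M d)\<^sup>2)"
      using t by (simp add: norm_mult power2_eq_square)
    finally have "t * (cmod a)\<^sup>2 * 2 \<le> t * (cmod a)\<^sup>2 * (t * (norm2 M d)\<^sup>2)" by simp
    then have "\<not> t * (cmod a)\<^sup>2 > 0" using t(2) by (auto simp: mult_le_cancel_left)
    then show "ip2 M v d = 0" using t(1) by (simp add: a_def zero_less_mult_iff)
  qed
qed

text \<open>Banach's iteration on a closed subset of a complete seminormed space; the seminorm is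
  why the fixed point equation comes out almost everywhere.\<close>

lemma (in prob_space) L2_contraction_fixpoint:
  assumes S: "S \<subseteq> L2 M" "x0 \<in> S"
    and closed: "\<And>s f. (\<And>n. s n \<in> S) \<Longrightarrow> f \<in> L2 M \<Longrightarrow> (\<lambda>n. norm2 M (\<lambda>x. f x - s n x)) \<longlonglongrightarrow> 0 \<Longrightarrow> f \<in> S"
    and A: "\<And>f. f \<in> S \<Longrightarrow> A f \<in> S"
    and contr: "\<And>f g. f \<in> S \<Longrightarrow> g \<in> S \<Longrightarrow> norm2 M (\<lambda>x. A f x - A g x) \<le> r * norm2 M (\<lambda>x. f x - g x)"
    and r: "0 \<le> r" "r < 1"
  obtains f where "f \<in> S" "AE x in M. A f x = f x"
proof -
  define s where "s n = (A ^^ n) x0" for n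
  have s: "s n \<in> S" for n unfolding s_def by (induction n) (auto intro: A S(2))
  have sL: "s n \<in> L2 M" for n using s S(1) by blast
  define d where "d = norm2 M (\<lambda>x. s 1 x - s 0 x)"
  have step: "norm2 M (\<lambda>x. s (Suc n) x - s n x) \<le> r ^ n * d" for n
  proof (induction n)
    case (Suc n)
    have "norm2 M (\<lambda>x. s (Suc (Suc n)) x - s (Suc n) x) \<le> r * norm2 M (\<lambda>x. s (Suc n) x - s n x)"
      using contr[OF s[of "Suc n"] s[of n]] by (simp add: s_def)
    also have "\<dots> \<le> r * (r ^ n * d)" using Suc r by (intro mult_left_mono)
    finally show ?case by simp
  qed (simp add: d_def)
  have d0: "0 \<le> d" by (simp add: d_def)
  \<comment> \<open>The partial geometric sum is kept with its factor \<open>1 - r ^ k\<close>, so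
    that the induction closes; the factor is dropped afterwards.\<close>
  have far: "norm2 M (\<lambda>x. s (n + k) x - s n x) \<le> r ^ n * d / (1 - r) * (1 - r ^ k)" for n k
  proof (induction k)
    case 0
    show ?case by (simp add: norm2_def)
  next
    case (Suc k)
    have "norm2 M (\<lambda>x. s (n + Suc k) x - s n x) \<le> norm2 M (\<lambda>x. s (Suc (n + k)) x - s (n + k) x) + norm2 M (\<lambda>x. s (n + k) x - s n x)"
      using norm2_diff_triangle[OF sL sL sL] by simp
    also have "\<dots> \<le> r ^ (n + k) * d + r ^ n * d / (1 - r) * (1 - r ^ k)"
      by (intro add_mono step Suc)
    also have "\<dots> = r ^ n * d / (1 - r) * (1 - r ^ Suc k)"
      using r by (simp add: field_simps power_add)
    finally show ?case .
  qed
  have far': "norm2 M (\<lambda>x. s m x - s n x) \<le> r ^ n * d / (1 - r)" if "n \<le> m" for m n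
  proof -
    have "r ^ n * d / (1 - r) * (1 - r ^ (m - n)) \<le> r ^ n * d / (1 - r) * 1"
      using r d0 by (intro mult_left_mono) auto
    then show ?thesis using far[of n "m - n"] that by simp
  qed
  obtain f where f: "f \<in> L2 M" "(\<lambda>n. norm2 M (\<lambda>x. f x - s n x)) \<longlonglongrightarrow> 0"
  proof (rule L2_complete[OF sL])
    fix e :: real assume e: "e > 0"
    have "(\<lambda>n. r ^ n * d / (1 - r)) \<longlonglongrightarrow> 0 * d / (1 - r)"
      using r by (intro tendsto_intros LIMSEQ_realpow_zero) auto
    then have "\<forall>\<^sub>F n in sequentially. r ^ n * d / (1 - r) < e"
      using e by (intro order_tendstoD) auto
    then obtain N where N: "\<And>n. n \<ge> N \<Longrightarrow> r ^ n * d / (1 - r) < e"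
      unfolding eventually_sequentially by blast
    have le: "norm2 M (\<lambda>x. s m x - s n x) \<le> e" if "m \<ge> n" "n \<ge> N" for m n
      using far'[OF that(1)] N[OF that(2)] by linarith
    show "\<exists>N. \<forall>m\<ge>N. \<forall>n\<ge>N. norm2 M (\<lambda>x. s m x - s n x) \<le> e"
    proof (intro exI[of _ N] allI impI)
      fix m n assume "m \<ge> N" "n \<ge> N"
      then show "norm2 M (\<lambda>x. s m x - s n x) \<le> e"
        using le[of n m] le[of m n] norm2_diff_commute[of M "s m" "s n"] by (cases "n \<le> m") auto
    qed
  qed
  have fS: "f \<in> S" by (rule closed[OF s f])
  have AL: "A f \<in> L2 M" using A[OF fS] S(1) by blast
  have "norm2 M (\<lambda>x. A f x - f x) \<le> 0"
  proof (rule LIMSEQ_le)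
    show "(\<lambda>n. norm2 M (\<lambda>x. A f x - f x)) \<longlonglongrightarrow> norm2 M (\<lambda>x. A f x - f x)" by simp
    show "(\<lambda>n. r * norm2 M (\<lambda>x. f x - s n x) + norm2 M (\<lambda>x. f x - s (Suc n) x)) \<longlonglongrightarrow> 0"
      using tendsto_add[OF tendsto_mult_left[OF f(2), of r] LIMSEQ_Suc[OF f(2)]] by simp
    have "norm2 M (\<lambda>x. A f x - f x) \<le> r * norm2 M (\<lambda>x. f x - s n x) + norm2 M (\<lambda>x. f x - s (Suc n) x)" for n
    proof -
      have "norm2 M (\<lambda>x. A f x - f x) \<le> norm2 M (\<lambda>x. A f x - s (Suc n) x) + norm2 M (\<lambda>x. s (Suc n) x - f x)"
        by (rule norm2_diff_triangle[OF AL sL f(1)])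
      moreover have "norm2 M (\<lambda>x. A f x - s (Suc n) x) \<le> r * norm2 M (\<lambda>x. f x - s n x)"
        using contr[OF fS s[of n]] by (simp add: s_def)
      ultimately show ?thesis by (simp add: norm2_diff_commute[of M f])
    qed
    then show "\<exists>N. \<forall>n\<ge>N. norm2 M (\<lambda>x. A f x - f x) \<le> r * norm2 M (\<lambda>x. f x - s n x) + norm2 M (\<lambda>x. f x - s (Suc n) x)" by blast
  qed
  then have "norm2 M (\<lambda>x. A f x - f x) = 0" using norm2_nonneg order_antisym by blast
  then have "AE x in M. A f x = f x" using norm2_eq_0_iff[OF L2_diff[OF AL f(1)]] by simp
  with fS show ?thesis by (rule that)
qed

section \<open>Uniqueness of Fourier coefficients\<close>

lemma chars_add: "\<gamma> \<in> chars \<Longrightarrow> \<gamma> (a + b) = \<gamma> a * \<gamma> b"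
  and chars_norm: "\<gamma> \<in> chars \<Longrightarrow> cmod (\<gamma> a) = 1"
  by (auto simp: chars_def)

lemma chars_0: "\<gamma> \<in> chars \<Longrightarrow> \<gamma> 0 = 1"
  using chars_add[of \<gamma> 0 0] chars_norm[of \<gamma> 0] by force

lemma chars_uminus: "\<gamma> \<in> chars \<Longrightarrow> \<gamma> (- a) = cnj (\<gamma> a)"
proof -
  assume g: "\<gamma> \<in> chars"
  have "\<gamma> a * cnj (\<gamma> a) = 1" using chars_norm[OF g, of a] complex_norm_square[of "\<gamma> a"] by simp
  moreover have "\<gamma> (- a) * \<gamma> a = 1" using chars_add[OF g, of "- a" a] chars_0[OF g] by simp
  ultimately show ?thesis by (metis mult.assoc mult.commute mult_1)
qed

lemma chars_diff: "\<gamma> \<in> chars \<Longrightarrow> \<gamma> (a - b) = \<gamma> a * cnj (\<gamma> b)"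
  using chars_add[of \<gamma> a "- b"] chars_uminus[of \<gamma> b] by simp

lemma chars_mult: "c \<in> chars \<Longrightarrow> \<gamma> \<in> chars \<Longrightarrow> (\<lambda>x. c x * \<gamma> x) \<in> chars"
  by (auto simp: chars_def norm_mult)

locale haar_measure = prob_space \<mu> for \<mu> :: "('x::linordered_ab_group_add \<Rightarrow> complex) measure" +
  assumes haar: "haar \<mu>"
begin

abbreviation ft :: "(('x \<Rightarrow> complex) \<Rightarrow> complex) \<Rightarrow> 'x \<Rightarrow> complex" where
  "ft \<equiv> fourier \<mu>"

abbreviation nrm :: "(('x \<Rightarrow> complex) \<Rightarrow> complex) \<Rightarrow> real" where
  "nrm \<equiv> norm2 \<mu>"

abbreviation ip :: "(('x \<Rightarrow> complex) \<Rightarrow> complex) \<Rightarrow> (('x \<Rightarrow> complex) \<Rightarrow> complex) \<Rightarrow> complex" where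
  "ip \<equiv> ip2 \<mu>"

lemma space_haar: "space \<mu> = chars"
  and sets_haar: "sets \<mu> = sets (restrict_space (Pi\<^sub>M UNIV (\<lambda>_. borel)) chars)"
  and translate_haar: "c \<in> chars \<Longrightarrow> distr \<mu> \<mu> (\<lambda>\<gamma> x. c x * \<gamma> x) = \<mu>"
  using haar by (auto simp: haar_def)

lemma AE_chars: "(\<And>\<gamma>. \<gamma> \<in> chars \<Longrightarrow> P \<gamma>) \<Longrightarrow> AE \<gamma> in \<mu>. P \<gamma>"
  by (rule AE_I2) (simp add: space_haar)

lemma eval_measurable [measurable]: "(\<lambda>\<gamma>. \<gamma> \<xi>) \<in> borel_measurable \<mu>"
proof -
  have "(\<lambda>\<gamma>. \<gamma> \<xi>) \<in> measurable (restrict_space (Pi\<^sub>M UNIV (\<lambda>_. borel)) chars) (borel :: complex measure)"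
    by (intro measurable_restrict_space1 measurable_component_singleton) auto
  then show ?thesis
    using measurable_cong_sets[OF sets_haar refl, of "borel :: complex measure"] by simp
qed

text \<open>Translation by \<open>c\<close> multiplies the integral by \<open>c \<xi>\<close> and
  also leaves it unchanged; a \<open>c\<close> with \<open>c \<xi> \<noteq> 1\<close> makes it
  vanish.\<close>

lemma integral_char:
  assumes "\<xi> \<noteq> 0"
  shows "(\<integral>\<gamma>. \<gamma> \<xi> \<partial>\<mu>) = 0"
proof -
  obtain c where c: "c \<in> chars" "c \<xi> \<noteq> 1" using chars_separate[OF assms] by blast
  have "(\<lambda>\<gamma> x. c x * \<gamma> x) \<in> measurable \<mu> (restrict_space (Pi\<^sub>M UNIV (\<lambda>_. borel)) chars)"
  proof (rule measurable_restrict_space2)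
    show "(\<lambda>\<gamma> x. c x * \<gamma> x) \<in> space \<mu> \<rightarrow> chars" using chars_mult[OF c(1)] by (auto simp: space_haar)
    show "(\<lambda>\<gamma> x. c x * \<gamma> x) \<in> measurable \<mu> (Pi\<^sub>M UNIV (\<lambda>_. borel))"
      by (rule measurable_PiM_single') auto
  qed
  then have T: "(\<lambda>\<gamma> x. c x * \<gamma> x) \<in> measurable \<mu> \<mu>"
    using measurable_cong_sets[OF refl sets_haar, of \<mu>] by simp
  have "(\<integral>\<gamma>. \<gamma> \<xi> \<partial>\<mu>) = (\<integral>\<gamma>. \<gamma> \<xi> \<partial>distr \<mu> \<mu> (\<lambda>\<gamma> x. c x * \<gamma> x))"
    by (simp add: translate_haar[OF c(1)])
  also have "\<dots> = (\<integral>\<gamma>. c \<xi> * \<gamma> \<xi> \<partial>\<mu>)" by (rule integral_distr[OF T]) measurable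
  also have "\<dots> = c \<xi> * (\<integral>\<gamma>. \<gamma> \<xi> \<partial>\<mu>)" by simp
  finally show ?thesis using c(2) by simp
qed

text \<open>Vanishing of all Fourier coefficients, written without conjugation. The integral at
  \<open>\<xi>\<close> is the coefficient at \<open>- \<xi>\<close>, and in this form stability
  under multiplication by characters is immediate.\<close>

definition annih :: "(('x \<Rightarrow> complex) \<Rightarrow> complex) \<Rightarrow> bool" where
  "annih f \<longleftrightarrow> integrable \<mu> f \<and> (\<forall>\<xi>. (\<integral>\<gamma>. f \<gamma> * \<gamma> \<xi> \<partial>\<mu>) = 0)"

lemma integrable_bounded_mult:
  assumes "integrable \<mu> f" "g \<in> borel_measurable \<mu>" "AE \<gamma> in \<mu>. cmod (g \<gamma>) \<le> C"
  shows "integrable \<mu> (\<lambda>\<gamma>. f \<gamma> * g \<gamma>)"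
proof (rule Bochner_Integration.integrable_bound)
  show "integrable \<mu> (\<lambda>\<gamma>. of_real C * f \<gamma>)" using assms(1) by simp
  show "(\<lambda>\<gamma>. f \<gamma> * g \<gamma>) \<in> borel_measurable \<mu>" using assms(1,2) by measurable
  show "AE \<gamma> in \<mu>. cmod (f \<gamma> * g \<gamma>) \<le> cmod (of_real C * f \<gamma>)"
    using assms(3)
  proof eventually_elim
    case (elim \<gamma>)
    then have "cmod (f \<gamma>) * cmod (g \<gamma>) \<le> cmod (f \<gamma>) * \<bar>C\<bar>" by (intro mult_left_mono) auto
    then show ?case by (simp add: norm_mult mult.commute)
  qed
qed

lemma integrable_mult_char:
  "integrable \<mu> f \<Longrightarrow> integrable \<mu> (\<lambda>\<gamma>. f \<gamma> * \<gamma> \<xi>)"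
  by (rule integrable_bounded_mult[where C = 1]) (auto intro!: AE_chars simp: chars_norm)

lemma annih_mult_char:
  assumes "annih f" shows "annih (\<lambda>\<gamma>. f \<gamma> * \<gamma> \<eta>)"
proof -
  have "(\<integral>\<gamma>. f \<gamma> * \<gamma> \<eta> * \<gamma> \<xi> \<partial>\<mu>) = (\<integral>\<gamma>. f \<gamma> * \<gamma> (\<eta> + \<xi>) \<partial>\<mu>)" for \<xi>
    by (rule Bochner_Integration.integral_cong) (simp_all add: space_haar chars_add)
  then show ?thesis using assms integrable_mult_char by (simp add: annih_def)
qed

lemma annih_lincomb:
  assumes "annih f" "annih g" shows "annih (\<lambda>\<gamma>. a * f \<gamma> + b * g \<gamma>)"
  using assms integrable_mult_char[of f] integrable_mult_char[of g]
  by (simp add: annih_def ring_distribs mult.assoc)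

lemma annih_cong:
  assumes "annih f" "\<And>\<gamma>. \<gamma> \<in> chars \<Longrightarrow> f \<gamma> = g \<gamma>" shows "annih g"
proof -
  have "integrable \<mu> f = integrable \<mu> g"
    by (rule Bochner_Integration.integrable_cong) (simp_all add: space_haar assms)
  moreover have "(\<integral>\<gamma>. f \<gamma> * \<gamma> \<xi> \<partial>\<mu>) = (\<integral>\<gamma>. g \<gamma> * \<gamma> \<xi> \<partial>\<mu>)" for \<xi>
    by (rule Bochner_Integration.integral_cong) (simp_all add: space_haar assms)
  ultimately show ?thesis using assms(1) by (simp add: annih_def)
qed

text \<open>Dominated convergence with majorant \<open>C * cmod (f \<gamma>)\<close>: multipliers
  that keep \<open>f\<close> annihilating may be replaced by their bounded pointwise limits.\<close>

lemma annih_limit: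
  fixes s :: "nat \<Rightarrow> ('x \<Rightarrow> complex) \<Rightarrow> real"
  assumes f: "annih f" and s: "\<And>n. annih (\<lambda>\<gamma>. f \<gamma> * of_real (s n \<gamma>))"
    and bound: "\<And>n \<gamma>. \<gamma> \<in> chars \<Longrightarrow> \<bar>s n \<gamma>\<bar> \<le> C"
    and g: "g \<in> borel_measurable \<mu>" and lim: "\<And>\<gamma>. \<gamma> \<in> chars \<Longrightarrow> (\<lambda>n. s n \<gamma>) \<longlonglongrightarrow> g \<gamma>"
  shows "annih (\<lambda>\<gamma>. f \<gamma> * of_real (g \<gamma>))"
proof -
  have gC: "\<bar>g \<gamma>\<bar> \<le> C" if "\<gamma> \<in> chars" for \<gamma>
    using lim[OF that] bound[OF that] by (intro LIMSEQ_le_const2[OF tendsto_rabs]) auto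
  have int: "integrable \<mu> (\<lambda>\<gamma>. f \<gamma> * of_real (g \<gamma>))"
    using f gC g by (intro integrable_bounded_mult[where C = C] AE_chars) (auto simp: annih_def)
  have "(\<integral>\<gamma>. f \<gamma> * of_real (g \<gamma>) * \<gamma> \<xi> \<partial>\<mu>) = 0" for \<xi>
  proof (rule LIMSEQ_unique)
    show "(\<lambda>n. \<integral>\<gamma>. f \<gamma> * of_real (s n \<gamma>) * \<gamma> \<xi> \<partial>\<mu>) \<longlonglongrightarrow> (\<integral>\<gamma>. f \<gamma> * of_real (g \<gamma>) * \<gamma> \<xi> \<partial>\<mu>)"
    proof (rule integral_dominated_convergence)
      show "integrable \<mu> (\<lambda>\<gamma>. C * cmod (f \<gamma>))" using f by (auto simp: annih_def)
      show "AE \<gamma> in \<mu>. (\<lambda>n. f \<gamma> * of_real (s n \<gamma>) * \<gamma> \<xi>) \<longlonglongrightarrow> f \<gamma> * of_real (g \<gamma>) * \<gamma> \<xi>"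
        by (intro AE_chars tendsto_intros lim)
      show "AE \<gamma> in \<mu>. norm (f \<gamma> * of_real (s n \<gamma>) * \<gamma> \<xi>) \<le> C * cmod (f \<gamma>)" for n
        using bound by (intro AE_chars) (simp add: norm_mult chars_norm mult.commute[of C] mult_left_mono)
    qed (use int s integrable_mult_char in \<open>auto simp: annih_def intro!: borel_measurable_integrable\<close>)
    show "(\<lambda>n. \<integral>\<gamma>. f \<gamma> * of_real (s n \<gamma>) * \<gamma> \<xi> \<partial>\<mu>) \<longlonglongrightarrow> 0"
      using s by (simp add: annih_def)
  qed
  with int show ?thesis by (simp add: annih_def)
qed

text \<open>The aim is to show that every measurable set belongs here, so that an annihilating
  function has integral 0 over every set. Quantifying over all \<open>f\<close> makes the family
  closed under intersection: one indicator is multiplied in after the other.\<close>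

definition annih_sets :: "('x \<Rightarrow> complex) set set" where
  "annih_sets = {E \<in> sets \<mu>. \<forall>f. annih f \<longrightarrow> annih (\<lambda>\<gamma>. f \<gamma> * of_real (indicator E \<gamma>))}"

lemma sigma_algebra_annih_sets: "sigma_algebra chars annih_sets"
  unfolding sigma_algebra_iff2
proof (intro conjI ballI allI impI)
  show "annih_sets \<subseteq> Pow chars" unfolding annih_sets_def using sets.sets_into_space[of _ \<mu>] space_haar by auto
  show empty: "{} \<in> annih_sets" by (auto simp: annih_sets_def annih_def)
  show compl: "chars - E \<in> annih_sets" if "E \<in> annih_sets" for E
    unfolding annih_sets_def
  proof (intro CollectI conjI allI impI)
    show "chars - E \<in> sets \<mu>" using that sets.compl_sets[of E \<mu>] space_haar by (simp add: annih_sets_def)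
    fix f assume f: "annih f"
    then have "annih (\<lambda>\<gamma>. 1 * f \<gamma> + (- 1) * (f \<gamma> * of_real (indicator E \<gamma>)))"
      using that by (intro annih_lincomb) (auto simp: annih_sets_def)
    then show "annih (\<lambda>\<gamma>. f \<gamma> * of_real (indicator (chars - E) \<gamma>))"
      by (rule annih_cong) (auto simp: indicator_def)
  qed
  have inter: "E \<inter> F \<in> annih_sets" if "E \<in> annih_sets" "F \<in> annih_sets" for E F
    unfolding annih_sets_def
  proof (intro CollectI conjI allI impI)
    show "E \<inter> F \<in> sets \<mu>" using that by (auto simp: annih_sets_def)
    fix f assume "annih f"
    then have "annih (\<lambda>\<gamma>. f \<gamma> * of_real (indicator E \<gamma>) * of_real (indicator F \<gamma>))"
      using that by (auto simp: annih_sets_def)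
    then show "annih (\<lambda>\<gamma>. f \<gamma> * of_real (indicator (E \<inter> F) \<gamma>))"
      by (rule annih_cong) (auto simp: indicator_def)
  qed
  have union: "E \<union> F \<in> annih_sets" if "E \<in> annih_sets" "F \<in> annih_sets" for E F
  proof -
    have "E \<union> F = chars - ((chars - E) \<inter> (chars - F))"
      using that sets.sets_into_space[of _ \<mu>] space_haar by (auto simp: annih_sets_def)
    then show ?thesis using compl inter that by simp
  qed
  fix A :: "nat \<Rightarrow> ('x \<Rightarrow> complex) set" assume A: "range A \<subseteq> annih_sets"
  have fin: "(\<Union>i<n. A i) \<in> annih_sets" for n
    using A by (induction n) (auto simp: lessThan_Suc empty intro!: union)
  have meas: "(\<Union>i. A i) \<in> sets \<mu>" using A by (auto simp: annih_sets_def)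
  show "(\<Union>i. A i) \<in> annih_sets"
    unfolding annih_sets_def
  proof (intro CollectI conjI allI impI meas)
    fix f assume f: "annih f"
    show "annih (\<lambda>\<gamma>. f \<gamma> * of_real (indicator (\<Union>i. A i) \<gamma>))"
    proof (rule annih_limit[where s = "\<lambda>n \<gamma>. indicator (\<Union>i<n. A i) \<gamma>" and C = 1])
      show "annih (\<lambda>\<gamma>. f \<gamma> * of_real (indicator (\<Union>i<n. A i) \<gamma>))" for n
        using fin[of n] f by (simp add: annih_sets_def)
      show "(indicator (\<Union>i. A i) :: _ \<Rightarrow> real) \<in> borel_measurable \<mu>" using meas by simp
      show "(\<lambda>n. indicator (\<Union>i<n. A i) \<gamma> :: real) \<longlonglongrightarrow> indicator (\<Union>i. A i) \<gamma>" for \<gamma>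
        by (rule LIMSEQ_indicator_UN)
    qed (auto simp: f indicator_def)
  qed
qed

text \<open>If multiplication by \<open>g\<close> preserves annihilation, so does multiplication by
  a polynomial in \<open>g\<close>, then by Weierstrass approximation on [-1, 1] by a bounded
  continuous function of \<open>g\<close>, and finally by the indicator of a superlevel set.\<close>

lemma superlevel_in_annih_sets:
  assumes g: "g \<in> borel_measurable \<mu>" "\<And>\<gamma>. \<gamma> \<in> chars \<Longrightarrow> \<bar>g \<gamma>\<bar> \<le> (1::real)"
    and pres: "\<And>f. annih f \<Longrightarrow> annih (\<lambda>\<gamma>. f \<gamma> * of_real (g \<gamma>))"
  shows "{\<gamma> \<in> chars. a < g \<gamma>} \<in> annih_sets"
proof -
  have poly: "\<And>f. annih f \<Longrightarrow> annih (\<lambda>\<gamma>. f \<gamma> * of_real (q (g \<gamma>)))" if "real_polynomial_function q" for q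
    using that
  proof induction
    case (linear h)
    have h: "h t = t * h 1" for t using linear_cmul[OF bounded_linear.linear[OF linear(1)], of t 1] by simp
    have "annih (\<lambda>\<gamma>. of_real (h 1) * (f \<gamma> * of_real (g \<gamma>)) + 0 * f \<gamma>)"
      by (intro annih_lincomb pres linear(2))
    then show ?case by (rule annih_cong) (simp add: h[of "g _"])
  next
    case (const c)
    then show ?case using annih_lincomb[OF const const, of "of_real c" 0] by (simp add: mult.commute)
  next
    case (add q1 q2)
    show ?case using annih_lincomb[OF add(3)[OF add(5)] add(4)[OF add(5)], of 1 1] by (simp add: ring_distribs)
  next
    case (mult q1 q2)
    show ?case using mult(4)[OF mult(3)[OF mult(5)]] by (simp add: mult.assoc)
  qed
  have cont: "annih (\<lambda>\<gamma>. f \<gamma> * of_real (q (g \<gamma>)))"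
    if f: "annih f" and q: "continuous_on UNIV q" "\<And>t. \<bar>q t\<bar> \<le> 1" for f and q :: "real \<Rightarrow> real"
  proof -
    have "\<exists>h. real_polynomial_function h \<and> (\<forall>t\<in>{-1..1}. \<bar>q t - h t\<bar> < 1 / real (Suc n))" for n
      using Stone_Weierstrass_real_polynomial_function[of "{-1..1}" q "1 / real (Suc n)"]
        continuous_on_subset[OF q(1)] by (metis compact_Icc of_nat_0_less_iff subset_UNIV zero_less_Suc zero_less_divide_1_iff)
    then obtain h where h: "\<And>n. real_polynomial_function (h n)"
      "\<And>n t. t \<in> {-1..1} \<Longrightarrow> \<bar>q t - h n t\<bar> < 1 / real (Suc n)"
      by metis
    have gI: "g \<gamma> \<in> {-1..1}" if "\<gamma> \<in> chars" for \<gamma> using g(2)[OF that] by auto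
    show ?thesis
    proof (rule annih_limit[OF f, where s = "\<lambda>n \<gamma>. h n (g \<gamma>)" and C = 2])
      show "annih (\<lambda>\<gamma>. f \<gamma> * of_real (h n (g \<gamma>)))" for n by (rule poly[OF h(1) f])
      fix \<gamma> :: "'x \<Rightarrow> complex" assume \<gamma>: "\<gamma> \<in> chars"
      show "\<bar>h n (g \<gamma>)\<bar> \<le> 2" for n
      proof -
        have "1 / real (Suc n) \<le> 1" by simp
        then show ?thesis using h(2)[OF gI[OF \<gamma>], of n] q(2)[of "g \<gamma>"] by linarith
      qed
      have "(\<lambda>n. q (g \<gamma>) - h n (g \<gamma>)) \<longlonglongrightarrow> 0"
      proof (rule Lim_null_comparison)
        show "\<forall>\<^sub>F n in sequentially. norm (q (g \<gamma>) - h n (g \<gamma>)) \<le> 1 / real (Suc n)"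
          using h(2)[OF gI[OF \<gamma>]] by (auto intro!: always_eventually less_imp_le)
        show "(\<lambda>n. 1 / real (Suc n)) \<longlonglongrightarrow> 0" by (rule LIMSEQ_Suc[OF lim_1_over_n])
      qed
      from tendsto_diff[OF tendsto_const[of "q (g \<gamma>)"] this]
      show "(\<lambda>n. h n (g \<gamma>)) \<longlonglongrightarrow> q (g \<gamma>)" by simp
    next
      show "(\<lambda>\<gamma>. q (g \<gamma>)) \<in> borel_measurable \<mu>"
        using measurable_compose[OF g(1) borel_measurable_continuous_onI[OF q(1)]] .
    qed
  qed
  have meas: "{\<gamma> \<in> chars. a < g \<gamma>} \<in> sets \<mu>"
    using g(1) unfolding borel_measurable_iff_greater space_haar by simp
  show ?thesis
    unfolding annih_sets_def
  proof (intro CollectI conjI allI impI meas)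
    fix f assume f: "annih f"
    \<comment> \<open>Ramps that leave the level \<open>a\<close> with slope \<open>n\<close> and
      are cut off at 1 converge to the indicator; on \<open>g \<gamma> = a\<close> they are 0,
      matching the strict inequality.\<close>
    show "annih (\<lambda>\<gamma>. f \<gamma> * of_real (indicator {\<gamma> \<in> chars. a < g \<gamma>} \<gamma>))"
    proof (rule annih_limit[OF f, where s = "\<lambda>n \<gamma>. min 1 (max 0 (real n * (g \<gamma> - a)))" and C = 1])
      show "annih (\<lambda>\<gamma>. f \<gamma> * of_real (min 1 (max 0 (real n * (g \<gamma> - a)))))" for n
        by (rule cont[of f "\<lambda>t. min 1 (max 0 (real n * (t - a)))"]) (auto intro!: continuous_intros f)
      show "(indicator {\<gamma> \<in> chars. a < g \<gamma>} :: _ \<Rightarrow> real) \<in> borel_measurable \<mu>" using meas by simp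
      fix \<gamma> :: "'x \<Rightarrow> complex" assume \<gamma>: "\<gamma> \<in> chars"
      show "\<bar>min 1 (max 0 (real n * (g \<gamma> - a)))\<bar> \<le> 1" for n by auto
      show "(\<lambda>n. min 1 (max 0 (real n * (g \<gamma> - a)))) \<longlonglongrightarrow> indicator {\<gamma> \<in> chars. a < g \<gamma>} \<gamma>"
      proof (cases "a < g \<gamma>")
        case True
        obtain N where N: "1 / (g \<gamma> - a) < real N" using reals_Archimedean2 by blast
        have "min 1 (max 0 (real n * (g \<gamma> - a))) = 1" if "n \<ge> N" for n
        proof -
          have "1 / (g \<gamma> - a) \<le> real n" using N that by simp
          then have "1 \<le> real n * (g \<gamma> - a)" using True by (simp add: divide_le_eq)
          then show ?thesis by simp
        qed
        then have "\<forall>\<^sub>F n in sequentially. min 1 (max 0 (real n * (g \<gamma> - a))) = 1"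
          unfolding eventually_sequentially by blast
        then show ?thesis using True \<gamma> by (simp add: tendsto_eventually)
      next
        case False
        then have "max 0 (real n * (g \<gamma> - a)) = 0" for n by (intro max_absorb1 mult_nonneg_nonpos) auto
        then show ?thesis using False by simp
      qed
    qed
  qed
qed

text \<open>Real and imaginary parts of an evaluation are combinations of two characters, so they
  preserve annihilation and are measurable for \<open>annih_sets\<close>. As \<open>\<mu>\<close>
  carries the sigma-algebra generated by evaluations, the identity map from
  \<open>annih_sets\<close> to \<open>\<mu>\<close> is measurable.\<close>

lemma sets_haar_subset_annih_sets: "sets \<mu> \<subseteq> annih_sets"
proof -
  interpret D: sigma_algebra chars annih_sets by (rule sigma_algebra_annih_sets)
  define S where "S = sigma chars annih_sets"
  have S: "sets S = annih_sets" "space S = chars"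
    unfolding S_def using D.sets_measure_of_eq D.space_closed by auto
  have Re: "(\<lambda>\<gamma>. Re (\<gamma> \<xi>)) \<in> borel_measurable S" for \<xi>
    unfolding borel_measurable_iff_greater S
  proof
    fix a
    show "{\<gamma> \<in> chars. a < Re (\<gamma> \<xi>)} \<in> annih_sets"
    proof (rule superlevel_in_annih_sets)
      show "\<bar>Re (\<gamma> \<xi>)\<bar> \<le> 1" if "\<gamma> \<in> chars" for \<gamma> using abs_Re_le_cmod[of "\<gamma> \<xi>"] chars_norm[OF that] by simp
      fix f assume "annih f"
      then have "annih (\<lambda>\<gamma>. (1/2) * (f \<gamma> * \<gamma> \<xi>) + (1/2) * (f \<gamma> * \<gamma> (- \<xi>)))"
        by (intro annih_lincomb annih_mult_char)
      then show "annih (\<lambda>\<gamma>. f \<gamma> * of_real (Re (\<gamma> \<xi>)))"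
        by (rule annih_cong) (simp add: chars_uminus complex_eq_iff field_simps)
    qed measurable
  qed
  have Im: "(\<lambda>\<gamma>. Im (\<gamma> \<xi>)) \<in> borel_measurable S" for \<xi>
    unfolding borel_measurable_iff_greater S
  proof
    fix a
    show "{\<gamma> \<in> chars. a < Im (\<gamma> \<xi>)} \<in> annih_sets"
    proof (rule superlevel_in_annih_sets)
      show "\<bar>Im (\<gamma> \<xi>)\<bar> \<le> 1" if "\<gamma> \<in> chars" for \<gamma> using abs_Im_le_cmod[of "\<gamma> \<xi>"] chars_norm[OF that] by simp
      fix f assume "annih f"
      then have "annih (\<lambda>\<gamma>. (- \<i>/2) * (f \<gamma> * \<gamma> \<xi>) + (\<i>/2) * (f \<gamma> * \<gamma> (- \<xi>)))"
        by (intro annih_lincomb annih_mult_char)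
      then show "annih (\<lambda>\<gamma>. f \<gamma> * of_real (Im (\<gamma> \<xi>)))"
        by (rule annih_cong) (simp add: chars_uminus complex_eq_iff field_simps)
    qed measurable
  qed
  have "(\<lambda>\<gamma>. \<gamma> \<xi>) \<in> borel_measurable S" for \<xi>
    using Re Im by (simp add: borel_measurable_complex_iff)
  then have "(\<lambda>\<gamma> \<xi>. \<gamma> \<xi>) \<in> measurable S (Pi\<^sub>M UNIV (\<lambda>_. borel :: complex measure))"
    by (intro measurable_PiM_single') auto
  then have "(\<lambda>\<gamma>. \<gamma>) \<in> measurable S (restrict_space (Pi\<^sub>M UNIV (\<lambda>_. borel :: complex measure)) chars)"
    by (intro measurable_restrict_space2) (auto simp: S)
  then have id: "(\<lambda>\<gamma>. \<gamma>) \<in> measurable S \<mu>"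
    using measurable_cong_sets[OF refl sets_haar, of S] by simp
  show ?thesis
  proof
    fix E assume E: "E \<in> sets \<mu>"
    then have "E \<subseteq> chars" using sets.sets_into_space space_haar by blast
    then show "E \<in> annih_sets" using measurable_sets[OF id E] by (simp add: S Int_absorb2)
  qed
qed

lemma annih_AE_zero:
  assumes "annih f" shows "AE \<gamma> in \<mu>. f \<gamma> = 0"
proof (rule density_zero)
  show "integrable \<mu> f" using assms by (simp add: annih_def)
  fix E assume "E \<in> sets \<mu>"
  then have "annih (\<lambda>\<gamma>. f \<gamma> * of_real (indicator E \<gamma>))"
    using sets_haar_subset_annih_sets assms by (auto simp: annih_sets_def)
  then have "(\<integral>\<gamma>. f \<gamma> * of_real (indicator E \<gamma>) * \<gamma> 0 \<partial>\<mu>) = 0" by (simp add: annih_def)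
  also have "(\<integral>\<gamma>. f \<gamma> * of_real (indicator E \<gamma>) * \<gamma> 0 \<partial>\<mu>) = set_lebesgue_integral \<mu> E f"
    unfolding set_lebesgue_integral_def
    by (rule Bochner_Integration.integral_cong) (simp_all add: space_haar chars_0 scaleR_conv_of_real mult.commute)
  finally show "set_lebesgue_integral \<mu> E f = 0" .
qed

lemma fourier_zero_AE_zero:
  assumes f: "integrable \<mu> f" "\<And>\<xi>. ft f \<xi> = 0"
  shows "AE \<gamma> in \<mu>. f \<gamma> = 0"
proof (rule annih_AE_zero)
  have "(\<integral>\<gamma>. f \<gamma> * \<gamma> \<xi> \<partial>\<mu>) = ft f (- \<xi>)" for \<xi>
    unfolding fourier_def
    by (rule Bochner_Integration.integral_cong) (simp_all add: space_haar chars_uminus)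
  with f show "annih f" by (simp add: annih_def)
qed

end

section \<open>The Riesz--Fischer theorem and Hardy spaces\<close>

lemma has_sum_zero_imp:
  fixes s :: complex
  assumes "(f has_sum s) A" "\<And>x. f x = 0"
  shows "s = 0"
  using has_sum_unique[OF assms(1) has_sum_0] assms(2) by simp

context haar_measure
begin

lemma char_L2: "(\<lambda>\<gamma>. \<gamma> \<xi>) \<in> L2 \<mu>"
  by (rule L2_bounded[where C = 1]) (auto intro!: AE_chars simp: chars_norm)

lemma L2_mult_char: "f \<in> L2 \<mu> \<Longrightarrow> (\<lambda>\<gamma>. f \<gamma> * \<gamma> \<xi>) \<in> L2 \<mu>"
  unfolding mult.commute[of "f _"]
  by (rule L2_bounded_mult[where C = 1]) (auto intro!: AE_chars simp: chars_norm)

lemma fourier_ip2: "ft f \<xi> = ip f (\<lambda>\<gamma>. \<gamma> \<xi>)"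
  by (simp add: fourier_def ip2_def)

lemma fourier_char: "ft (\<lambda>\<gamma>. \<gamma> \<eta>) \<xi> = (if \<xi> = \<eta> then 1 else 0)"
proof -
  have "ft (\<lambda>\<gamma>. \<gamma> \<eta>) \<xi> = (\<integral>\<gamma>. \<gamma> (\<eta> - \<xi>) \<partial>\<mu>)"
    unfolding fourier_def by (rule Bochner_Integration.integral_cong) (simp_all add: space_haar chars_diff)
  also have "\<dots> = (if \<xi> = \<eta> then 1 else 0)"
  proof (cases "\<xi> = \<eta>")
    case True
    have "(\<integral>\<gamma>. \<gamma> (\<eta> - \<xi>) \<partial>\<mu>) = (\<integral>\<gamma>. 1 \<partial>\<mu>)"
      by (rule Bochner_Integration.integral_cong) (simp_all add: space_haar chars_0 True)
    then show ?thesis using True by (simp add: prob_space)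
  next
    case False
    then show ?thesis using integral_char[of "\<eta> - \<xi>"] by simp
  qed
  finally show ?thesis .
qed

lemma fourier_add: "f \<in> L2 \<mu> \<Longrightarrow> g \<in> L2 \<mu> \<Longrightarrow> ft (\<lambda>\<gamma>. f \<gamma> + g \<gamma>) \<xi> = ft f \<xi> + ft g \<xi>"
  and fourier_diff: "f \<in> L2 \<mu> \<Longrightarrow> g \<in> L2 \<mu> \<Longrightarrow> ft (\<lambda>\<gamma>. f \<gamma> - g \<gamma>) \<xi> = ft f \<xi> - ft g \<xi>"
  and fourier_cmult: "ft (\<lambda>\<gamma>. c * f \<gamma>) \<xi> = c * ft f \<xi>"
  by (simp_all add: fourier_ip2 ip2_add_left ip2_diff_left ip2_cmult_left char_L2)

lemma fourier_cnj: "ft (\<lambda>\<gamma>. cnj (f \<gamma>)) \<xi> = cnj (ft f (- \<xi>))"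
proof -
  have "ft (\<lambda>\<gamma>. cnj (f \<gamma>)) \<xi> = (\<integral>\<gamma>. cnj (f \<gamma> * cnj (\<gamma> (- \<xi>))) \<partial>\<mu>)"
    unfolding fourier_def by (rule Bochner_Integration.integral_cong) (simp_all add: space_haar chars_uminus)
  then show ?thesis unfolding fourier_def by (simp only: Bochner_Integration.integral_cnj)
qed

lemma fourier_mult_char: "ft (\<lambda>\<gamma>. f \<gamma> * \<gamma> \<eta>) \<xi> = ft f (\<xi> - \<eta>)"
  unfolding fourier_def by (rule Bochner_Integration.integral_cong) (simp_all add: space_haar chars_diff)

lemma fourier_cong_AE:
  assumes "f \<in> borel_measurable \<mu>" "g \<in> borel_measurable \<mu>" "AE \<gamma> in \<mu>. f \<gamma> = g \<gamma>"
  shows "ft f = ft g"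
  unfolding fourier_def using assms by (auto intro!: ext integral_cong_AE)

lemma fourier_eq_imp_AE_eq:
  assumes f: "integrable \<mu> f" and g: "integrable \<mu> g" and eq: "\<And>\<xi>. ft f \<xi> = ft g \<xi>"
  shows "AE \<gamma> in \<mu>. f \<gamma> = g \<gamma>"
proof -
  have c: "integrable \<mu> (\<lambda>\<gamma>. h \<gamma> * cnj (\<gamma> \<xi>))" if "integrable \<mu> h" for h \<xi>
    by (rule integrable_bounded_mult[OF that, where C = 1]) (auto intro!: AE_chars simp: chars_norm)
  have "AE \<gamma> in \<mu>. f \<gamma> - g \<gamma> = 0"
  proof (rule fourier_zero_AE_zero)
    show "ft (\<lambda>\<gamma>. f \<gamma> - g \<gamma>) \<xi> = 0" for \<xi>
      using eq[of \<xi>] c[OF f] c[OF g] by (simp add: fourier_def left_diff_distrib)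
  qed (use f g in simp)
  then show ?thesis by simp
qed

lemma fourier_tendsto:
  assumes "f \<in> L2 \<mu>" "\<And>n. s n \<in> L2 \<mu>" "((\<lambda>n. nrm (\<lambda>\<gamma>. f \<gamma> - s n \<gamma>)) \<longlongrightarrow> 0) F"
  shows "((\<lambda>n. ft (s n) \<xi>) \<longlongrightarrow> ft f \<xi>) F"
  unfolding fourier_ip2 by (rule ip2_tendsto[OF assms(1,2) char_L2 assms(3)])

section \<open>Trigonometric polynomials, Fourier series and Parseval\<close>

definition trig :: "'x set \<Rightarrow> ('x \<Rightarrow> complex) \<Rightarrow> ('x \<Rightarrow> complex) \<Rightarrow> complex" where
  "trig F k \<gamma> = (\<Sum>\<xi>\<in>F. k \<xi> * \<gamma> \<xi>)"

lemma trig_L2: "trig F k \<in> L2 \<mu>"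
proof (cases "finite F")
  case True
  then show ?thesis
  proof (induction F)
    case empty
    then show ?case using L2_cmult[OF char_L2[of 0], of 0] by (simp add: trig_def[abs_def])
  next
    case (insert \<xi> F)
    then show ?case
      using L2_add[OF L2_cmult[OF char_L2[of \<xi>], of "k \<xi>"] insert(3)] by (simp add: trig_def[abs_def])
  qed
next
  \<comment> \<open>A sum over an infinite index set is 0 by convention.\<close>
  case False
  then show ?thesis using L2_cmult[OF char_L2[of 0], of 0] by (simp add: trig_def[abs_def])
qed

lemma ip2_trig_left:
  assumes "f \<in> L2 \<mu>" "finite F"
  shows "ip (trig F k) f = (\<Sum>\<xi>\<in>F. k \<xi> * cnj (ft f \<xi>))"
  using assms(2)
proof induction
  case empty
  then show ?case by (simp add: trig_def[abs_def] ip2_def)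
next
  case (insert \<xi> F)
  have "trig (insert \<xi> F) k = (\<lambda>\<gamma>. k \<xi> * \<gamma> \<xi> + trig F k \<gamma>)"
    using insert by (simp add: trig_def[abs_def])
  then show ?case
    using insert assms(1) ip2_commute[of \<mu> "\<lambda>\<gamma>. \<gamma> \<xi>" f]
    by (simp add: ip2_add_left L2_cmult char_L2 trig_L2 ip2_cmult_left fourier_ip2)
qed

lemma fourier_trig:
  assumes "finite F"
  shows "ft (trig F k) \<eta> = (if \<eta> \<in> F then k \<eta> else 0)"
proof -
  have "ft (trig F k) \<eta> = (\<Sum>\<xi>\<in>F. k \<xi> * (if \<xi> = \<eta> then 1 else 0))"
    unfolding fourier_ip2[of "trig F k"] ip2_trig_left[OF char_L2 assms] by (simp add: fourier_char if_distrib cong: if_cong)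
  then show ?thesis using assms by (simp add: if_distrib sum.delta' cong: if_cong)
qed

lemma norm2_trig:
  assumes "finite F"
  shows "(nrm (trig F k))\<^sup>2 = (\<Sum>\<xi>\<in>F. (cmod (k \<xi>))\<^sup>2)"
proof -
  have "complex_of_real ((nrm (trig F k))\<^sup>2) = (\<Sum>\<xi>\<in>F. k \<xi> * cnj (k \<xi>))"
    unfolding ip2_self[symmetric] ip2_trig_left[OF trig_L2 assms] by (simp add: fourier_trig assms)
  also have "\<dots> = complex_of_real (\<Sum>\<xi>\<in>F. (cmod (k \<xi>))\<^sup>2)"
    unfolding of_real_sum complex_norm_square ..
  finally show ?thesis by (simp only: of_real_eq_iff)
qed

definition trig_polys :: "'x set \<Rightarrow> (('x \<Rightarrow> complex) \<Rightarrow> complex) set" where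
  "trig_polys A = {trig F k | F k. finite F \<and> F \<subseteq> A}"

lemma trig_mono:
  assumes "finite G" "F \<subseteq> G"
  shows "trig F k = trig G (\<lambda>\<xi>. if \<xi> \<in> F then k \<xi> else 0)"
proof
  fix \<gamma>
  show "trig F k \<gamma> = trig G (\<lambda>\<xi>. if \<xi> \<in> F then k \<xi> else 0) \<gamma>"
    unfolding trig_def using assms by (intro sum.mono_neutral_cong_left) auto
qed

lemma trig_polys_lincomb:
  assumes "d \<in> trig_polys A" "e \<in> trig_polys A"
  shows "(\<lambda>\<gamma>. c * d \<gamma> + e \<gamma>) \<in> trig_polys A"
proof -
  obtain F k G l where *: "d = trig F k" "e = trig G l" "finite F" "finite G" "F \<subseteq> A" "G \<subseteq> A"
    using assms by (auto simp: trig_polys_def)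
  define k' where "k' = (\<lambda>\<xi>. if \<xi> \<in> F then k \<xi> else 0)"
  define l' where "l' = (\<lambda>\<xi>. if \<xi> \<in> G then l \<xi> else 0)"
  have "d = trig (F \<union> G) k'" "e = trig (F \<union> G) l'"
    unfolding * k'_def l'_def using * by (auto intro!: trig_mono)
  then have "(\<lambda>\<gamma>. c * d \<gamma> + e \<gamma>) = trig (F \<union> G) (\<lambda>\<xi>. c * k' \<xi> + l' \<xi>)"
    by (auto simp: trig_def sum_distrib_left sum.distrib ring_distribs mult.assoc)
  then show ?thesis using * by (auto simp: trig_polys_def)
qed

text \<open>The remainder is orthogonal to every trigonometric polynomial on \<open>F\<close>, so
  Pythagoras applies. Allowing a smaller \<open>G\<close> makes one good approximant control all
  finite sets above it.\<close>

lemma trig_best_approx: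
  assumes f: "f \<in> L2 \<mu>" and F: "finite F" "G \<subseteq> F"
  shows "nrm (\<lambda>\<gamma>. f \<gamma> - trig F (ft f) \<gamma>) \<le> nrm (\<lambda>\<gamma>. f \<gamma> - trig G k \<gamma>)"
proof (rule power2_le_imp_le)
  define r where "r = (\<lambda>\<gamma>. f \<gamma> - trig F (ft f) \<gamma>)"
  define k' where "k' = (\<lambda>\<xi>. ft f \<xi> - (if \<xi> \<in> G then k \<xi> else 0))"
  have r: "r \<in> L2 \<mu>" unfolding r_def by (intro L2_diff f trig_L2)
  have fr: "ft r \<xi> = 0" if "\<xi> \<in> F" for \<xi>
    unfolding r_def by (simp add: fourier_diff f trig_L2 fourier_trig F that)
  have "ip (trig F k') r = 0"
    unfolding ip2_trig_left[OF r F(1)] by (simp add: fr)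
  then have "ip r (trig F k') = 0" using ip2_commute[of \<mu> r "trig F k'"] by simp
  moreover have "(\<lambda>\<gamma>. f \<gamma> - trig G k \<gamma>) = (\<lambda>\<gamma>. r \<gamma> + trig F k' \<gamma>)"
    unfolding r_def k'_def trig_mono[OF F, of k] by (auto simp: trig_def algebra_simps sum_subtractf)
  ultimately have "(nrm (\<lambda>\<gamma>. f \<gamma> - trig G k \<gamma>))\<^sup>2 = (nrm r)\<^sup>2 + (nrm (trig F k'))\<^sup>2"
    using norm2_add_sq[OF r trig_L2[of F k']] by simp
  then show "(nrm (\<lambda>\<gamma>. f \<gamma> - trig F (ft f) \<gamma>))\<^sup>2 \<le> (nrm (\<lambda>\<gamma>. f \<gamma> - trig G k \<gamma>))\<^sup>2"
    unfolding r_def by simp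
qed simp

text \<open>The remainder of \<open>f\<close> orthogonal to all trigonometric polynomials has zero
  coefficients, hence vanishes almost everywhere by uniqueness. So some sequence of polynomials
  tends to \<open>f\<close>, and best approximation upgrades this to convergence along all finite
  subsets.\<close>

lemma fourier_series_converges:
  assumes f: "f \<in> L2 \<mu>"
  shows "((\<lambda>F. nrm (\<lambda>\<gamma>. f \<gamma> - trig F (ft f) \<gamma>)) \<longlongrightarrow> 0) (finite_subsets_at_top UNIV)"
proof -
  obtain v m where v: "v \<in> L2 \<mu>" "\<And>n. m n \<in> trig_polys UNIV"
    "(\<lambda>n. nrm (\<lambda>\<gamma>. v \<gamma> - (f \<gamma> - m n \<gamma>))) \<longlonglongrightarrow> 0" "\<And>d. d \<in> trig_polys UNIV \<Longrightarrow> ip v d = 0"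
  proof (rule L2_projection[OF _ _ trig_polys_lincomb f])
    show "trig_polys UNIV \<subseteq> L2 \<mu>" using trig_L2 by (auto simp: trig_polys_def)
    show "trig_polys UNIV \<noteq> {}" by (auto simp: trig_polys_def)
  qed auto
  have "(\<lambda>\<gamma>. \<gamma> \<xi>) \<in> trig_polys UNIV" for \<xi>
    unfolding trig_polys_def by (rule CollectI, rule exI[of _ "{\<xi>}"], rule exI[of _ "\<lambda>_. 1"]) (simp add: trig_def[abs_def])
  then have "ft v \<xi> = 0" for \<xi> unfolding fourier_ip2 by (rule v(4))
  then have v0: "AE \<gamma> in \<mu>. v \<gamma> = 0" by (intro fourier_zero_AE_zero L2_integrable v(1))
  have mL: "m n \<in> L2 \<mu>" for n using v(2)[of n] trig_L2 by (auto simp: trig_polys_def)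
  have "nrm (\<lambda>\<gamma>. v \<gamma> - (f \<gamma> - m n \<gamma>)) = nrm (\<lambda>\<gamma>. f \<gamma> - m n \<gamma>)" for n
  proof -
    have "nrm (\<lambda>\<gamma>. v \<gamma> - (f \<gamma> - m n \<gamma>)) = nrm (\<lambda>\<gamma>. - (f \<gamma> - m n \<gamma>))"
      by (rule norm2_cong_AE) (use v0 in \<open>auto intro!: L2_measurable L2_diff v(1) f mL borel_measurable_uminus\<close>)
    then show ?thesis by (simp only: norm2_uminus)
  qed
  with v(3) have lim: "(\<lambda>n. nrm (\<lambda>\<gamma>. f \<gamma> - m n \<gamma>)) \<longlonglongrightarrow> 0" by simp
  show ?thesis
  proof (rule tendstoI)
    fix e :: real assume "e > 0"
    with lim have "\<forall>\<^sub>F n in sequentially. nrm (\<lambda>\<gamma>. f \<gamma> - m n \<gamma>) < e" by (rule order_tendstoD)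
    then obtain n where n: "nrm (\<lambda>\<gamma>. f \<gamma> - m n \<gamma>) < e" unfolding eventually_sequentially by blast
    obtain G k where G: "finite G" "m n = trig G k" using v(2)[of n] by (auto simp: trig_polys_def)
    have "dist (nrm (\<lambda>\<gamma>. f \<gamma> - trig F (ft f) \<gamma>)) 0 < e" if "finite F" "G \<subseteq> F" for F
      using trig_best_approx[OF f that, of k] n G(2) by simp
    then show "\<forall>\<^sub>F F in finite_subsets_at_top UNIV. dist (nrm (\<lambda>\<gamma>. f \<gamma> - trig F (ft f) \<gamma>)) 0 < e"
      unfolding eventually_finite_subsets_at_top using G(1) by blast
  qed
qed

lemma parseval:
  assumes f: "f \<in> L2 \<mu>" and g: "g \<in> L2 \<mu>"
  shows "((\<lambda>\<xi>. ft f \<xi> * cnj (ft g \<xi>)) has_sum ip f g) UNIV"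
proof -
  have "((\<lambda>F. ip (trig F (ft f)) g) \<longlongrightarrow> ip f g) (finite_subsets_at_top UNIV)"
    by (rule ip2_tendsto[OF f trig_L2 g fourier_series_converges[OF f]])
  then show ?thesis unfolding has_sum_def
    by (rule Lim_transform_eventually) (auto simp: ip2_trig_left[OF g] intro: eventually_finite_subsets_at_top_weakI)
qed

lemma parseval_norm:
  assumes f: "f \<in> L2 \<mu>"
  shows "((\<lambda>\<xi>. (cmod (ft f \<xi>))\<^sup>2) has_sum (nrm f)\<^sup>2) UNIV"
  using has_sum_Re[OF parseval[OF f f]] by (simp add: ip2_self complex_norm_square[symmetric] del: of_real_power flip: of_real_power)

lemma fourier_l2space: "f \<in> L2 \<mu> \<Longrightarrow> ft f \<in> l2space UNIV"
  using parseval_norm by (auto simp: l2space_def summable_on_def)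

lemma l2norm_fourier: "f \<in> L2 \<mu> \<Longrightarrow> l2norm (ft f) = nrm f"
  unfolding l2norm_def using infsumI[OF parseval_norm] by simp

text \<open>Parseval applied to \<open>f\<close> and the conjugate of \<open>g\<close> times a
  character. The product itself need only be integrable.\<close>

lemma fourier_mult:
  assumes f: "f \<in> L2 \<mu>" and g: "g \<in> L2 \<mu>"
  shows "((\<lambda>\<eta>. ft f \<eta> * ft g (\<xi> - \<eta>)) has_sum ft (\<lambda>\<gamma>. f \<gamma> * g \<gamma>) \<xi>) UNIV"
proof -
  have "((\<lambda>\<eta>. ft f \<eta> * cnj (ft (\<lambda>\<gamma>. cnj (g \<gamma>) * \<gamma> \<xi>) \<eta>)) has_sum
      ip f (\<lambda>\<gamma>. cnj (g \<gamma>) * \<gamma> \<xi>)) UNIV"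
    by (rule parseval[OF f L2_mult_char[OF L2_cnj[OF g]]])
  moreover have "ip f (\<lambda>\<gamma>. cnj (g \<gamma>) * \<gamma> \<xi>) = ft (\<lambda>\<gamma>. f \<gamma> * g \<gamma>) \<xi>"
    by (simp add: ip2_def fourier_def mult.assoc)
  ultimately show ?thesis by (simp add: fourier_mult_char fourier_cnj)
qed

text \<open>\<open>X\<close> may be uncountable, so the series is tamed by finite sets
  \<open>F n\<close> outside of which every finite sum of squares is at most
  \<open>1 / (n + 1)\<close>; the partial sums over them form a Cauchy sequence.\<close>

lemma riesz_fischer:
  assumes g: "g \<in> l2space UNIV"
  shows "\<exists>f. f \<in> L2 \<mu> \<and> ft f = g"
proof -
  define a where "a \<xi> = (cmod (g \<xi>))\<^sup>2" for \<xi>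
  obtain S where S: "(a has_sum S) UNIV"
    using g unfolding l2space_def summable_on_def a_def by auto
  have "\<exists>F. finite F \<and> (\<forall>G. finite G \<longrightarrow> G \<inter> F = {} \<longrightarrow> sum a G \<le> 1 / real (Suc n))" for n
  proof -
    have "\<forall>\<^sub>F F in finite_subsets_at_top UNIV. S - 1 / real (Suc n) < sum a F"
      using S unfolding has_sum_def by (rule order_tendstoD) simp
    then obtain F where F: "finite F" "S - 1 / real (Suc n) < sum a F"
      unfolding eventually_finite_subsets_at_top by auto
    have "sum a G \<le> 1 / real (Suc n)" if "finite G" "G \<inter> F = {}" for G
    proof -
      have "sum a (G \<union> F) \<le> S"
        using S that F by (intro finite_sum_le_has_sum) (auto simp: a_def)
      then show ?thesis using F that by (simp add: sum.union_disjoint)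
    qed
    with F show ?thesis by blast
  qed
  then obtain F where F: "\<And>n. finite (F n)"
    "\<And>n G. finite G \<Longrightarrow> G \<inter> F n = {} \<Longrightarrow> sum a G \<le> 1 / real (Suc n)"
    by metis
  define s where "s n = trig (F n) g" for n
  have sL: "s n \<in> L2 \<mu>" for n unfolding s_def by (rule trig_L2)
  have tail: "nrm (trig (F m - F n) g) \<le> sqrt (1 / real (Suc n))" for m n
  proof (rule real_le_rsqrt)
    show "(nrm (trig (F m - F n) g))\<^sup>2 \<le> 1 / real (Suc n)"
      using F(2)[of "F m - F n" n] F(1)[of m] unfolding a_def by (subst norm2_trig) auto
  qed
  have diff: "nrm (\<lambda>\<gamma>. s m \<gamma> - s n \<gamma>) \<le> sqrt (1 / real (Suc n)) + sqrt (1 / real (Suc m))" for m n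
  proof -
    \<comment> \<open>The sets \<open>F n\<close> need not be nested: the common part cancels, and
      each of the two set differences is a tail.\<close>
    have "trig (F i) g \<gamma> = trig (F i - F j) g \<gamma> + trig (F i \<inter> F j) g \<gamma>" for i j \<gamma>
      unfolding trig_def using sum.Int_Diff[OF F(1), of "\<lambda>\<xi>. g \<xi> * \<gamma> \<xi>" i "F j"] by (simp add: add.commute)
    from this[of m _ n] this[of n _ m]
    have "(\<lambda>\<gamma>. s m \<gamma> - s n \<gamma>) = (\<lambda>\<gamma>. trig (F m - F n) g \<gamma> + (- 1) * trig (F n - F m) g \<gamma>)"
      unfolding s_def by (auto simp: Int_commute[of "F n"])
    then have "nrm (\<lambda>\<gamma>. s m \<gamma> - s n \<gamma>) \<le> nrm (trig (F m - F n) g) + nrm (\<lambda>\<gamma>. (- 1) * trig (F n - F m) g \<gamma>)"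
      by (simp only:) (intro norm2_triangle trig_L2 L2_cmult)
    also have "nrm (\<lambda>\<gamma>. (- 1) * trig (F n - F m) g \<gamma>) = nrm (trig (F n - F m) g)"
      by (simp add: norm2_uminus)
    finally show ?thesis using tail[of m n] tail[of n m] by linarith
  qed
  have inv0: "(\<lambda>n. sqrt (1 / real (Suc n))) \<longlonglongrightarrow> 0"
    using tendsto_real_sqrt[OF LIMSEQ_Suc[OF lim_1_over_n]] by simp
  obtain f where f: "f \<in> L2 \<mu>" "(\<lambda>n. nrm (\<lambda>x. f x - s n x)) \<longlonglongrightarrow> 0"
  proof (rule L2_complete[OF sL])
    fix e :: real assume "e > 0"
    then have "\<forall>\<^sub>F n in sequentially. sqrt (1 / real (Suc n)) < e / 2"
      using inv0 by (intro order_tendstoD) auto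
    then obtain N where N: "\<And>n. n \<ge> N \<Longrightarrow> sqrt (1 / real (Suc n)) < e / 2"
      unfolding eventually_sequentially by blast
    show "\<exists>N. \<forall>m\<ge>N. \<forall>n\<ge>N. nrm (\<lambda>x. s m x - s n x) \<le> e"
    proof (intro exI[of _ N] allI impI)
      fix m n assume "m \<ge> N" "n \<ge> N"
      then show "nrm (\<lambda>x. s m x - s n x) \<le> e" using diff[of m n] N[of m] N[of n] by linarith
    qed
  qed
  \<comment> \<open>When \<open>\<xi>\<close> lies outside \<open>F n\<close>, the singleton is
    itself a tail, so \<open>g \<xi>\<close> is small; otherwise the coefficient of
    \<open>s n\<close> is exact.\<close>
  have "ft f \<xi> = g \<xi>" for \<xi>
  proof (rule LIMSEQ_unique[OF fourier_tendsto[OF f(1) sL f(2)]])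
    have "(\<lambda>n. g \<xi> - ft (s n) \<xi>) \<longlonglongrightarrow> 0"
    proof (rule Lim_null_comparison[OF _ inv0])
      have "cmod (g \<xi> - ft (s n) \<xi>) \<le> sqrt (1 / real (Suc n))" for n
      proof (cases "\<xi> \<in> F n")
        case False
        then have "(cmod (g \<xi>))\<^sup>2 \<le> 1 / real (Suc n)" using F(2)[of "{\<xi>}" n] by (simp add: a_def)
        then show ?thesis unfolding s_def using False by (subst fourier_trig[OF F(1)]) (auto intro: real_le_rsqrt)
      qed (simp add: s_def fourier_trig F)
      then show "\<forall>\<^sub>F n in sequentially. norm (g \<xi> - ft (s n) \<xi>) \<le> sqrt (1 / real (Suc n))" by simp
    qed
    from tendsto_diff[OF tendsto_const[of "g \<xi>"] this] show "(\<lambda>n. ft (s n) \<xi>) \<longlonglongrightarrow> g \<xi>" by simp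
  qed
  with f(1) show ?thesis by auto
qed

text \<open>Each coefficient is a continuous functional on L2, and on a partial sum it equals
  \<open>k \<xi>\<close> as soon as the finite set contains \<open>\<xi>\<close>.\<close>

lemma is_check_imp_fourier:
  assumes "is_check \<mu> k f"
  shows "f \<in> L2 \<mu>" "ft f = k"
proof -
  show f: "f \<in> L2 \<mu>" using assms by (simp add: is_check_def L2_def)
  have "((\<lambda>F. nrm (\<lambda>\<gamma>. f \<gamma> - trig F k \<gamma>)) \<longlongrightarrow> sqrt 0) (finite_subsets_at_top UNIV)"
    unfolding norm2_def trig_def using assms by (intro tendsto_real_sqrt) (simp add: is_check_def)
  then have lim: "((\<lambda>F. ft (trig F k) \<xi>) \<longlongrightarrow> ft f \<xi>) (finite_subsets_at_top UNIV)" for \<xi>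
    by (intro fourier_tendsto f trig_L2) simp
  show "ft f = k"
  proof
    fix \<xi>
    have "\<forall>\<^sub>F F in finite_subsets_at_top UNIV. ft (trig F k) \<xi> = k \<xi>"
      unfolding eventually_finite_subsets_at_top
      by (rule exI[of _ "{\<xi>}"]) (auto simp: fourier_trig)
    then have "((\<lambda>F. ft (trig F k) \<xi>) \<longlongrightarrow> k \<xi>) (finite_subsets_at_top UNIV)"
      by (rule tendsto_eventually)
    from tendsto_unique[OF finite_subsets_at_top_neq_bot lim this] show "ft f \<xi> = k \<xi>" .
  qed
qed

text \<open>Inverse Fourier transform by choice of a representative. It is determined only up to
  null sets, so linearity is available only almost everywhere.\<close>

definition synth :: "('x \<Rightarrow> complex) \<Rightarrow> ('x \<Rightarrow> complex) \<Rightarrow> complex" where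
  "synth g = (SOME f. f \<in> L2 \<mu> \<and> ft f = g)"

lemma synth_L2: "g \<in> l2space UNIV \<Longrightarrow> synth g \<in> L2 \<mu>"
  and fourier_synth: "g \<in> l2space UNIV \<Longrightarrow> ft (synth g) = g"
  using someI_ex[OF riesz_fischer[of g]] by (simp_all add: synth_def)

section \<open>The Hardy space, its complement and the projection between them\<close>

definition H2 :: "(('x \<Rightarrow> complex) \<Rightarrow> complex) set" where
  "H2 = {f \<in> L2 \<mu>. \<forall>\<xi><0. ft f \<xi> = 0}"

definition H2m :: "(('x \<Rightarrow> complex) \<Rightarrow> complex) set" where
  "H2m = {f \<in> L2 \<mu>. \<forall>\<xi>\<ge>0. ft f \<xi> = 0}"

text \<open>Defined through coefficients alone, so functions that agree almost everywhere have
  literally equal projections.\<close>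

definition proj :: "(('x \<Rightarrow> complex) \<Rightarrow> complex) \<Rightarrow> ('x \<Rightarrow> complex) \<Rightarrow> complex" where
  "proj f = synth (\<lambda>\<xi>. if 0 \<le> \<xi> then ft f \<xi> else 0)"

lemma l2space_restrict:
  assumes "g \<in> l2space UNIV"
  shows "(\<lambda>\<xi>. if \<xi> \<in> A then g \<xi> else 0) \<in> l2space UNIV"
proof -
  have "(\<lambda>\<xi>. (cmod (g \<xi>))\<^sup>2) summable_on UNIV" using assms by (simp add: l2space_def)
  then have "(\<lambda>\<xi>. (cmod (if \<xi> \<in> A then g \<xi> else 0))\<^sup>2) summable_on UNIV"
    by (rule summable_on_comparison_test) auto
  then show ?thesis by (simp add: l2space_def)
qed

lemma proj_l2space: "f \<in> L2 \<mu> \<Longrightarrow> (\<lambda>\<xi>. if 0 \<le> \<xi> then ft f \<xi> else 0) \<in> l2space UNIV"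
  using l2space_restrict[OF fourier_l2space, of f "{0..}"] by simp

lemma fourier_proj: "f \<in> L2 \<mu> \<Longrightarrow> ft (proj f) \<xi> = (if 0 \<le> \<xi> then ft f \<xi> else 0)"
  unfolding proj_def by (simp add: fourier_synth proj_l2space)

lemma proj_L2: "f \<in> L2 \<mu> \<Longrightarrow> proj f \<in> L2 \<mu>"
  unfolding proj_def by (intro synth_L2 proj_l2space)

lemma proj_H2: "f \<in> L2 \<mu> \<Longrightarrow> proj f \<in> H2"
  by (auto simp: H2_def proj_L2 fourier_proj)

lemma H2_L2: "f \<in> H2 \<Longrightarrow> f \<in> L2 \<mu>" and H2m_L2: "f \<in> H2m \<Longrightarrow> f \<in> L2 \<mu>"
  by (auto simp: H2_def H2m_def)

lemma H2D: "f \<in> H2 \<Longrightarrow> \<xi> < 0 \<Longrightarrow> ft f \<xi> = 0"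
  by (simp add: H2_def)

lemma diff_proj_H2m: "f \<in> L2 \<mu> \<Longrightarrow> (\<lambda>\<gamma>. f \<gamma> - proj f \<gamma>) \<in> H2m"
  by (auto simp: H2m_def L2_diff proj_L2 fourier_diff fourier_proj)

lemma H2_lincomb: "f \<in> H2 \<Longrightarrow> g \<in> H2 \<Longrightarrow> (\<lambda>\<gamma>. c * f \<gamma> + g \<gamma>) \<in> H2"
  by (auto simp: H2_def L2_add L2_cmult fourier_add fourier_cmult)

lemma H2_cmult: "f \<in> H2 \<Longrightarrow> (\<lambda>\<gamma>. c * f \<gamma>) \<in> H2"
  by (auto simp: H2_def L2_cmult fourier_cmult)

lemma H2_diff: "f \<in> H2 \<Longrightarrow> g \<in> H2 \<Longrightarrow> (\<lambda>\<gamma>. f \<gamma> - g \<gamma>) \<in> H2"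
  by (auto simp: H2_def L2_diff fourier_diff)

lemma fourier_one: "ft (\<lambda>\<gamma>. 1) \<xi> = (if \<xi> = 0 then 1 else 0)"
proof -
  have "ft (\<lambda>\<gamma>. 1) \<xi> = ft (\<lambda>\<gamma>. \<gamma> 0) \<xi>"
    unfolding fourier_def by (rule Bochner_Integration.integral_cong) (simp_all add: space_haar chars_0)
  then show ?thesis by (simp add: fourier_char)
qed

lemma one_L2: "(\<lambda>\<gamma>. 1) \<in> L2 \<mu>" by (rule L2_bounded[where C = 1]) auto

lemma one_H2: "(\<lambda>\<gamma>. 1) \<in> H2"
  by (simp add: H2_def fourier_one one_L2)

lemma H2_closed:
  assumes "\<And>n::nat. s n \<in> H2" "f \<in> L2 \<mu>" "(\<lambda>n. nrm (\<lambda>\<gamma>. f \<gamma> - s n \<gamma>)) \<longlonglongrightarrow> 0"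
  shows "f \<in> H2"
proof -
  have "ft f \<xi> = 0" if "\<xi> < 0" for \<xi>
  proof (rule LIMSEQ_unique[OF fourier_tendsto[OF assms(2) H2_L2[OF assms(1)] assms(3)]])
    show "(\<lambda>n. ft (s n) \<xi>) \<longlonglongrightarrow> 0" using assms(1) that by (simp add: H2_def)
  qed
  with assms(2) show ?thesis by (simp add: H2_def)
qed

lemma ip2_H2_H2m:
  assumes "f \<in> H2" "b \<in> H2m"
  shows "ip f b = 0" "ip b f = 0"
proof -
  have "ft f \<xi> * cnj (ft b \<xi>) = 0" for \<xi>
    using assms by (cases "\<xi> < 0") (auto simp: H2_def H2m_def)
  with parseval[OF H2_L2[OF assms(1)] H2m_L2[OF assms(2)]]
  show "ip f b = 0" by (rule has_sum_zero_imp)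
  then show "ip b f = 0" using ip2_commute[of \<mu> b f] by simp
qed

lemma proj_ip2_left: "f \<in> L2 \<mu> \<Longrightarrow> e \<in> H2 \<Longrightarrow> ip (proj f) e = ip f e"
  using ip2_H2_H2m(2)[of e "\<lambda>\<gamma>. f \<gamma> - proj f \<gamma>"] diff_proj_H2m[of f]
  by (simp add: ip2_diff_left proj_L2 H2_L2)

lemma norm2_proj:
  assumes "f \<in> L2 \<mu>"
  shows "(nrm f)\<^sup>2 = (nrm (proj f))\<^sup>2 + (nrm (\<lambda>\<gamma>. f \<gamma> - proj f \<gamma>))\<^sup>2"
  using norm2_add_sq[OF proj_L2[OF assms] H2m_L2[OF diff_proj_H2m[OF assms]]]
    ip2_H2_H2m(1)[OF proj_H2[OF assms] diff_proj_H2m[OF assms]] by simp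

lemma norm2_proj_le:
  assumes "f \<in> L2 \<mu>"
  shows "nrm (proj f) \<le> nrm f" "nrm (\<lambda>\<gamma>. f \<gamma> - proj f \<gamma>) \<le> nrm f"
  using norm2_proj[OF assms] by - (rule power2_le_imp_le; simp)+

lemma L2_fourier_eq_imp_AE_eq:
  "f \<in> L2 \<mu> \<Longrightarrow> g \<in> L2 \<mu> \<Longrightarrow> (\<And>\<xi>. ft f \<xi> = ft g \<xi>) \<Longrightarrow> AE \<gamma> in \<mu>. f \<gamma> = g \<gamma>"
  by (intro fourier_eq_imp_AE_eq L2_integrable)

text \<open>In the convolution sum at a negative frequency one of the two frequencies is negative;
  at 0 only the pair of zeros survives, which makes the mean multiplicative. The claims concern
  coefficients because a product of two elements of \<open>H2\<close> may fail to be square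
  integrable.\<close>

lemma fourier_mult_H2:
  assumes f: "f \<in> H2" and g: "g \<in> H2"
  shows "\<xi> < 0 \<Longrightarrow> ft (\<lambda>\<gamma>. f \<gamma> * g \<gamma>) \<xi> = 0"
    and "ft (\<lambda>\<gamma>. f \<gamma> * g \<gamma>) 0 = ft f 0 * ft g 0"
proof -
  note sum = fourier_mult[OF H2_L2[OF f] H2_L2[OF g]]
  show "ft (\<lambda>\<gamma>. f \<gamma> * g \<gamma>) \<xi> = 0" if "\<xi> < 0"
  proof -
    have "ft f \<eta> * ft g (\<xi> - \<eta>) = 0" for \<eta>
    proof (cases "\<eta> < 0")
      case False
      then have "\<xi> < \<eta>" using that by (meson not_less less_le_trans)
      then have "\<xi> - \<eta> < 0" by simp
      then show ?thesis using g by (simp add: H2_def)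
    qed (use f in \<open>simp add: H2_def\<close>)
    with sum[of \<xi>] show ?thesis by (rule has_sum_zero_imp)
  qed
  have "ft f \<eta> * ft g (0 - \<eta>) = 0" if "\<eta> \<noteq> 0" for \<eta>
  proof (cases "\<eta> < 0")
    case False
    then have "0 - \<eta> < 0" using that by (simp add: order_less_le)
    from H2D[OF g this] show ?thesis by simp
  qed (use f in \<open>simp add: H2_def\<close>)
  then have "((\<lambda>\<eta>. ft f \<eta> * ft g (0 - \<eta>)) has_sum ft (\<lambda>\<gamma>. f \<gamma> * g \<gamma>) 0) {0}"
    using sum[of 0] by (subst has_sum_cong_neutral[where T = UNIV and g = "\<lambda>\<eta>. ft f \<eta> * ft g (0 - \<eta>)"]) auto
  from has_sum_unique[OF this has_sum_finite[of "{0}"]]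
  show "ft (\<lambda>\<gamma>. f \<gamma> * g \<gamma>) 0 = ft f 0 * ft g 0" by simp
qed

text \<open>A conjugated analytic function has frequencies at most 0 and \<open>b\<close> has
  frequencies below 0, so their sums stay below 0.\<close>

lemma fourier_cnj_mult_H2m:
  assumes f: "f \<in> H2" and b: "b \<in> H2m" and "0 \<le> \<xi>"
  shows "ft (\<lambda>\<gamma>. cnj (f \<gamma>) * b \<gamma>) \<xi> = 0"
proof -
  have "ft (\<lambda>\<gamma>. cnj (f \<gamma>)) \<eta> * ft b (\<xi> - \<eta>) = 0" for \<eta>
  proof (cases "0 < \<eta>")
    case True
    then show ?thesis using f by (simp add: H2_def fourier_cnj)
  next
    case False
    then have "\<eta> \<le> \<xi>" using assms(3) by (meson not_less order_trans)
    then have "0 \<le> \<xi> - \<eta>" by simp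
    then show ?thesis using b by (simp add: H2m_def)
  qed
  with fourier_mult[OF L2_cnj[OF H2_L2[OF f]] H2m_L2[OF b], of \<xi>]
  show ?thesis by (rule has_sum_zero_imp)
qed

end

section \<open>Outer factors\<close>

context haar_measure
begin

text \<open>For a real function the coefficient at \<open>- \<xi>\<close> is the conjugate of that
  at \<open>\<xi>\<close>, so vanishing on one side gives vanishing on both.\<close>

lemma real_analytic_const:
  fixes D :: "('x \<Rightarrow> complex) \<Rightarrow> real"
  assumes D: "integrable \<mu> D" and pos: "\<And>\<xi>. \<xi> > 0 \<Longrightarrow> ft (\<lambda>\<gamma>. of_real (D \<gamma>)) \<xi> = 0"
  shows "AE \<gamma> in \<mu>. D \<gamma> = (\<integral>\<gamma>. D \<gamma> \<partial>\<mu>)"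
proof -
  define c where "c = (\<integral>\<gamma>. D \<gamma> \<partial>\<mu>)"
  have "AE \<gamma> in \<mu>. complex_of_real (D \<gamma>) = of_real c * 1"
  proof (rule fourier_eq_imp_AE_eq)
    show "integrable \<mu> (\<lambda>\<gamma>. complex_of_real (D \<gamma>))" using D by simp
    fix \<xi> :: 'x
    have f0: "ft (\<lambda>\<gamma>. of_real (D \<gamma>)) 0 = of_real c"
    proof -
      have "ft (\<lambda>\<gamma>. of_real (D \<gamma>)) 0 = (\<integral>\<gamma>. of_real (D \<gamma>) \<partial>\<mu>)"
        unfolding fourier_def by (rule Bochner_Integration.integral_cong) (simp_all add: space_haar chars_0)
      then show ?thesis by (simp add: c_def)
    qed
    have neg: "ft (\<lambda>\<gamma>. of_real (D \<gamma>)) \<xi> = 0" if "\<xi> < 0"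
      using fourier_cnj[of "\<lambda>\<gamma>. of_real (D \<gamma>)" \<xi>] pos[of "- \<xi>"] that by simp
    show "ft (\<lambda>\<gamma>. of_real (D \<gamma>)) \<xi> = ft (\<lambda>\<gamma>. of_real c * 1) \<xi>"
      unfolding fourier_cmult fourier_one using f0 neg pos[of \<xi>] by (cases \<xi> "0::'x" rule: linorder_cases) auto
  qed simp
  then have "AE \<gamma> in \<mu>. complex_of_real (D \<gamma>) = complex_of_real c" by simp
  then show ?thesis unfolding c_def[symmetric] by (simp only: of_real_eq_iff)
qed

lemma ip2_mult_char: "ip (\<lambda>\<gamma>. f \<gamma> * \<gamma> \<xi>) g = ip f (\<lambda>\<gamma>. g \<gamma> * \<gamma> (- \<xi>))"
  unfolding ip2_def
  by (rule Bochner_Integration.integral_cong) (simp_all add: space_haar chars_uminus mult_ac)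

lemma fourier_norm_sq:
  "ft (\<lambda>\<gamma>. of_real ((cmod (f \<gamma>))\<^sup>2)) \<xi> = ip f (\<lambda>\<gamma>. f \<gamma> * \<gamma> \<xi>)"
  unfolding fourier_def ip2_def complex_norm_square by (simp add: mult.assoc)

lemma H2_mult_char: "f \<in> H2 \<Longrightarrow> 0 \<le> \<xi> \<Longrightarrow> (\<lambda>\<gamma>. f \<gamma> * \<gamma> \<xi>) \<in> H2"
  unfolding H2_def by (auto simp: L2_mult_char fourier_mult_char intro: le_less_trans less_le_trans)

lemma zero_H2: "(\<lambda>\<gamma>. 0) \<in> H2"
  using H2_cmult[OF one_H2, of 0] by simp

lemma H2_mult_trig:
  assumes p: "p \<in> H2" and F: "finite F" "F \<subseteq> {0..}"
  shows "(\<lambda>\<gamma>. p \<gamma> * trig F k \<gamma>) \<in> H2"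
  using F
proof induction
  case empty
  then show ?case by (simp add: trig_def zero_H2)
next
  case (insert \<xi> F)
  have "(\<lambda>\<gamma>. k \<xi> * (p \<gamma> * \<gamma> \<xi>) + p \<gamma> * trig F k \<gamma>) \<in> H2"
    using insert by (intro H2_lincomb H2_mult_char p) auto
  then show ?case using insert by (simp add: trig_def ring_distribs mult_ac)
qed

lemma ip2_mult_trig_zero:
  assumes p: "p \<in> H2" and w: "w \<in> L2 \<mu>" and F: "finite F" "F \<subseteq> {0..}"
    and "\<And>\<eta>. \<eta> \<in> F \<Longrightarrow> ip w (\<lambda>\<gamma>. p \<gamma> * \<gamma> \<eta>) = 0"
  shows "ip w (\<lambda>\<gamma>. p \<gamma> * trig F k \<gamma>) = 0"
  using F assms(5)
proof induction
  case empty
  then show ?case by (simp add: trig_def ip2_def)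
next
  case (insert \<xi> F)
  have "(\<lambda>\<gamma>. p \<gamma> * trig (insert \<xi> F) k \<gamma>) = (\<lambda>\<gamma>. k \<xi> * (p \<gamma> * \<gamma> \<xi>) + p \<gamma> * trig F k \<gamma>)"
    using insert by (simp add: trig_def ring_distribs mult_ac)
  moreover have "(\<lambda>\<gamma>. p \<gamma> * trig F k \<gamma>) \<in> L2 \<mu>" using H2_mult_trig[OF p, of F] insert H2_L2 by auto
  ultimately show ?case
    using insert w H2_L2[OF p] by (simp add: ip2_add_right L2_cmult L2_mult_char ip2_cmult_right)
qed

text \<open>The function \<open>v\<close> is \<open>p\<close> minus its projection onto the closed span of the \<open>p \<xi>\<close> with \<open>\<xi> > 0\<close>;
  orthogonality forces \<open>\<bar>v\<bar>\<close> to be constant, so \<open>v\<close> is the inner factor of \<open>p\<close> up to scaling.\<close>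

lemma inner_outer_factorization:
  assumes p: "p \<in> H2" and c: "c > 0" "AE \<gamma> in \<mu>. c \<le> (cmod (p \<gamma>))\<^sup>2"
  obtains u v r c' where "u \<in> H2" "v \<in> H2" "r \<in> H2" "c' > 0"
    "AE \<gamma> in \<mu>. (cmod (v \<gamma>))\<^sup>2 = c'" "AE \<gamma> in \<mu>. p \<gamma> = u \<gamma> * v \<gamma>" "AE \<gamma> in \<mu>. u \<gamma> * r \<gamma> = 1"
proof -
  define D where "D = {(\<lambda>\<gamma>. p \<gamma> * q \<gamma>) | q. q \<in> trig_polys {0<..}}"
  have DI: "(\<lambda>\<gamma>. p \<gamma> * q \<gamma>) \<in> D" if "q \<in> trig_polys {0<..}" for q
    unfolding D_def using that by blast
  have DH2: "D \<subseteq> H2"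
    unfolding D_def trig_polys_def using H2_mult_trig[OF p] by (force simp: subset_iff)
  note pL = H2_L2[OF p]
  obtain v m where v: "v \<in> L2 \<mu>" "\<And>n. m n \<in> D"
    "(\<lambda>n. nrm (\<lambda>\<gamma>. v \<gamma> - (p \<gamma> - m n \<gamma>))) \<longlonglongrightarrow> 0" "\<And>d. d \<in> D \<Longrightarrow> ip v d = 0"
  proof (rule L2_projection[of D p])
    show "D \<subseteq> L2 \<mu>" using DH2 H2_L2 by blast
    show "D \<noteq> {}" unfolding D_def trig_polys_def by blast
    fix a d e assume "d \<in> D" "e \<in> D"
    then obtain q1 q2 where q: "q1 \<in> trig_polys {0<..}" "q2 \<in> trig_polys {0<..}"
      "d = (\<lambda>\<gamma>. p \<gamma> * q1 \<gamma>)" "e = (\<lambda>\<gamma>. p \<gamma> * q2 \<gamma>)" unfolding D_def by blast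
    then have "(\<lambda>\<gamma>. a * d \<gamma> + e \<gamma>) = (\<lambda>\<gamma>. p \<gamma> * (a * q1 \<gamma> + q2 \<gamma>))" by (simp add: ring_distribs mult_ac)
    then show "(\<lambda>\<gamma>. a * d \<gamma> + e \<gamma>) \<in> D" using DI[OF trig_polys_lincomb[OF q(1,2), of a]] by simp
  qed (use pL in auto)
  have "\<exists>F k. m n = (\<lambda>\<gamma>. p \<gamma> * trig F k \<gamma>) \<and> finite F \<and> F \<subseteq> {0<..}" for n
    using v(2)[of n] unfolding D_def trig_polys_def by blast
  then obtain F k where m: "\<And>n. m n = (\<lambda>\<gamma>. p \<gamma> * trig (F n) (k n) \<gamma>)" "\<And>n. finite (F n)" "\<And>n. F n \<subseteq> {0<..}"
    by metis
  define s where "s n = (\<lambda>\<gamma>. p \<gamma> - m n \<gamma>)" for n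
  have sH: "s n \<in> H2" for n unfolding s_def using v(2) DH2 by (intro H2_diff p) auto
  have slim: "(\<lambda>n. nrm (\<lambda>\<gamma>. v \<gamma> - s n \<gamma>)) \<longlonglongrightarrow> 0" using v(3) by (simp add: s_def)
  have vH: "v \<in> H2" by (rule H2_closed[OF sH v(1) slim])
  have vp: "ip v (\<lambda>\<gamma>. p \<gamma> * \<gamma> \<xi>) = 0" if "\<xi> > 0" for \<xi>
  proof (rule v(4))
    have "(\<lambda>\<gamma>. \<gamma> \<xi>) = trig {\<xi>} (\<lambda>_. 1)" by (simp add: trig_def[abs_def])
    moreover have "trig {\<xi>} (\<lambda>_. 1) \<in> trig_polys {0<..}" unfolding trig_polys_def using that by blast
    ultimately show "(\<lambda>\<gamma>. p \<gamma> * \<gamma> \<xi>) \<in> D" by (intro DI) simp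
  qed
  have vv: "ip v (\<lambda>\<gamma>. v \<gamma> * \<gamma> \<xi>) = 0" if \<xi>: "\<xi> > 0" for \<xi>
  proof -
    \<comment> \<open>Moving the character across shifts each frequency of \<open>p\<close> from at
      least 0 to above 0, where \<open>v\<close> is orthogonal. So \<open>w\<close> is orthogonal to
      \<open>p\<close> and to each \<open>m n\<close>, hence to the limit \<open>v\<close> of their
      differences.\<close>
    define w where "w = (\<lambda>\<gamma>. v \<gamma> * \<gamma> (- \<xi>))"
    have w: "w \<in> L2 \<mu>" unfolding w_def by (rule L2_mult_char[OF v(1)])
    have wp: "ip w (\<lambda>\<gamma>. p \<gamma> * \<gamma> \<eta>) = 0" if "0 \<le> \<eta>" for \<eta>
    proof -
      have "ip w (\<lambda>\<gamma>. p \<gamma> * \<gamma> \<eta>) = ip v (\<lambda>\<gamma>. p \<gamma> * \<gamma> \<eta> * \<gamma> \<xi>)"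
        unfolding w_def ip2_mult_char by simp
      also have "\<dots> = ip v (\<lambda>\<gamma>. p \<gamma> * \<gamma> (\<eta> + \<xi>))"
        unfolding ip2_def by (rule Bochner_Integration.integral_cong) (simp_all add: space_haar chars_add)
      also have "\<dots> = 0" by (rule vp) (simp add: \<xi> that add_nonneg_pos)
      finally show ?thesis .
    qed
    have "ip w (s n) = 0" for n
    proof -
      have "ip w (m n) = 0"
        unfolding m(1) by (rule ip2_mult_trig_zero[OF p w m(2)]) (use m(3)[of n] wp in \<open>force+\<close>)
      moreover have "ip w p = ip w (\<lambda>\<gamma>. p \<gamma> * \<gamma> 0)"
        unfolding ip2_def by (rule Bochner_Integration.integral_cong) (simp_all add: space_haar chars_0)
      ultimately show ?thesis
        using wp[of 0] w pL v(2) DH2 H2_L2 by (simp add: s_def ip2_diff_right subset_iff)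
    qed
    then have sw: "ip (s n) w = 0" for n using ip2_commute[of \<mu> "s n" w] by simp
    have "(\<lambda>n. ip (s n) w) \<longlonglongrightarrow> ip v w"
      by (rule ip2_tendsto[OF v(1) H2_L2[OF sH] w slim])
    then have "ip v w = 0" unfolding sw by (simp add: LIMSEQ_const_iff)
    then have "ip w v = 0" using ip2_commute[of \<mu> w v] by simp
    then show ?thesis unfolding w_def ip2_mult_char by simp
  qed
  define c' where "c' = (nrm v)\<^sup>2"
  have vc': "AE \<gamma> in \<mu>. (cmod (v \<gamma>))\<^sup>2 = c'"
    unfolding c'_def norm2_sq
    by (rule real_analytic_const) (simp_all only: L2_integrable_sq[OF v(1)] fourier_norm_sq vv)
  have pne: "AE \<gamma> in \<mu>. p \<gamma> \<noteq> 0" using c(2) by eventually_elim (use c(1) in auto)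
  have inv: "AE \<gamma> in \<mu>. cmod (1 / p \<gamma>) \<le> 1 / sqrt c"
    using c(2)
  proof eventually_elim
    case (elim \<gamma>)
    have "sqrt c \<le> cmod (p \<gamma>)" using elim by (intro real_le_lsqrt) auto
    then show ?case using c(1) by (simp add: norm_divide frac_le)
  qed
  note [measurable] = L2_measurable[OF pL] L2_measurable[OF v(1)]
  have im: "(\<lambda>\<gamma>. 1 / p \<gamma>) \<in> borel_measurable \<mu>" by measurable
  \<comment> \<open>Inverse of the outer factor \<open>p / v\<close>. The lower bound on
    \<open>p\<close> makes division by \<open>p\<close> continuous on L2, and dividing
    \<open>s n\<close> by \<open>p\<close> leaves the analytic polynomial \<open>t n\<close>, so the
    limit \<open>r\<close> is analytic.\<close>
  define r where "r = (\<lambda>\<gamma>. 1 / p \<gamma> * v \<gamma>)"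
  have rL: "r \<in> L2 \<mu>" unfolding r_def by (rule L2_bounded_mult[OF v(1) im inv])
  define t where "t n = (\<lambda>\<gamma>. 1 - trig (F n) (k n) \<gamma>)" for n
  have tL: "t n \<in> L2 \<mu>" for n unfolding t_def by (intro L2_diff one_L2 trig_L2)
  have tf: "ft (t n) \<xi> = (if \<xi> = 0 then 1 else 0)" if "\<xi> \<le> 0" for n \<xi>
    using m(3)[of n] that unfolding t_def by (auto simp: fourier_diff one_L2 trig_L2 fourier_one fourier_trig m(2))
  have tH: "t n \<in> H2" for n using tL tf by (simp add: H2_def)
  have tlim: "(\<lambda>n. nrm (\<lambda>\<gamma>. r \<gamma> - t n \<gamma>)) \<longlonglongrightarrow> 0"
  proof (rule Lim_null_comparison)
    have "nrm (\<lambda>\<gamma>. r \<gamma> - t n \<gamma>) \<le> 1 / sqrt c * nrm (\<lambda>\<gamma>. v \<gamma> - s n \<gamma>)" for n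
    proof -
      have "nrm (\<lambda>\<gamma>. r \<gamma> - t n \<gamma>) = nrm (\<lambda>\<gamma>. 1 / p \<gamma> * (v \<gamma> - s n \<gamma>))"
      proof (rule norm2_cong_AE)
        show "AE \<gamma> in \<mu>. r \<gamma> - t n \<gamma> = 1 / p \<gamma> * (v \<gamma> - s n \<gamma>)"
          using pne by eventually_elim (simp add: r_def t_def s_def m field_simps)
      qed (intro L2_measurable L2_diff rL tL L2_bounded_mult[OF _ im inv] v(1) H2_L2[OF sH])+
      also have "\<dots> \<le> 1 / sqrt c * nrm (\<lambda>\<gamma>. v \<gamma> - s n \<gamma>)"
        by (rule norm2_bounded_mult[OF _ im inv]) (use c in \<open>auto intro!: L2_diff v(1) H2_L2[OF sH]\<close>)
      finally show ?thesis .
    qed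
    then show "\<forall>\<^sub>F n in sequentially. norm (nrm (\<lambda>\<gamma>. r \<gamma> - t n \<gamma>)) \<le> 1 / sqrt c * nrm (\<lambda>\<gamma>. v \<gamma> - s n \<gamma>)"
      by simp
    show "(\<lambda>n. 1 / sqrt c * nrm (\<lambda>\<gamma>. v \<gamma> - s n \<gamma>)) \<longlonglongrightarrow> 0"
      using tendsto_mult_left[OF slim, of "1 / sqrt c"] by simp
  qed
  have rH: "r \<in> H2" by (rule H2_closed[OF tH rL tlim])
  \<comment> \<open>All \<open>t n\<close> have mean 1, and this survives in the limit; it is what
    rules out \<open>v = 0\<close>.\<close>
  have r0: "ft r 0 = 1"
    using LIMSEQ_unique[OF fourier_tendsto[OF rL tL tlim, of 0]] tf[of 0] by simp
  have c'0: "c' > 0"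
  proof (rule ccontr)
    assume "\<not> c' > 0"
    then have "nrm v = 0" by (simp add: c'_def)
    then have "AE \<gamma> in \<mu>. v \<gamma> = 0" using norm2_eq_0_iff[OF v(1)] by simp
    then have "AE \<gamma> in \<mu>. r \<gamma> = 0 * 1" by eventually_elim (simp add: r_def)
    then have "ft r = ft (\<lambda>\<gamma>. 0 * 1)" by (intro fourier_cong_AE L2_measurable[OF rL]) auto
    then have "ft r 0 = 0 * ft (\<lambda>\<gamma>. 1) 0" by (simp only: fourier_cmult)
    with r0 show False by simp
  qed
  \<comment> \<open>Since \<open>v\<close> has constant squared modulus \<open>c'\<close>, this is
    \<open>p / v\<close>. Its coefficients at negative frequencies are inner products of
    \<open>v\<close> with \<open>p\<close> times a positive character, up to conjugation and
    scaling, and these vanish.\<close>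
  define u where "u = (\<lambda>\<gamma>. of_real (1 / c') * (cnj (v \<gamma>) * p \<gamma>))"
  have vbd: "AE \<gamma> in \<mu>. cmod (cnj (v \<gamma>)) \<le> sqrt c'"
    using vc' by eventually_elim (auto intro: real_le_rsqrt)
  have uL: "u \<in> L2 \<mu>" unfolding u_def by (intro L2_cmult L2_bounded_mult[OF pL _ vbd]) measurable
  have "ft u \<xi> = 0" if "\<xi> < 0" for \<xi>
  proof -
    have "ft (\<lambda>\<gamma>. cnj (v \<gamma>) * p \<gamma>) \<xi> = ip (\<lambda>\<gamma>. p \<gamma> * \<gamma> (- \<xi>)) v"
      unfolding fourier_def ip2_def
      by (rule Bochner_Integration.integral_cong) (simp_all add: space_haar chars_uminus mult_ac)
    also have "\<dots> = 0" using ip2_commute[of \<mu> "\<lambda>\<gamma>. p \<gamma> * \<gamma> (- \<xi>)" v] vp[of "- \<xi>"] that by simp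
    finally show ?thesis unfolding u_def fourier_cmult by simp
  qed
  with uL have uH: "u \<in> H2" by (simp add: H2_def)
  have uv: "AE \<gamma> in \<mu>. p \<gamma> = u \<gamma> * v \<gamma>"
    using vc'
  proof eventually_elim
    case (elim \<gamma>)
    have "u \<gamma> * v \<gamma> = of_real (1 / c') * (v \<gamma> * cnj (v \<gamma>)) * p \<gamma>" by (simp add: u_def mult_ac)
    also have "v \<gamma> * cnj (v \<gamma>) = of_real c'" unfolding elim[symmetric] complex_norm_square ..
    finally show ?case using c'0 by (simp flip: of_real_mult)
  qed
  have "AE \<gamma> in \<mu>. u \<gamma> * r \<gamma> = 1"
    using uv pne
  proof eventually_elim
    case (elim \<gamma>)
    have "u \<gamma> * r \<gamma> = u \<gamma> * v \<gamma> / p \<gamma>" by (simp add: r_def)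
    then show ?case using elim by simp
  qed
  with uH vH rH c'0 vc' uv show ?thesis by (rule that)
qed

end

section \<open>Nehari's theorem\<close>

context haar_measure
begin

lemma proj_lincomb:
  assumes "f \<in> L2 \<mu>" "g \<in> L2 \<mu>"
  shows "AE \<gamma> in \<mu>. proj (\<lambda>\<gamma>. c * f \<gamma> + g \<gamma>) \<gamma> = c * proj f \<gamma> + proj g \<gamma>"
  by (rule L2_fourier_eq_imp_AE_eq)
    (simp_all add: assms proj_L2 L2_add L2_cmult fourier_proj fourier_add fourier_cmult)

lemma proj_H2_id:
  assumes "f \<in> H2"
  shows "AE \<gamma> in \<mu>. proj f \<gamma> = f \<gamma>"
proof (rule L2_fourier_eq_imp_AE_eq)
  show "ft (proj f) \<xi> = ft f \<xi>" for \<xi>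
    using fourier_proj[OF H2_L2[OF assms], of \<xi>] H2D[OF assms, of \<xi>] by (cases "0 \<le> \<xi>") auto
qed (use assms in \<open>auto intro: proj_L2 H2_L2\<close>)

lemma proj_cong:
  assumes "f \<in> borel_measurable \<mu>" "g \<in> borel_measurable \<mu>" "AE \<gamma> in \<mu>. f \<gamma> = g \<gamma>"
  shows "proj f = proj g"
  unfolding proj_def fourier_cong_AE[OF assms] ..

lemma fourier_le_norm2: "f \<in> L2 \<mu> \<Longrightarrow> cmod (ft f \<xi>) \<le> nrm f"
proof -
  assume f: "f \<in> L2 \<mu>"
  have "(nrm (\<lambda>\<gamma>. \<gamma> \<xi>))\<^sup>2 = 1"
    using norm2_trig[of "{\<xi>}" "\<lambda>_. 1"] by (simp add: trig_def[abs_def])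
  then have "nrm (\<lambda>\<gamma>. \<gamma> \<xi>) = 1" using norm2_nonneg[of \<mu> "\<lambda>\<gamma>. \<gamma> \<xi>"] by (simp add: power2_eq_1_iff)
  then show ?thesis unfolding fourier_ip2 using ip2_Cauchy_Schwarz[OF f char_L2, of \<xi>] by simp
qed

end

section \<open>Hankel operators with unimodular symbol\<close>

locale unimodular_symbol = haar_measure +
  fixes \<phi> :: "('a \<Rightarrow> complex) \<Rightarrow> complex"
  assumes phi_measurable [measurable]: "\<phi> \<in> borel_measurable \<mu>"
    and phi_unimodular: "AE \<gamma> in \<mu>. cmod (\<phi> \<gamma>) = 1"
begin

lemma phi_mult_L2: "f \<in> L2 \<mu> \<Longrightarrow> (\<lambda>\<gamma>. \<phi> \<gamma> * f \<gamma>) \<in> L2 \<mu>"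
  and cnj_phi_mult_L2: "f \<in> L2 \<mu> \<Longrightarrow> (\<lambda>\<gamma>. cnj (\<phi> \<gamma>) * f \<gamma>) \<in> L2 \<mu>"
  by (rule L2_bounded_mult[where C = 1]; use phi_unimodular in \<open>auto elim: eventually_mono\<close>)+

lemma norm2_phi_mult:
  assumes "f \<in> L2 \<mu>" shows "nrm (\<lambda>\<gamma>. \<phi> \<gamma> * f \<gamma>) = nrm f"
proof -
  have "(\<integral>\<gamma>. (cmod (\<phi> \<gamma> * f \<gamma>))\<^sup>2 \<partial>\<mu>) = (\<integral>\<gamma>. (cmod (f \<gamma>))\<^sup>2 \<partial>\<mu>)"
  proof (rule integral_cong_AE)
    show "AE \<gamma> in \<mu>. (cmod (\<phi> \<gamma> * f \<gamma>))\<^sup>2 = (cmod (f \<gamma>))\<^sup>2"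
      using phi_unimodular by eventually_elim (simp add: norm_mult)
  qed (use L2_measurable[OF assms] in measurable)
  then show ?thesis by (simp add: norm2_def)
qed

lemma ip2_cnj_phi: "ip (\<lambda>\<gamma>. cnj (\<phi> \<gamma>) * f \<gamma>) g = ip f (\<lambda>\<gamma>. \<phi> \<gamma> * g \<gamma>)"
  unfolding ip2_def by (simp add: mult_ac)

definition hankel :: "(('a \<Rightarrow> complex) \<Rightarrow> complex) \<Rightarrow> ('a \<Rightarrow> complex) \<Rightarrow> complex" where
  "hankel f = (\<lambda>\<gamma>. \<phi> \<gamma> * f \<gamma> - proj (\<lambda>\<gamma>. \<phi> \<gamma> * f \<gamma>) \<gamma>)"

lemma hankel_H2m: "f \<in> L2 \<mu> \<Longrightarrow> hankel f \<in> H2m"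
  unfolding hankel_def by (intro diff_proj_H2m phi_mult_L2)

lemma hankel_L2: "f \<in> L2 \<mu> \<Longrightarrow> hankel f \<in> L2 \<mu>"
  by (rule H2m_L2) (rule hankel_H2m)

lemma hankel_lincomb:
  assumes "f \<in> L2 \<mu>" "g \<in> L2 \<mu>"
  shows "AE \<gamma> in \<mu>. hankel (\<lambda>\<gamma>. c * f \<gamma> + g \<gamma>) \<gamma> = c * hankel f \<gamma> + hankel g \<gamma>"
proof -
  have "(\<lambda>\<gamma>. \<phi> \<gamma> * (c * f \<gamma> + g \<gamma>)) = (\<lambda>\<gamma>. c * (\<phi> \<gamma> * f \<gamma>) + \<phi> \<gamma> * g \<gamma>)"
    by (simp add: algebra_simps)
  then show ?thesis
    using proj_lincomb[OF phi_mult_L2[OF assms(1)] phi_mult_L2[OF assms(2)], of c]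
    unfolding hankel_def by (auto elim!: eventually_mono simp: algebra_simps)
qed

lemma norm2_hankel_diff:
  assumes "f \<in> L2 \<mu>" "g \<in> L2 \<mu>"
  shows "nrm (hankel (\<lambda>\<gamma>. f \<gamma> - g \<gamma>)) = nrm (\<lambda>\<gamma>. hankel f \<gamma> - hankel g \<gamma>)"
proof (rule norm2_cong_AE)
  show "AE \<gamma> in \<mu>. hankel (\<lambda>\<gamma>. f \<gamma> - g \<gamma>) \<gamma> = hankel f \<gamma> - hankel g \<gamma>"
    using hankel_lincomb[OF assms(2,1), of "- 1"] by simp
qed (use assms in \<open>auto intro!: L2_measurable hankel_L2 L2_diff\<close>)

lemma norm2_hankel_cmult:
  assumes "f \<in> L2 \<mu>"
  shows "nrm (hankel (\<lambda>\<gamma>. c * f \<gamma>)) = cmod c * nrm (hankel f)"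
proof -
  have z: "(\<lambda>\<gamma>. 0) \<in> L2 \<mu>" using H2_L2[OF zero_H2] .
  have "AE \<gamma> in \<mu>. proj (\<lambda>\<gamma>. 0) \<gamma> = 0" by (rule proj_H2_id[OF zero_H2])
  then have "AE \<gamma> in \<mu>. hankel (\<lambda>\<gamma>. 0) \<gamma> = 0" by (simp add: hankel_def)
  with hankel_lincomb[OF assms z, of c] have "AE \<gamma> in \<mu>. hankel (\<lambda>\<gamma>. c * f \<gamma>) \<gamma> = c * hankel f \<gamma>"
    by eventually_elim simp
  then have "nrm (hankel (\<lambda>\<gamma>. c * f \<gamma>)) = nrm (\<lambda>\<gamma>. c * hankel f \<gamma>)"
    using assms by (intro norm2_cong_AE) (auto intro!: L2_measurable hankel_L2 L2_cmult)
  then show ?thesis by (simp add: norm2_cmult)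
qed

lemma ip2_hankel:
  assumes "b \<in> H2m" "e \<in> L2 \<mu>"
  shows "ip b (hankel e) = ip b (\<lambda>\<gamma>. \<phi> \<gamma> * e \<gamma>)"
proof -
  have "proj (\<lambda>\<gamma>. \<phi> \<gamma> * e \<gamma>) \<in> H2" by (rule proj_H2[OF phi_mult_L2[OF assms(2)]])
  then show ?thesis
    unfolding hankel_def using assms ip2_H2_H2m(2)
    by (simp add: ip2_diff_right H2m_L2 H2_L2 phi_mult_L2)
qed

text \<open>The adjoint of \<open>hankel\<close>, as a map from \<open>H2\<close> to
  \<open>H2m\<close>, is multiplication by \<open>cnj (\<phi> \<gamma>)\<close> followed by
  \<open>proj\<close>; this is the adjoint composed with \<open>hankel\<close>.\<close>

definition hankel_sq :: "(('a \<Rightarrow> complex) \<Rightarrow> complex) \<Rightarrow> ('a \<Rightarrow> complex) \<Rightarrow> complex" where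
  "hankel_sq f = proj (\<lambda>\<gamma>. cnj (\<phi> \<gamma>) * hankel f \<gamma>)"

lemma hankel_sq_H2: "f \<in> L2 \<mu> \<Longrightarrow> hankel_sq f \<in> H2"
  unfolding hankel_sq_def by (intro proj_H2 cnj_phi_mult_L2 hankel_L2)

lemma hankel_sq_L2: "f \<in> L2 \<mu> \<Longrightarrow> hankel_sq f \<in> L2 \<mu>"
  by (rule H2_L2) (rule hankel_sq_H2)

lemma ip2_hankel_sq:
  assumes "f \<in> L2 \<mu>" "e \<in> H2"
  shows "ip (hankel_sq f) e = ip (hankel f) (hankel e)"
  unfolding hankel_sq_def using assms
  by (simp add: proj_ip2_left cnj_phi_mult_L2 hankel_L2 ip2_cnj_phi ip2_hankel hankel_H2m H2_L2)

lemma hankel_sq_diff: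
  assumes "f \<in> L2 \<mu>" "g \<in> L2 \<mu>"
  shows "AE \<gamma> in \<mu>. hankel_sq (\<lambda>\<gamma>. f \<gamma> - g \<gamma>) \<gamma> = hankel_sq f \<gamma> - hankel_sq g \<gamma>"
proof -
  have "AE \<gamma> in \<mu>. hankel (\<lambda>\<gamma>. - 1 * g \<gamma> + f \<gamma>) \<gamma> = - 1 * hankel g \<gamma> + hankel f \<gamma>"
    by (rule hankel_lincomb[OF assms(2,1)])
  then have "AE \<gamma> in \<mu>. cnj (\<phi> \<gamma>) * hankel (\<lambda>\<gamma>. f \<gamma> - g \<gamma>) \<gamma> =
      - 1 * (cnj (\<phi> \<gamma>) * hankel g \<gamma>) + cnj (\<phi> \<gamma>) * hankel f \<gamma>"
    by eventually_elim (simp add: right_diff_distrib)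
  then have "hankel_sq (\<lambda>\<gamma>. f \<gamma> - g \<gamma>) =
      proj (\<lambda>\<gamma>. - 1 * (cnj (\<phi> \<gamma>) * hankel g \<gamma>) + cnj (\<phi> \<gamma>) * hankel f \<gamma>)"
    unfolding hankel_sq_def
    by (intro proj_cong L2_measurable cnj_phi_mult_L2 hankel_L2 L2_add L2_cmult L2_diff assms)
  then show ?thesis
    using proj_lincomb[OF cnj_phi_mult_L2[OF hankel_L2[OF assms(2)]] cnj_phi_mult_L2[OF hankel_L2[OF assms(1)]], of "- 1"]
    by (simp add: hankel_sq_def)
qed

text \<open>With \<open>x\<close> the left-hand side, the adjoint relation and Cauchy-Schwarz bound
  \<open>x\<^sup>2\<close> by the norms of \<open>hankel f\<close> and
  \<open>hankel (hankel_sq f)\<close>. Each contributes a square root of \<open>\<kappa>\<close>,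
  and one factor \<open>x\<close> cancels.\<close>

lemma norm2_hankel_sq_le:
  assumes \<kappa>: "\<And>f. f \<in> H2 \<Longrightarrow> (nrm (hankel f))\<^sup>2 \<le> \<kappa> * (nrm f)\<^sup>2" "0 \<le> \<kappa>" and f: "f \<in> H2"
  shows "nrm (hankel_sq f) \<le> \<kappa> * nrm f"
proof -
  define x where "x = nrm (hankel_sq f)"
  have H: "hankel_sq f \<in> H2" by (rule hankel_sq_H2[OF H2_L2[OF f]])
  have "x\<^sup>2 = cmod (ip (hankel f) (hankel (hankel_sq f)))"
    unfolding x_def ip2_hankel_sq[OF H2_L2[OF f] H, symmetric] ip2_self norm_of_real by simp
  also have "\<dots> \<le> nrm (hankel f) * nrm (hankel (hankel_sq f))"
    by (intro ip2_Cauchy_Schwarz hankel_L2 H2_L2 f H)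
  finally have "(x\<^sup>2)\<^sup>2 \<le> (nrm (hankel f) * nrm (hankel (hankel_sq f)))\<^sup>2"
    by (intro power_mono) auto
  also have "\<dots> \<le> (\<kappa> * (nrm f)\<^sup>2) * (\<kappa> * x\<^sup>2)"
    unfolding power_mult_distrib x_def using \<kappa>(2) by (intro mult_mono \<kappa>(1) f H) auto
  finally have x4: "x\<^sup>2 * x\<^sup>2 \<le> (\<kappa> * nrm f)\<^sup>2 * x\<^sup>2" by (simp add: power2_eq_square mult_ac)
  have "x\<^sup>2 \<le> (\<kappa> * nrm f)\<^sup>2"
  proof (cases "x = 0")
    case False
    then show ?thesis using x4 by (intro mult_right_le_imp_le[OF x4]) simp
  qed simp
  then show ?thesis unfolding x_def using \<kappa>(2) by (auto intro: power2_le_imp_le)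
qed

text \<open>The Adamyan--Arov--Krein construction: \<open>p\<close> solves \<open>(1 - \<lambda> H\<^sup>* H) p = 1\<close> with \<open>H\<close> the Hankel
  operator, and \<open>p\<close> is shown to be outer by comparing it with its own outer factor in the
  variational characterization of this equation.\<close>

lemma nehari_hankel:
  assumes \<kappa>: "\<And>f. f \<in> H2 \<Longrightarrow> (nrm (hankel f))\<^sup>2 \<le> \<kappa> * (nrm f)\<^sup>2" "0 \<le> \<kappa>"
    and lam: "0 < lam" "lam * \<kappa> < 1"
  obtains h where "h \<in> Hinf \<mu>" "AE \<gamma> in \<mu>. lam * (cmod (\<phi> \<gamma> - h \<gamma>))\<^sup>2 \<le> 1"
proof -
  \<comment> \<open>A fixed point of \<open>A\<close> solves the equation for \<open>p\<close>;
    \<open>A\<close> contracts with factor \<open>lam * \<kappa>\<close>.\<close>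
  define A where "A f = (\<lambda>\<gamma>. of_real lam * hankel_sq f \<gamma> + 1)" for f
  obtain p where p: "p \<in> H2" "AE \<gamma> in \<mu>. A p \<gamma> = p \<gamma>"
  proof (rule L2_contraction_fixpoint[of H2 "\<lambda>\<gamma>. 1" A "lam * \<kappa>"])
    show "H2 \<subseteq> L2 \<mu>" using H2_L2 by blast
    show "A f \<in> H2" if "f \<in> H2" for f
      unfolding A_def by (intro H2_lincomb hankel_sq_H2 H2_L2 that one_H2)
    show "nrm (\<lambda>\<gamma>. A f \<gamma> - A g \<gamma>) \<le> lam * \<kappa> * nrm (\<lambda>\<gamma>. f \<gamma> - g \<gamma>)" if fg: "f \<in> H2" "g \<in> H2" for f g
    proof -
      have "nrm (\<lambda>\<gamma>. A f \<gamma> - A g \<gamma>) = nrm (\<lambda>\<gamma>. of_real lam * hankel_sq (\<lambda>\<gamma>. f \<gamma> - g \<gamma>) \<gamma>)"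
      proof (rule norm2_cong_AE)
        show "AE \<gamma> in \<mu>. A f \<gamma> - A g \<gamma> = of_real lam * hankel_sq (\<lambda>\<gamma>. f \<gamma> - g \<gamma>) \<gamma>"
          using hankel_sq_diff[OF H2_L2[OF fg(1)] H2_L2[OF fg(2)]]
          by eventually_elim (simp add: A_def right_diff_distrib)
      qed (auto simp: A_def intro!: L2_measurable L2_diff L2_cmult hankel_sq_L2 H2_L2[OF fg(1)] H2_L2[OF fg(2)])
      also have "\<dots> = lam * nrm (hankel_sq (\<lambda>\<gamma>. f \<gamma> - g \<gamma>))" using lam by (simp add: norm2_cmult)
      also have "\<dots> \<le> lam * (\<kappa> * nrm (\<lambda>\<gamma>. f \<gamma> - g \<gamma>))"
        using lam by (intro mult_left_mono norm2_hankel_sq_le[OF \<kappa>] H2_diff fg) auto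
      finally show ?thesis by simp
    qed
  qed (use lam \<kappa>(2) one_H2 H2_closed in auto)
  note pL = H2_L2[OF p(1)]
  define b where "b = hankel p"
  have bH: "b \<in> H2m" and bL: "b \<in> L2 \<mu>" unfolding b_def by (intro hankel_H2m hankel_L2 pL)+
  \<comment> \<open>Weak form of the equation, with \<open>e\<close> as test function: pairing the
    constant 1 with \<open>e\<close> gives the conjugated mean of \<open>e\<close>.\<close>
  have Qeq: "ip p e = cnj (ft e 0) + of_real lam * ip b (hankel e)" if e: "e \<in> H2" for e
  proof -
    have "ip p e = ip (A p) e"
      using p(2) by (intro ip2_cong_AE L2_measurable pL H2_L2[OF e])
        (auto simp: A_def intro!: L2_add L2_cmult one_L2 hankel_sq_L2 pL)
    also have "\<dots> = of_real lam * ip b (hankel e) + ip (\<lambda>\<gamma>. 1) e"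
      unfolding A_def b_def
      by (simp add: ip2_add_left L2_cmult H2_L2 hankel_sq_H2 pL one_L2 e ip2_cmult_left ip2_hankel_sq)
    also have "ip (\<lambda>\<gamma>. 1) e = cnj (ip e (\<lambda>\<gamma>. 1))" by (rule ip2_commute)
    also have "ip e (\<lambda>\<gamma>. 1) = ft e 0"
      unfolding fourier_def ip2_def by (rule Bochner_Integration.integral_cong) (simp_all add: space_haar chars_0)
    finally show ?thesis by simp
  qed
  \<comment> \<open>The quadratic form of the operator in the equation; it is positive definite on
    \<open>H2\<close> because \<open>lam * \<kappa> < 1\<close>.\<close>
  define Q where "Q f = (nrm f)\<^sup>2 - lam * (nrm (hankel f))\<^sup>2" for f
  have Q_ge: "(1 - lam * \<kappa>) * (nrm f)\<^sup>2 \<le> Q f" if "f \<in> H2" for f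
    using mult_left_mono[OF \<kappa>(1)[OF that], of lam] lam(1) unfolding Q_def by (simp add: algebra_simps)
  define c where "c = Q p"
  have p0: "ft p 0 = of_real c"
  proof -
    have "cnj (ft p 0) = of_real c"
      using Qeq[OF p(1)] by (simp add: ip2_self Q_def c_def b_def flip: of_real_mult of_real_power)
    then show ?thesis by (metis complex_cnj_cnj complex_cnj_complex_of_real)
  qed
  \<comment> \<open>Otherwise definiteness makes \<open>p\<close> and \<open>b\<close> null, and
    testing the equation with the constant 1 gives 0 = 1.\<close>
  have c0: "c > 0"
  proof (rule ccontr)
    assume "\<not> c > 0"
    then have "(1 - lam * \<kappa>) * (nrm p)\<^sup>2 \<le> 0" using Q_ge[OF p(1)] unfolding c_def by linarith
    then have "nrm p = 0" using lam(2) by (auto simp: mult_le_0_iff)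
    then have z: "nrm p = 0" "nrm b = 0" using \<kappa>(1)[OF p(1)] by (auto simp: b_def)
    have "ip p (\<lambda>\<gamma>. 1) = 0" using ip2_Cauchy_Schwarz[OF pL one_L2] z by simp
    moreover have "ip b (hankel (\<lambda>\<gamma>. 1)) = 0"
      using ip2_Cauchy_Schwarz[OF bL hankel_L2[OF one_L2]] z by simp
    ultimately show False using Qeq[OF one_H2] by (simp add: fourier_one)
  qed
  have D: "AE \<gamma> in \<mu>. (cmod (p \<gamma>))\<^sup>2 - lam * (cmod (b \<gamma>))\<^sup>2 = c"
  proof -
    define D where "D \<gamma> = (cmod (p \<gamma>))\<^sup>2 - lam * (cmod (b \<gamma>))\<^sup>2" for \<gamma>
    have int: "integrable \<mu> D" unfolding D_def using L2_integrable_sq[OF pL] L2_integrable_sq[OF bL] by simp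
    have "AE \<gamma> in \<mu>. D \<gamma> = (\<integral>\<gamma>. D \<gamma> \<partial>\<mu>)"
    proof (rule real_analytic_const[OF int])
      fix \<xi> :: 'a assume \<xi>: "\<xi> > 0"
      \<comment> \<open>Testing the equation with this shift of \<open>p\<close> yields the
        coefficient of \<open>D\<close> at \<open>\<xi>\<close>. The mean of \<open>e\<close> is the
        coefficient of \<open>p\<close> at \<open>- \<xi>\<close>, which is 0.\<close>
      define e where "e = (\<lambda>\<gamma>. p \<gamma> * \<gamma> \<xi>)"
      have e: "e \<in> H2" unfolding e_def using \<xi> by (intro H2_mult_char p) simp
      \<comment> \<open>Analytic part of \<open>\<phi> p\<close>. After multiplication by the
        character it remains analytic and hence orthogonal to \<open>b\<close>, so in the pairing
        with \<open>b\<close> only the shifted \<open>b\<close> is left of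
        \<open>\<phi> e\<close>.\<close>
      define a where "a = proj (\<lambda>\<gamma>. \<phi> \<gamma> * p \<gamma>)"
      have a: "a \<in> H2" unfolding a_def by (intro proj_H2 phi_mult_L2 pL)
      have "ft (\<lambda>\<gamma>. of_real (D \<gamma>)) \<xi> =
          (\<integral>\<gamma>. p \<gamma> * cnj (p \<gamma> * \<gamma> \<xi>) - of_real lam * (b \<gamma> * cnj (b \<gamma> * \<gamma> \<xi>)) \<partial>\<mu>)"
        unfolding fourier_def D_def of_real_diff of_real_mult complex_norm_square by (simp add: algebra_simps)
      also have "\<dots> = ip p e - of_real lam * ip b (\<lambda>\<gamma>. b \<gamma> * \<gamma> \<xi>)"
        using ip2_integrable[OF pL L2_mult_char[OF pL]] ip2_integrable[OF bL L2_mult_char[OF bL]]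
        unfolding ip2_def e_def by (subst Bochner_Integration.integral_diff) auto
      also have "ip b (\<lambda>\<gamma>. b \<gamma> * \<gamma> \<xi>) = ip b (hankel e)"
      proof -
        have "(\<lambda>\<gamma>. \<phi> \<gamma> * e \<gamma>) = (\<lambda>\<gamma>. a \<gamma> * \<gamma> \<xi> + b \<gamma> * \<gamma> \<xi>)"
          by (simp add: e_def a_def b_def hankel_def algebra_simps)
        moreover have "(\<lambda>\<gamma>. a \<gamma> * \<gamma> \<xi>) \<in> H2" using \<xi> by (intro H2_mult_char a) simp
        ultimately show ?thesis
          unfolding ip2_hankel[OF bH H2_L2[OF e]]
          using ip2_H2_H2m(2)[OF _ bH] by (simp add: ip2_add_right bL H2_L2 L2_mult_char)
      qed
      also have "ip p e - of_real lam * ip b (hankel e) = cnj (ft e 0)"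
        using Qeq[OF e] by simp
      also have "ft e 0 = 0"
        unfolding e_def fourier_mult_char by (rule H2D[OF p(1)]) (use \<xi> in simp)
      finally show "ft (\<lambda>\<gamma>. of_real (D \<gamma>)) \<xi> = 0" by simp
    qed
    moreover have "(\<integral>\<gamma>. D \<gamma> \<partial>\<mu>) = c"
      unfolding D_def c_def Q_def norm2_sq b_def[symmetric]
      using L2_integrable_sq[OF pL] L2_integrable_sq[OF bL] by simp
    ultimately show ?thesis unfolding D_def by simp
  qed
  have p_ge: "AE \<gamma> in \<mu>. c \<le> (cmod (p \<gamma>))\<^sup>2"
    using D
  proof eventually_elim
    case (elim \<gamma>)
    have "0 \<le> lam * (cmod (b \<gamma>))\<^sup>2" using lam(1) by simp
    then show ?case using elim by linarith
  qed
  obtain u v r c' where uvr: "u \<in> H2" "v \<in> H2" "r \<in> H2" "c' > 0"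
    "AE \<gamma> in \<mu>. (cmod (v \<gamma>))\<^sup>2 = c'" "AE \<gamma> in \<mu>. p \<gamma> = u \<gamma> * v \<gamma>" "AE \<gamma> in \<mu>. u \<gamma> * r \<gamma> = 1"
    by (rule inner_outer_factorization[OF p(1) c0 p_ge])
  note uL = H2_L2[OF uvr(1)] and vL = H2_L2[OF uvr(2)] and rL = H2_L2[OF uvr(3)]
  note [measurable] = L2_measurable[OF uL] L2_measurable[OF vL] L2_measurable[OF rL]
    L2_measurable[OF pL] L2_measurable[OF bL]
  have vbd: "AE \<gamma> in \<mu>. cmod (v \<gamma>) \<le> sqrt c'"
    using uvr(5) by eventually_elim (auto intro: real_le_rsqrt)
  have norm_v_mult: "(nrm (\<lambda>\<gamma>. v \<gamma> * f \<gamma>))\<^sup>2 = c' * (nrm f)\<^sup>2" if "f \<in> L2 \<mu>" for f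
  proof -
    have "(\<integral>\<gamma>. (cmod (v \<gamma> * f \<gamma>))\<^sup>2 \<partial>\<mu>) = (\<integral>\<gamma>. c' * (cmod (f \<gamma>))\<^sup>2 \<partial>\<mu>)"
    proof (rule integral_cong_AE)
      show "AE \<gamma> in \<mu>. (cmod (v \<gamma> * f \<gamma>))\<^sup>2 = c' * (cmod (f \<gamma>))\<^sup>2"
        using uvr(5) by eventually_elim (simp add: norm_mult power_mult_distrib)
    qed (use L2_measurable[OF that] in measurable)
    then show ?thesis by (simp add: norm2_sq)
  qed
  have "(nrm v)\<^sup>2 = c'" using norm_v_mult[OF one_L2] by (simp add: norm2_sq prob_space)
  \<comment> \<open>Scaling \<open>u\<close> by \<open>\<beta>\<close> gives it the same mean
    \<open>c\<close> as \<open>p\<close>, since means multiply. That the squared modulus of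
    \<open>\<beta>\<close> is at most \<open>c'\<close> makes the scaled function no more expensive
    than \<open>p\<close> for \<open>Q\<close>.\<close>
  define \<beta> where "\<beta> = ft v 0"
  have "(cmod \<beta>)\<^sup>2 \<le> (nrm v)\<^sup>2"
    unfolding \<beta>_def by (intro power_mono fourier_le_norm2 vL) simp
  then have \<beta>_le: "(cmod \<beta>)\<^sup>2 \<le> c'" using \<open>(nrm v)\<^sup>2 = c'\<close> by simp
  have "ft p 0 = ft (\<lambda>\<gamma>. u \<gamma> * v \<gamma>) 0"
    by (subst fourier_cong_AE[OF _ _ uvr(6)]) auto
  then have u\<beta>: "ft u 0 * \<beta> = of_real c"
    using fourier_mult_H2(2)[OF uvr(1,2)] p0 by (simp add: \<beta>_def)
  then have \<beta>0: "\<beta> \<noteq> 0" using c0 by auto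
  define f where "f = (\<lambda>\<gamma>. \<beta> * u \<gamma>)"
  have f: "f \<in> H2" unfolding f_def by (rule H2_cmult[OF uvr(1)])
  have f0: "ft f 0 = of_real c" unfolding f_def fourier_cmult using u\<beta> by (simp add: mult.commute)
  have vu: "nrm p = nrm (\<lambda>\<gamma>. v \<gamma> * u \<gamma>)"
    using uvr(6) by (intro norm2_cong_AE) (auto simp: mult.commute)
  \<comment> \<open>In \<open>\<phi> p = v (\<phi> u)\<close> the analytic part of
    \<open>\<phi> u\<close> stays analytic when multiplied by \<open>v\<close>, so \<open>b\<close>
    arises from \<open>v\<close> times \<open>hankel u\<close> by removing a projection, which
    cannot increase the norm.\<close>
  have "(nrm b)\<^sup>2 \<le> c' * (nrm (hankel u))\<^sup>2"
  proof -
    define a where "a = proj (\<lambda>\<gamma>. \<phi> \<gamma> * u \<gamma>)"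
    have a: "a \<in> H2" unfolding a_def by (intro proj_H2 phi_mult_L2 uL)
    define w where "w = (\<lambda>\<gamma>. v \<gamma> * hankel u \<gamma>)"
    have w: "w \<in> L2 \<mu>" unfolding w_def by (rule L2_bounded_mult[OF hankel_L2[OF uL] _ vbd]) simp
    have va: "(\<lambda>\<gamma>. v \<gamma> * a \<gamma>) \<in> H2"
      using L2_bounded_mult[OF H2_L2[OF a] _ vbd] fourier_mult_H2(1)[OF uvr(2) a] by (simp add: H2_def)
    have ph: "AE \<gamma> in \<mu>. \<phi> \<gamma> * p \<gamma> = 1 * (v \<gamma> * a \<gamma>) + w \<gamma>"
      using uvr(6) by eventually_elim (simp add: w_def a_def hankel_def algebra_simps)
    then have pr: "proj (\<lambda>\<gamma>. \<phi> \<gamma> * p \<gamma>) = proj (\<lambda>\<gamma>. 1 * (v \<gamma> * a \<gamma>) + w \<gamma>)"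
      by (intro proj_cong L2_measurable phi_mult_L2 pL L2_add L2_cmult H2_L2[OF va] w)
    have "AE \<gamma> in \<mu>. b \<gamma> = w \<gamma> - proj w \<gamma>"
      using ph proj_lincomb[OF H2_L2[OF va] w, of 1] proj_H2_id[OF va]
      unfolding b_def hankel_def pr by eventually_elim simp
    then have "nrm b = nrm (\<lambda>\<gamma>. w \<gamma> - proj w \<gamma>)"
      by (intro norm2_cong_AE L2_measurable bL L2_diff w proj_L2)
    also have "\<dots> \<le> nrm w" by (rule norm2_proj_le(2)[OF w])
    finally have "(nrm b)\<^sup>2 \<le> (nrm w)\<^sup>2" by (intro power_mono) auto
    then show ?thesis unfolding w_def norm_v_mult[OF hankel_L2[OF uL]] .
  qed
  then have "c' * Q u \<le> c"
    unfolding c_def Q_def vu norm_v_mult[OF uL] b_def[symmetric]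
    using mult_left_mono[of "(nrm b)\<^sup>2" "c' * (nrm (hankel u))\<^sup>2" lam] lam(1) by (simp add: algebra_simps)
  moreover have "0 \<le> Q u"
    using Q_ge[OF uvr(1)] lam(2) by (meson diff_ge_0_iff_ge less_imp_le mult_nonneg_nonneg order_trans zero_le_power2)
  then have "(cmod \<beta>)\<^sup>2 * Q u \<le> c' * Q u" by (intro mult_right_mono \<beta>_le)
  moreover have "Q f = (cmod \<beta>)\<^sup>2 * Q u"
    unfolding Q_def f_def norm2_hankel_cmult[OF uL] norm2_cmult by (simp add: algebra_simps power_mult_distrib)
  ultimately have Qf: "Q f \<le> c" by simp
  \<comment> \<open>The weak equation evaluates the cross term as the mean of \<open>f\<close>,
    which is \<open>c\<close>. The form at \<open>f - p\<close> is thus \<open>Q f - c\<close>, at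
    most 0, and definiteness gives \<open>f = p\<close>.\<close>
  have "Q (\<lambda>\<gamma>. f \<gamma> - p \<gamma>) = Q f + Q p - 2 * (Re (ip f p) - lam * Re (ip (hankel f) b))"
    unfolding Q_def norm2_hankel_diff[OF H2_L2[OF f] pL] norm2_diff_sq[OF H2_L2[OF f] pL] b_def
      norm2_diff_sq[OF hankel_L2[OF H2_L2[OF f]] hankel_L2[OF pL]] by (simp add: algebra_simps)
  also have "Re (ip f p) - lam * Re (ip (hankel f) b) = c"
    using arg_cong[OF Qeq[OF f], of Re] ip2_commute[of \<mu> p f] ip2_commute[of \<mu> b "hankel f"] f0 by simp
  also have "Q f + Q p - 2 * c \<le> 0" using Qf by (simp add: c_def)
  finally have "(1 - lam * \<kappa>) * (nrm (\<lambda>\<gamma>. f \<gamma> - p \<gamma>))\<^sup>2 \<le> 0"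
    using Q_ge[OF H2_diff[OF f p(1)]] by linarith
  then have "nrm (\<lambda>\<gamma>. f \<gamma> - p \<gamma>) = 0" using lam(2) by (auto simp: mult_le_0_iff)
  then have fp: "AE \<gamma> in \<mu>. f \<gamma> = p \<gamma>"
    using norm2_eq_0_iff[OF L2_diff[OF H2_L2[OF f] pL]] by simp
  define a where "a = proj (\<lambda>\<gamma>. \<phi> \<gamma> * p \<gamma>)"
  have a: "a \<in> H2" unfolding a_def by (intro proj_H2 phi_mult_L2 pL)
  \<comment> \<open>As \<open>p\<close> equals \<open>\<beta> u\<close> almost everywhere, this
    analytic function is its inverse; \<open>h = a q\<close> then has only nonnegative frequencies,
    and \<open>\<phi> - h = b q\<close>.\<close>
  define q where "q = (\<lambda>\<gamma>. inverse \<beta> * r \<gamma>)"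
  have q: "q \<in> H2" unfolding q_def by (rule H2_cmult[OF uvr(3)])
  have pq: "AE \<gamma> in \<mu>. p \<gamma> * q \<gamma> = 1"
    using fp uvr(7)
  proof eventually_elim
    case (elim \<gamma>)
    have "p \<gamma> * q \<gamma> = (\<beta> * inverse \<beta>) * (u \<gamma> * r \<gamma>)"
      unfolding elim(1)[symmetric] f_def q_def by (simp add: mult_ac)
    then show ?case using \<beta>0 elim(2) by simp
  qed
  define h where "h = (\<lambda>\<gamma>. a \<gamma> * q \<gamma>)"
  have [measurable]: "a \<in> borel_measurable \<mu>" "q \<in> borel_measurable \<mu>"
    using a q H2_L2 L2_measurable by blast+
  have hm: "h \<in> borel_measurable \<mu>" unfolding h_def by measurable
  have bound: "AE \<gamma> in \<mu>. lam * (cmod (\<phi> \<gamma> - h \<gamma>))\<^sup>2 \<le> 1"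
    using pq D
  proof eventually_elim
    case (elim \<gamma>)
    have "\<phi> \<gamma> - h \<gamma> = \<phi> \<gamma> * (p \<gamma> * q \<gamma>) - a \<gamma> * q \<gamma>" by (simp add: h_def elim(1))
    also have "\<dots> = b \<gamma> * q \<gamma>" by (simp add: b_def hankel_def a_def algebra_simps)
    finally have "lam * (cmod (\<phi> \<gamma> - h \<gamma>))\<^sup>2 = (lam * (cmod (b \<gamma>))\<^sup>2) * (cmod (q \<gamma>))\<^sup>2"
      by (simp add: norm_mult power_mult_distrib)
    also have "\<dots> \<le> (cmod (p \<gamma>))\<^sup>2 * (cmod (q \<gamma>))\<^sup>2" using elim(2) c0 by (intro mult_right_mono) auto
    also have "\<dots> = (cmod (p \<gamma> * q \<gamma>))\<^sup>2" by (simp add: norm_mult power_mult_distrib)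
    finally show ?case by (simp add: elim(1))
  qed
  have "AE \<gamma> in \<mu>. cmod (h \<gamma>) \<le> 1 + sqrt (1 / lam)"
    using bound phi_unimodular
  proof eventually_elim
    case (elim \<gamma>)
    have "cmod (\<phi> \<gamma> - h \<gamma>) \<le> sqrt (1 / lam)"
      using elim(1) lam(1) by (intro real_le_rsqrt) (simp add: field_simps)
    then show ?case using norm_triangle_ineq4[of "\<phi> \<gamma>" "\<phi> \<gamma> - h \<gamma>"] elim(2) by simp
  qed
  then have "h \<in> Linf \<mu>" unfolding Linf_def using hm by blast
  moreover have "ft h \<xi> = 0" if "\<xi> \<notin> posCone" for \<xi>
    unfolding h_def using that by (intro fourier_mult_H2(1)[OF a q]) (simp add: posCone_def)
  ultimately have "h \<in> Hinf \<mu>" by (simp add: Hinf_def)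
  then show ?thesis using bound by (rule that)
qed

text \<open>Multiplication by \<open>\<phi>\<close> is isometric, so by Pythagoras the squared norms
  of the Toeplitz and Hankel parts add up to that of \<open>f\<close>. A lower bound for one is an
  upper bound below 1 for the other.\<close>

lemma nehari_bounded_below:
  assumes \<epsilon>: "\<epsilon> > 0" and below: "\<And>f. f \<in> H2 \<Longrightarrow> \<epsilon> * nrm f \<le> nrm (proj (\<lambda>\<gamma>. \<phi> \<gamma> * f \<gamma>))"
  obtains h \<rho> where "h \<in> Hinf \<mu>" "\<rho> < 1" "AE \<gamma> in \<mu>. cmod (\<phi> \<gamma> - h \<gamma>) \<le> \<rho>"
proof -
  define \<kappa> where "\<kappa> = 1 - \<epsilon>\<^sup>2"
  have le: "(nrm (hankel f))\<^sup>2 \<le> \<kappa> * (nrm f)\<^sup>2" if f: "f \<in> H2" for f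
  proof -
    have "(nrm f)\<^sup>2 = (nrm (proj (\<lambda>\<gamma>. \<phi> \<gamma> * f \<gamma>)))\<^sup>2 + (nrm (hankel f))\<^sup>2"
      using norm2_proj[OF phi_mult_L2[OF H2_L2[OF f]]] norm2_phi_mult[OF H2_L2[OF f]] by (simp add: hankel_def)
    moreover have "(\<epsilon> * nrm f)\<^sup>2 \<le> (nrm (proj (\<lambda>\<gamma>. \<phi> \<gamma> * f \<gamma>)))\<^sup>2"
      using \<epsilon> by (intro power_mono below f) simp
    ultimately show ?thesis by (simp add: \<kappa>_def algebra_simps power_mult_distrib)
  qed
  have \<kappa>: "0 \<le> \<kappa>" "\<kappa> < 1"
  proof -
    \<comment> \<open>Testing on the constant 1, which has norm 1, shows that
      \<open>\<kappa>\<close> is not negative.\<close>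
    have "0 \<le> (nrm (hankel (\<lambda>\<gamma>. 1)))\<^sup>2" by simp
    also have "\<dots> \<le> \<kappa> * (nrm (\<lambda>\<gamma>. 1))\<^sup>2" by (rule le[OF one_H2])
    finally show "0 \<le> \<kappa>" by (simp add: norm2_sq prob_space)
    show "\<kappa> < 1" using \<epsilon> by (simp add: \<kappa>_def)
  qed
  \<comment> \<open>The reciprocal of the midpoint between \<open>\<kappa>\<close> and 1: larger
    than 1, while \<open>lam * \<kappa>\<close> stays below 1.\<close>
  define lam where "lam = 2 / (1 + \<kappa>)"
  have lam: "0 < lam" "lam * \<kappa> < 1" "1 < lam" using \<kappa> by (auto simp: lam_def field_simps)
  obtain h where h: "h \<in> Hinf \<mu>" "AE \<gamma> in \<mu>. lam * (cmod (\<phi> \<gamma> - h \<gamma>))\<^sup>2 \<le> 1"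
    using nehari_hankel[OF le \<kappa>(1) lam(1,2)] by blast
  show ?thesis
  proof (rule that[OF h(1)])
    show "sqrt (1 / lam) < 1" using lam by simp
    show "AE \<gamma> in \<mu>. cmod (\<phi> \<gamma> - h \<gamma>) \<le> sqrt (1 / lam)"
      using h(2)
    proof eventually_elim
      case (elim \<gamma>)
      then show ?case using lam(1) by (intro real_le_rsqrt) (simp add: field_simps)
    qed
  qed
qed

end

section \<open>Toeplitz operators\<close>

lemma l2norm_nonneg: "0 \<le> l2norm g"
  unfolding l2norm_def by (simp add: infsum_nonneg)

lemma linf_norm_less_one_iff:
  assumes "f \<in> borel_measurable \<mu>"
  shows "linf_norm \<mu> f < 1 \<longleftrightarrow> (\<exists>\<rho><1. AE \<gamma> in \<mu>. cmod (f \<gamma>) \<le> \<rho>)"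
proof
  assume "linf_norm \<mu> f < 1"
  then obtain \<rho> where \<rho>: "linf_norm \<mu> f < ereal \<rho>" "ereal \<rho> < 1"
    using ereal_dense2[of "linf_norm \<mu> f" 1] by blast
  have "AE \<gamma> in \<mu>. ereal (cmod (f \<gamma>)) \<le> linf_norm \<mu> f" unfolding linf_norm_def by (rule esssup_AE)
  then have "AE \<gamma> in \<mu>. cmod (f \<gamma>) \<le> \<rho>"
  proof eventually_elim
    case (elim \<gamma>)
    from order_le_less_trans[OF this \<rho>(1)] show ?case by simp
  qed
  then show "\<exists>\<rho><1. AE \<gamma> in \<mu>. cmod (f \<gamma>) \<le> \<rho>" using \<rho>(2) by auto
next
  assume "\<exists>\<rho><1. AE \<gamma> in \<mu>. cmod (f \<gamma>) \<le> \<rho>"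
  then obtain \<rho> where \<rho>: "\<rho> < 1" "AE \<gamma> in \<mu>. cmod (f \<gamma>) \<le> \<rho>" by blast
  have "linf_norm \<mu> f \<le> ereal \<rho>"
    unfolding linf_norm_def using assms \<rho>(2) by (intro esssup_I) auto
  also have "\<dots> < 1" using \<rho>(1) by simp
  finally show "linf_norm \<mu> f < 1" .
qed

lemma dist_Hinf_less_one_iff:
  assumes "f \<in> borel_measurable \<mu>"
  shows "dist_Hinf \<mu> f < 1 \<longleftrightarrow> (\<exists>h\<in>Hinf \<mu>. \<exists>\<rho><1. AE \<gamma> in \<mu>. cmod (f \<gamma> - h \<gamma>) \<le> \<rho>)"
proof -
  have "(\<lambda>\<gamma>. f \<gamma> - h \<gamma>) \<in> borel_measurable \<mu>" if "h \<in> Hinf \<mu>" for h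
    using assms that by (auto simp: Hinf_def Linf_def)
  then show ?thesis unfolding dist_Hinf_def INF_less_iff by (simp add: linf_norm_less_one_iff)
qed

lemma bounded_op_compose:
  assumes "bounded_op A S" "bounded_op A T"
  shows "bounded_op A (\<lambda>g. S (T g))"
proof -
  obtain C1 C2 where C: "\<And>g. g \<in> l2space A \<Longrightarrow> l2norm (S g) \<le> C1 * l2norm g"
    "\<And>g. g \<in> l2space A \<Longrightarrow> l2norm (T g) \<le> C2 * l2norm g"
    using assms unfolding bounded_op_def by blast
  have T: "T g \<in> l2space A" if "g \<in> l2space A" for g using assms that unfolding bounded_op_def by blast
  have "l2norm (S (T g)) \<le> \<bar>C1\<bar> * C2 * l2norm g" if g: "g \<in> l2space A" for g
  proof -
    have "l2norm (S (T g)) \<le> C1 * l2norm (T g)" by (rule C(1)[OF T[OF g]])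
    also have "\<dots> \<le> \<bar>C1\<bar> * l2norm (T g)" by (intro mult_right_mono l2norm_nonneg) simp
    also have "\<dots> \<le> \<bar>C1\<bar> * (C2 * l2norm g)" by (intro mult_left_mono C(2) g) simp
    finally show ?thesis by simp
  qed
  then have "\<exists>C. \<forall>g\<in>l2space A. l2norm (S (T g)) \<le> C * l2norm g" by blast
  then show ?thesis using assms unfolding bounded_op_def by simp
qed

context haar_measure
begin

text \<open>Closure under linear combinations is inherited from L2 through the Fourier
  transform.\<close>

lemma l2space_lincomb:
  fixes g h :: "'x \<Rightarrow> complex"
  assumes "g \<in> l2space A" "h \<in> l2space A"
  shows "(\<lambda>x. c * g x + h x) \<in> l2space A"
proof -
  have gh: "g \<in> l2space UNIV" "h \<in> l2space UNIV" using assms by (auto simp: l2space_def)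
  have "(\<lambda>x. c * g x + h x) = ft (\<lambda>\<gamma>. c * synth g \<gamma> + synth h \<gamma>)"
    by (rule ext) (simp add: fourier_add fourier_cmult L2_cmult synth_L2 gh fourier_synth)
  also have "\<dots> \<in> l2space UNIV" by (intro fourier_l2space L2_add L2_cmult synth_L2 gh)
  finally show ?thesis using assms by (auto simp: l2space_def)
qed

lemma l2norm_eq_0:
  fixes g :: "'x \<Rightarrow> complex"
  assumes "g \<in> l2space A" "l2norm g = 0"
  shows "g = (\<lambda>x. 0)"
proof -
  have g: "g \<in> l2space UNIV" using assms by (auto simp: l2space_def)
  have "nrm (synth g) = 0" using l2norm_fourier[OF synth_L2[OF g]] assms(2) by (simp add: fourier_synth g)
  then have "cmod (ft (synth g) x) \<le> 0" for x using fourier_le_norm2[OF synth_L2[OF g], of x] by simp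
  then show ?thesis by (simp add: fourier_synth g fun_eq_iff)
qed

text \<open>Wiener-Hopf and Toeplitz operators will agree only on the space itself, while the
  linearity clause evaluates them at combinations; these lie in the space by
  \<open>l2space_lincomb\<close>.\<close>

lemma bounded_op_cong:
  fixes A :: "'x set"
  assumes eq: "\<And>g. g \<in> l2space A \<Longrightarrow> T g = T' g"
  shows "bounded_op A T \<longleftrightarrow> bounded_op A T'"
  unfolding bounded_op_def using eq l2space_lincomb by (simp cong: ball_cong)

lemma invertible_op_cong:
  fixes A :: "'x set"
  assumes eq: "\<And>g. g \<in> l2space A \<Longrightarrow> T g = T' g"
  shows "left_invertible_op A T \<longleftrightarrow> left_invertible_op A T'"
    and "right_invertible_op A T \<longleftrightarrow> right_invertible_op A T'"
    and "invertible_op A T \<longleftrightarrow> invertible_op A T'"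
proof -
  have b_eq: "bounded_op A T \<longleftrightarrow> bounded_op A T'" using eq by (rule bounded_op_cong)
  have R: "R g \<in> l2space A" if "bounded_op A R" "g \<in> l2space A" for R g
    using that unfolding bounded_op_def by blast
  show "left_invertible_op A T \<longleftrightarrow> left_invertible_op A T'"
    unfolding left_invertible_op_def b_eq using eq by simp
  have *: "(\<forall>g\<in>l2space A. T (R g) = g) \<longleftrightarrow> (\<forall>g\<in>l2space A. T' (R g) = g)" if "bounded_op A R" for R
    using eq R[OF that] by simp
  show "right_invertible_op A T \<longleftrightarrow> right_invertible_op A T'"
    unfolding right_invertible_op_def b_eq using * by blast
  show "invertible_op A T \<longleftrightarrow> invertible_op A T'"
    unfolding invertible_op_def b_eq using * eq by (simp cong: conj_cong)
qed

text \<open>The lower bound yields injectivity, from which linearity of the chosen inverse follows,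
  and also the norm bound \<open>1 / \<delta>\<close>; no open mapping argument enters.\<close>

lemma bounded_below_surj_invertible:
  fixes A :: "'x set"
  assumes T: "bounded_op A T" and \<delta>: "\<delta> > 0"
    and below: "\<And>g. g \<in> l2space A \<Longrightarrow> \<delta> * l2norm g \<le> l2norm (T g)"
    and surj: "\<And>y. y \<in> l2space A \<Longrightarrow> \<exists>g\<in>l2space A. T g = y"
  shows "invertible_op A T"
proof -
  have lin: "T (\<lambda>x. c * g x + h x) = (\<lambda>x. c * T g x + T h x)" if "g \<in> l2space A" "h \<in> l2space A" for c g h
    using T that unfolding bounded_op_def by blast
  have TA: "T g \<in> l2space A" if "g \<in> l2space A" for g using T that unfolding bounded_op_def by blast
  have inj: "g = h" if gh: "g \<in> l2space A" "h \<in> l2space A" and eq: "T g = T h" for g h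
  proof -
    define d where "d = (\<lambda>x. - 1 * h x + g x)"
    have d: "d \<in> l2space A" unfolding d_def by (rule l2space_lincomb[OF gh(2,1)])
    have "T d = (\<lambda>x. 0)" unfolding d_def lin[OF gh(2,1)] by (simp add: eq)
    then have "\<delta> * l2norm d \<le> 0" using below[OF d] by (simp add: l2norm_def)
    then have "l2norm d = 0" using \<delta> l2norm_nonneg[of d] by (simp add: mult_le_0_iff)
    then have "d = (\<lambda>x. 0)" by (rule l2norm_eq_0[OF d])
    then show ?thesis unfolding d_def by (auto simp: fun_eq_iff)
  qed
  define S where "S y = (SOME g. g \<in> l2space A \<and> T g = y)" for y
  have S: "S y \<in> l2space A" "T (S y) = y" if "y \<in> l2space A" for y
    using someI_ex[of "\<lambda>g. g \<in> l2space A \<and> T g = y"] surj[OF that] unfolding S_def by blast+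
  have ST: "S (T g) = g" if "g \<in> l2space A" for g
    by (rule inj[OF S(1)[OF TA[OF that]] that S(2)[OF TA[OF that]]])
  have "bounded_op A S"
    unfolding bounded_op_def
  proof (intro conjI ballI allI)
    fix y assume y: "y \<in> l2space A"
    show "S y \<in> l2space A" by (rule S(1)[OF y])
    fix z c assume z: "z \<in> l2space A"
    show "S (\<lambda>x. c * y x + z x) = (\<lambda>x. c * S y x + S z x)"
    proof (rule inj)
      show "T (S (\<lambda>x. c * y x + z x)) = T (\<lambda>x. c * S y x + S z x)"
        by (simp add: lin S y z l2space_lincomb)
    qed (auto intro!: S(1) l2space_lincomb y z)
  next
    show "\<exists>C. \<forall>y\<in>l2space A. l2norm (S y) \<le> C * l2norm y"
    proof (intro exI[of _ "1 / \<delta>"] ballI)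
      fix y assume y: "y \<in> l2space A"
      show "l2norm (S y) \<le> 1 / \<delta> * l2norm y"
        using below[OF S(1)[OF y]] S(2)[OF y] \<delta> by (simp add: field_simps)
    qed
  qed
  then show ?thesis unfolding invertible_op_def using T ST S(2) by blast
qed

section \<open>Toeplitz operators and their products\<close>

lemma l2space_posCone_UNIV: "g \<in> l2space posCone \<Longrightarrow> g \<in> l2space UNIV"
  by (simp add: l2space_def)

lemma synth_H2: "g \<in> l2space posCone \<Longrightarrow> synth g \<in> H2"
  unfolding H2_def using l2space_posCone_UNIV[of g]
  by (auto simp: synth_L2 fourier_synth) (auto simp: l2space_def posCone_def)

lemma fourier_H2_l2space: "f \<in> H2 \<Longrightarrow> ft f \<in> l2space posCone"
  using fourier_l2space[OF H2_L2, of f] H2D[of f] by (auto simp: l2space_def posCone_def)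

lemma synth_fourier: "f \<in> L2 \<mu> \<Longrightarrow> AE \<gamma> in \<mu>. synth (ft f) \<gamma> = f \<gamma>"
  by (rule L2_fourier_eq_imp_AE_eq) (auto simp: synth_L2 fourier_l2space fourier_synth)

lemma Linf_bound:
  assumes "\<psi> \<in> Linf \<mu>"
  obtains C where "0 \<le> C" "AE \<gamma> in \<mu>. cmod (\<psi> \<gamma>) \<le> C"
proof -
  obtain C where C: "AE \<gamma> in \<mu>. cmod (\<psi> \<gamma>) \<le> C" using assms by (auto simp: Linf_def)
  show ?thesis
  proof (rule that)
    show "AE \<gamma> in \<mu>. cmod (\<psi> \<gamma>) \<le> \<bar>C\<bar>" using C by eventually_elim simp
  qed simp
qed

lemma Linf_measurable: "\<psi> \<in> Linf \<mu> \<Longrightarrow> \<psi> \<in> borel_measurable \<mu>"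
  by (simp add: Linf_def)

lemma Linf_mult_L2: "\<psi> \<in> Linf \<mu> \<Longrightarrow> f \<in> L2 \<mu> \<Longrightarrow> (\<lambda>\<gamma>. \<psi> \<gamma> * f \<gamma>) \<in> L2 \<mu>"
  using L2_bounded_mult Linf_measurable by (metis Linf_bound)

lemma Linf_cnj: "\<psi> \<in> Linf \<mu> \<Longrightarrow> (\<lambda>\<gamma>. cnj (\<psi> \<gamma>)) \<in> Linf \<mu>"
  by (auto simp: Linf_def)

lemma Linf_mult:
  assumes "\<psi> \<in> Linf \<mu>" "\<theta> \<in> Linf \<mu>"
  shows "(\<lambda>\<gamma>. \<psi> \<gamma> * \<theta> \<gamma>) \<in> Linf \<mu>"
proof -
  obtain C D where CD: "0 \<le> C" "AE \<gamma> in \<mu>. cmod (\<psi> \<gamma>) \<le> C" "0 \<le> D" "AE \<gamma> in \<mu>. cmod (\<theta> \<gamma>) \<le> D"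
    using Linf_bound assms by metis
  have "AE \<gamma> in \<mu>. cmod (\<psi> \<gamma> * \<theta> \<gamma>) \<le> C * D"
    using CD(2,4) by eventually_elim (auto simp: norm_mult intro!: mult_mono CD)
  then show ?thesis using assms by (auto simp: Linf_def)
qed

lemma Hinf_Linf: "h \<in> Hinf \<mu> \<Longrightarrow> h \<in> Linf \<mu>"
  by (simp add: Hinf_def)

lemma Hinf_H2:
  assumes "h \<in> Hinf \<mu>"
  shows "h \<in> H2"
proof -
  obtain C where "AE \<gamma> in \<mu>. cmod (h \<gamma>) \<le> C" using Linf_bound[OF Hinf_Linf[OF assms]] by blast
  then have "h \<in> L2 \<mu>" by (rule L2_bounded[OF Linf_measurable[OF Hinf_Linf[OF assms]]])
  moreover have "ft h \<xi> = 0" if "\<xi> < 0" for \<xi>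
    using assms that by (simp add: Hinf_def posCone_def)
  ultimately show ?thesis by (simp add: H2_def)
qed

lemma Hinf_mult_H2: "h \<in> Hinf \<mu> \<Longrightarrow> f \<in> H2 \<Longrightarrow> (\<lambda>\<gamma>. h \<gamma> * f \<gamma>) \<in> H2"
  using fourier_mult_H2(1)[OF Hinf_H2, of h f] Linf_mult_L2[OF Hinf_Linf H2_L2, of h f] by (simp add: H2_def)

text \<open>Acts on coefficient families, so that it can be compared directly with
  \<open>wienerHopf\<close>.\<close>

definition toeplitz :: "(('x \<Rightarrow> complex) \<Rightarrow> complex) \<Rightarrow> ('x \<Rightarrow> complex) \<Rightarrow> 'x \<Rightarrow> complex" where
  "toeplitz \<psi> g = ft (proj (\<lambda>\<gamma>. \<psi> \<gamma> * synth g \<gamma>))"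

text \<open>By the convolution theorem \<open>conv k g\<close> lists the coefficients of
  \<open>kc\<close> times the function with coefficients \<open>g\<close>; cutting off outside the
  cone is the projection.\<close>

lemma wienerHopf_eq_toeplitz:
  assumes k: "kc \<in> Linf \<mu>" "kc \<in> L2 \<mu>" "ft kc = k" and g: "g \<in> l2space posCone"
  shows "wienerHopf k g = toeplitz kc g"
proof -
  note g' = l2space_posCone_UNIV[OF g]
  have "conv k g x = ft (\<lambda>\<gamma>. kc \<gamma> * synth g \<gamma>) x" for x
    using infsumI[OF fourier_mult[OF k(2) synth_L2[OF g'], of x]] by (simp add: conv_def k(3) fourier_synth g')
  then show ?thesis
    by (auto simp: wienerHopf_def toeplitz_def posCone_def fourier_proj Linf_mult_L2 k synth_L2 g')
qed

lemma toeplitz_fourier: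
  assumes "\<psi> \<in> Linf \<mu>" "f \<in> L2 \<mu>"
  shows "toeplitz \<psi> (ft f) = ft (proj (\<lambda>\<gamma>. \<psi> \<gamma> * f \<gamma>))"
proof -
  have "proj (\<lambda>\<gamma>. \<psi> \<gamma> * synth (ft f) \<gamma>) = proj (\<lambda>\<gamma>. \<psi> \<gamma> * f \<gamma>)"
  proof (rule proj_cong)
    show "AE \<gamma> in \<mu>. \<psi> \<gamma> * synth (ft f) \<gamma> = \<psi> \<gamma> * f \<gamma>"
      using synth_fourier[OF assms(2)] by eventually_elim simp
  qed (auto intro!: L2_measurable Linf_mult_L2 synth_L2 fourier_l2space assms)
  then show ?thesis by (simp add: toeplitz_def)
qed

lemma l2space_posCone_cases:
  assumes "g \<in> l2space posCone"
  obtains f where "f \<in> H2" "g = ft f" "l2norm g = nrm f"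
  using that[OF synth_H2[OF assms]] fourier_synth[OF l2space_posCone_UNIV[OF assms]]
    l2norm_fourier[OF synth_L2[OF l2space_posCone_UNIV[OF assms]]] by simp

lemma toeplitz_l2space:
  assumes "\<psi> \<in> Linf \<mu>" "g \<in> l2space posCone"
  shows "toeplitz \<psi> g \<in> l2space posCone"
  unfolding toeplitz_def
  by (intro fourier_H2_l2space proj_H2 Linf_mult_L2 assms synth_L2 l2space_posCone_UNIV)

lemma toeplitz_bounded:
  assumes "\<psi> \<in> Linf \<mu>" "AE \<gamma> in \<mu>. cmod (\<psi> \<gamma>) \<le> C" "0 \<le> C" "g \<in> l2space posCone"
  shows "l2norm (toeplitz \<psi> g) \<le> C * l2norm g"
proof -
  obtain f where f: "f \<in> H2" "g = ft f" "l2norm g = nrm f" by (rule l2space_posCone_cases[OF assms(4)])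
  note m = Linf_mult_L2[OF assms(1) H2_L2[OF f(1)]]
  have "l2norm (toeplitz \<psi> g) = nrm (proj (\<lambda>\<gamma>. \<psi> \<gamma> * f \<gamma>))"
    unfolding f(2) toeplitz_fourier[OF assms(1) H2_L2[OF f(1)]] by (rule l2norm_fourier[OF proj_L2[OF m]])
  also have "\<dots> \<le> nrm (\<lambda>\<gamma>. \<psi> \<gamma> * f \<gamma>)" by (rule norm2_proj_le(1)[OF m])
  also have "\<dots> \<le> C * nrm f"
    by (rule norm2_bounded_mult[OF H2_L2[OF f(1)] Linf_measurable[OF assms(1)] assms(2,3)])
  finally show ?thesis by (simp add: f(3))
qed

lemma bounded_op_toeplitz:
  assumes "\<psi> \<in> Linf \<mu>"
  shows "bounded_op posCone (toeplitz \<psi>)"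
  unfolding bounded_op_def
proof (intro conjI ballI allI)
  fix g :: "'x \<Rightarrow> complex" assume g: "g \<in> l2space posCone"
  show "toeplitz \<psi> g \<in> l2space posCone" by (rule toeplitz_l2space[OF assms g])
  fix h :: "'x \<Rightarrow> complex" and c assume h: "h \<in> l2space posCone"
  obtain f where f: "f \<in> H2" "g = ft f" by (rule l2space_posCone_cases[OF g])
  obtain e where e: "e \<in> H2" "h = ft e" by (rule l2space_posCone_cases[OF h])
  note fL = H2_L2[OF f(1)] and eL = H2_L2[OF e(1)]
  have "(\<lambda>x. c * g x + h x) = ft (\<lambda>\<gamma>. c * f \<gamma> + e \<gamma>)"
    by (rule ext) (simp add: f e fourier_add fourier_cmult L2_cmult fL eL)
  then have "toeplitz \<psi> (\<lambda>x. c * g x + h x) = ft (proj (\<lambda>\<gamma>. \<psi> \<gamma> * (c * f \<gamma> + e \<gamma>)))"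
    using toeplitz_fourier[OF assms L2_add[OF L2_cmult[OF fL] eL]] by simp
  also have "(\<lambda>\<gamma>. \<psi> \<gamma> * (c * f \<gamma> + e \<gamma>)) = (\<lambda>\<gamma>. c * (\<psi> \<gamma> * f \<gamma>) + \<psi> \<gamma> * e \<gamma>)"
    by (simp add: ring_distribs mult_ac)
  also have "ft (proj \<dots>) = (\<lambda>x. c * toeplitz \<psi> g x + toeplitz \<psi> h x)"
    unfolding f(2) e(2) toeplitz_fourier[OF assms fL] toeplitz_fourier[OF assms eL]
    by (rule ext) (simp add: fourier_proj L2_add L2_cmult Linf_mult_L2 assms fL eL fourier_add fourier_cmult)
  finally show "toeplitz \<psi> (\<lambda>x. c * g x + h x) = (\<lambda>x. c * toeplitz \<psi> g x + toeplitz \<psi> h x)" .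
next
  obtain C where "0 \<le> C" "AE \<gamma> in \<mu>. cmod (\<psi> \<gamma>) \<le> C" using Linf_bound[OF assms] by blast
  then show "\<exists>C. \<forall>g\<in>l2space posCone. l2norm (toeplitz \<psi> g) \<le> C * l2norm g"
    using toeplitz_bounded[OF assms] by blast
qed

lemma toeplitz_one:
  assumes "\<psi> \<in> Linf \<mu>" "AE \<gamma> in \<mu>. \<psi> \<gamma> = 1" "g \<in> l2space posCone"
  shows "toeplitz \<psi> g = g"
proof -
  obtain f where f: "f \<in> H2" "g = ft f" by (rule l2space_posCone_cases[OF assms(3)])
  note fL = H2_L2[OF f(1)]
  have "proj (\<lambda>\<gamma>. \<psi> \<gamma> * f \<gamma>) = proj f"
  proof (rule proj_cong)
    show "AE \<gamma> in \<mu>. \<psi> \<gamma> * f \<gamma> = f \<gamma>" using assms(2) by eventually_elim simp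
  qed (intro L2_measurable Linf_mult_L2 assms fL)+
  then show ?thesis
    unfolding f(2) toeplitz_fourier[OF assms(1) fL]
    using fourier_cong_AE[OF L2_measurable[OF proj_L2[OF fL]] L2_measurable[OF fL] proj_H2_id[OF f(1)]] by simp
qed

text \<open>The part discarded by the inner projection lies in \<open>H2m\<close>, and
  multiplication by \<open>cnj (h \<gamma>)\<close> creates no nonnegative frequency from it. The
  outer projection would have removed it anyway.\<close>

lemma toeplitz_cnj_analytic_mult:
  assumes h: "h \<in> Hinf \<mu>" and \<psi>: "\<psi> \<in> Linf \<mu>" and g: "g \<in> l2space posCone"
  shows "toeplitz (\<lambda>\<gamma>. cnj (h \<gamma>)) (toeplitz \<psi> g) = toeplitz (\<lambda>\<gamma>. cnj (h \<gamma>) * \<psi> \<gamma>) g"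
proof -
  obtain f where f: "f \<in> H2" "g = ft f" by (rule l2space_posCone_cases[OF g])
  note hc = Linf_cnj[OF Hinf_Linf[OF h]]
  define m where "m = (\<lambda>\<gamma>. \<psi> \<gamma> * f \<gamma>)"
  have m: "m \<in> L2 \<mu>" unfolding m_def by (rule Linf_mult_L2[OF \<psi> H2_L2[OF f(1)]])
  have "ft (\<lambda>\<gamma>. cnj (h \<gamma>) * m \<gamma>) \<xi> = ft (\<lambda>\<gamma>. cnj (h \<gamma>) * proj m \<gamma>) \<xi>" if "0 \<le> \<xi>" for \<xi>
  proof -
    have "ft (\<lambda>\<gamma>. cnj (h \<gamma>) * (m \<gamma> - proj m \<gamma>)) \<xi> = 0"
      by (rule fourier_cnj_mult_H2m[OF Hinf_H2[OF h] diff_proj_H2m[OF m] that])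
    then show ?thesis
      using fourier_diff[OF Linf_mult_L2[OF hc m] Linf_mult_L2[OF hc proj_L2[OF m]], of \<xi>]
      by (simp add: right_diff_distrib)
  qed
  then have "ft (proj (\<lambda>\<gamma>. cnj (h \<gamma>) * proj m \<gamma>)) = ft (proj (\<lambda>\<gamma>. cnj (h \<gamma>) * m \<gamma>))"
    by (auto simp: fourier_proj Linf_mult_L2 hc m proj_L2)
  then show ?thesis
    unfolding f(2) toeplitz_fourier[OF \<psi> H2_L2[OF f(1)]] toeplitz_fourier[OF Linf_mult[OF hc \<psi>] H2_L2[OF f(1)]]
      m_def[symmetric] toeplitz_fourier[OF hc proj_L2[OF m]]
    by (simp add: m_def mult.assoc)
qed

lemma toeplitz_analytic:
  assumes "h \<in> Hinf \<mu>" "f \<in> H2"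
  shows "toeplitz h (ft f) = ft (\<lambda>\<gamma>. h \<gamma> * f \<gamma>)"
  unfolding toeplitz_fourier[OF Hinf_Linf[OF assms(1)] H2_L2[OF assms(2)]]
  using proj_H2_id[OF Hinf_mult_H2[OF assms]] H2_L2[OF Hinf_mult_H2[OF assms]]
  by (intro fourier_cong_AE L2_measurable proj_L2)

text \<open>An analytic \<open>h\<close> maps \<open>H2\<close> into itself, so the inner projection
  changes nothing. This is the mirror image of the conjugate-analytic factor on the left.\<close>

lemma toeplitz_mult_analytic:
  assumes h: "h \<in> Hinf \<mu>" and \<psi>: "\<psi> \<in> Linf \<mu>" and g: "g \<in> l2space posCone"
  shows "toeplitz \<psi> (toeplitz h g) = toeplitz (\<lambda>\<gamma>. \<psi> \<gamma> * h \<gamma>) g"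
proof -
  obtain f where f: "f \<in> H2" "g = ft f" by (rule l2space_posCone_cases[OF g])
  show ?thesis
    unfolding f(2) toeplitz_analytic[OF h f(1)] toeplitz_fourier[OF \<psi> H2_L2[OF Hinf_mult_H2[OF h f(1)]]]
      toeplitz_fourier[OF Linf_mult[OF \<psi> Hinf_Linf[OF h]] H2_L2[OF f(1)]]
    by (simp add: mult.assoc)
qed

text \<open>The difference from the identity is the operator with symbol \<open>1 - \<psi>\<close>,
  of norm at most \<open>\<rho>\<close>. The lower bound follows from the triangle inequality,
  surjectivity from a contraction.\<close>

lemma toeplitz_near_one_invertible:
  assumes \<psi>: "\<psi> \<in> Linf \<mu>" and \<rho>: "\<rho> < 1" "AE \<gamma> in \<mu>. cmod (1 - \<psi> \<gamma>) \<le> \<rho>"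
  shows "invertible_op posCone (toeplitz \<psi>)"
proof -
  have [measurable]: "\<psi> \<in> borel_measurable \<mu>" by (rule Linf_measurable[OF \<psi>])
  define \<theta> where "\<theta> = (\<lambda>\<gamma>. 1 - \<psi> \<gamma>)"
  have \<theta>: "\<theta> \<in> Linf \<mu>" unfolding Linf_def \<theta>_def using \<rho>(2) by auto
  \<comment> \<open>The sign of \<open>\<rho>\<close> comes from a bound valid almost everywhere; in
    a probability space a constant statement that holds almost everywhere is true.\<close>
  have "AE \<gamma> in \<mu>. 0 \<le> \<rho>" using \<rho>(2) by eventually_elim (rule order_trans[OF norm_ge_zero])
  then have \<rho>0: "0 \<le> \<rho>" by simp
  define B where "B f = proj (\<lambda>\<gamma>. \<theta> \<gamma> * f \<gamma>)" for f
  have BH: "B f \<in> H2" if "f \<in> L2 \<mu>" for f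
    unfolding B_def by (intro proj_H2 Linf_mult_L2[OF \<theta>] that)
  have BL: "B f \<in> L2 \<mu>" if "f \<in> L2 \<mu>" for f using BH[OF that] by (rule H2_L2)
  have Bnorm: "nrm (B f) \<le> \<rho> * nrm f" if f: "f \<in> L2 \<mu>" for f
    unfolding B_def
    using norm2_proj_le(1)[OF Linf_mult_L2[OF \<theta> f]]
      norm2_bounded_mult[OF f Linf_measurable[OF \<theta>], of \<rho>] \<rho>(2) \<rho>0 by (simp add: \<theta>_def)
  have Bdiff: "AE \<gamma> in \<mu>. B (\<lambda>\<gamma>. f \<gamma> - g \<gamma>) \<gamma> = B f \<gamma> - B g \<gamma>" if "f \<in> L2 \<mu>" "g \<in> L2 \<mu>" for f g
    using proj_lincomb[OF Linf_mult_L2[OF \<theta> that(2)] Linf_mult_L2[OF \<theta> that(1)], of "- 1"]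
    by (simp add: B_def right_diff_distrib)
  have eq: "ft (proj (\<lambda>\<gamma>. \<psi> \<gamma> * f \<gamma>)) \<xi> = ft f \<xi> - ft (B f) \<xi>" if f: "f \<in> H2" for f \<xi>
  proof -
    note fL = H2_L2[OF f]
    have "(\<lambda>\<gamma>. \<psi> \<gamma> * f \<gamma>) = (\<lambda>\<gamma>. f \<gamma> - \<theta> \<gamma> * f \<gamma>)" by (simp add: \<theta>_def algebra_simps)
    then have "ft (proj (\<lambda>\<gamma>. \<psi> \<gamma> * f \<gamma>)) \<xi> =
        (if 0 \<le> \<xi> then ft f \<xi> - ft (\<lambda>\<gamma>. \<theta> \<gamma> * f \<gamma>) \<xi> else 0)"
      by (simp add: fourier_proj L2_diff fL Linf_mult_L2 \<theta> fourier_diff)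
    then show ?thesis
      using H2D[OF f, of \<xi>] by (auto simp: B_def fourier_proj Linf_mult_L2 \<theta> fL)
  qed
  show ?thesis
  proof (rule bounded_below_surj_invertible[OF bounded_op_toeplitz[OF \<psi>], of "1 - \<rho>"])
    show "0 < 1 - \<rho>" using \<rho>(1) by simp
  next
    fix g :: "'x \<Rightarrow> complex" assume "g \<in> l2space posCone"
    then obtain f where f: "f \<in> H2" "g = ft f" "l2norm g = nrm f" by (rule l2space_posCone_cases)
    note fL = H2_L2[OF f(1)]
    have "nrm f \<le> nrm (B f) + nrm (\<lambda>\<gamma>. f \<gamma> - B f \<gamma>)" by (rule norm2_le_diff[OF fL BL[OF fL]])
    also have "\<dots> \<le> \<rho> * nrm f + nrm (\<lambda>\<gamma>. f \<gamma> - B f \<gamma>)" using Bnorm[OF fL] by simp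
    also have "nrm (\<lambda>\<gamma>. f \<gamma> - B f \<gamma>) = l2norm (ft (\<lambda>\<gamma>. f \<gamma> - B f \<gamma>))"
      by (rule l2norm_fourier[symmetric]) (intro L2_diff fL BL)
    also have "ft (\<lambda>\<gamma>. f \<gamma> - B f \<gamma>) = toeplitz \<psi> g"
      unfolding f(2) toeplitz_fourier[OF \<psi> fL] by (rule ext) (simp add: eq[OF f(1)] fourier_diff fL BL)
    finally show "(1 - \<rho>) * l2norm g \<le> l2norm (toeplitz \<psi> g)" by (simp add: f(3) algebra_simps)
  next
    fix g :: "'x \<Rightarrow> complex" assume "g \<in> l2space posCone"
    then obtain y where y: "y \<in> H2" "g = ft y" by (rule l2space_posCone_cases)
    \<comment> \<open>\<open>f = B f + y\<close> says that the operator with symbol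
      \<open>\<psi>\<close> sends \<open>f\<close> to \<open>y\<close>, since \<open>B\<close> has
      symbol \<open>1 - \<psi>\<close>.\<close>
    obtain f where f: "f \<in> H2" "AE \<gamma> in \<mu>. 1 * B f \<gamma> + y \<gamma> = f \<gamma>"
    proof (rule L2_contraction_fixpoint[of H2 y "\<lambda>f \<gamma>. 1 * B f \<gamma> + y \<gamma>" \<rho>])
      show "H2 \<subseteq> L2 \<mu>" using H2_L2 by blast
      show "(\<lambda>\<gamma>. 1 * B f \<gamma> + y \<gamma>) \<in> H2" if "f \<in> H2" for f
        by (rule H2_lincomb[OF BH[OF H2_L2[OF that]] y(1)])
      show "nrm (\<lambda>\<gamma>. (1 * B f \<gamma> + y \<gamma>) - (1 * B e \<gamma> + y \<gamma>)) \<le> \<rho> * nrm (\<lambda>\<gamma>. f \<gamma> - e \<gamma>)"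
        if fe: "f \<in> H2" "e \<in> H2" for f e
      proof -
        note fL = H2_L2[OF fe(1)] and eL = H2_L2[OF fe(2)]
        have "nrm (\<lambda>\<gamma>. B f \<gamma> - B e \<gamma>) = nrm (B (\<lambda>\<gamma>. f \<gamma> - e \<gamma>))"
        proof (rule norm2_cong_AE)
          show "AE \<gamma> in \<mu>. B f \<gamma> - B e \<gamma> = B (\<lambda>\<gamma>. f \<gamma> - e \<gamma>) \<gamma>"
            using Bdiff[OF fL eL] by eventually_elim simp
        qed (intro L2_measurable L2_diff BL fL eL)+
        also have "\<dots> \<le> \<rho> * nrm (\<lambda>\<gamma>. f \<gamma> - e \<gamma>)" by (rule Bnorm[OF L2_diff[OF fL eL]])
        finally show ?thesis by simp
      qed
    qed (use y(1) \<rho>(1) \<rho>0 H2_closed in auto)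
    have "ft f \<xi> = ft (B f) \<xi> + ft y \<xi>" for \<xi>
    proof -
      have "ft (\<lambda>\<gamma>. 1 * B f \<gamma> + y \<gamma>) = ft f"
        using f by (intro fourier_cong_AE L2_measurable L2_add L2_cmult BL H2_L2[OF f(1)] H2_L2[OF y(1)])
      from fun_cong[OF this, of \<xi>] show ?thesis
        by (simp add: fourier_add BL H2_L2[OF f(1)] H2_L2[OF y(1)])
    qed
    then have "toeplitz \<psi> (ft f) = g"
      unfolding y(2) toeplitz_fourier[OF \<psi> H2_L2[OF f(1)]] by (auto simp: eq[OF f(1)])
    then show "\<exists>s\<in>l2space posCone. toeplitz \<psi> s = g" using fourier_H2_l2space[OF f(1)] by blast
  qed
qed

lemma left_inverse_bounded_below:
  assumes \<psi>: "\<psi> \<in> Linf \<mu>" and inv: "left_invertible_op posCone (toeplitz \<psi>)"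
  obtains \<epsilon> where "\<epsilon> > 0" "\<And>f. f \<in> H2 \<Longrightarrow> \<epsilon> * nrm f \<le> nrm (proj (\<lambda>\<gamma>. \<psi> \<gamma> * f \<gamma>))"
proof -
  obtain L where L: "bounded_op posCone L" "\<And>g. g \<in> l2space posCone \<Longrightarrow> L (toeplitz \<psi> g) = g"
    using inv by (auto simp: left_invertible_op_def)
  obtain C where C: "\<And>g. g \<in> l2space posCone \<Longrightarrow> l2norm (L g) \<le> C * l2norm g"
    using L(1) unfolding bounded_op_def by blast
  show ?thesis
  proof (rule that)
    \<comment> \<open>\<open>C\<close> may be 0 or negative; its absolute value plus 1 is a positive
      bound.\<close>
    show "1 / (\<bar>C\<bar> + 1) > 0" by (simp add: add_nonneg_pos)
    fix f assume f: "f \<in> H2"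
    note g = fourier_H2_l2space[OF f]
    have "nrm f = l2norm (L (toeplitz \<psi> (ft f)))"
      unfolding L(2)[OF g] by (simp add: l2norm_fourier H2_L2[OF f])
    also have "\<dots> \<le> C * l2norm (toeplitz \<psi> (ft f))" by (rule C[OF toeplitz_l2space[OF \<psi> g]])
    also have "\<dots> \<le> (\<bar>C\<bar> + 1) * l2norm (toeplitz \<psi> (ft f))"
      by (intro mult_right_mono l2norm_nonneg) simp
    also have "l2norm (toeplitz \<psi> (ft f)) = nrm (proj (\<lambda>\<gamma>. \<psi> \<gamma> * f \<gamma>))"
      unfolding toeplitz_fourier[OF \<psi> H2_L2[OF f]]
      by (intro l2norm_fourier proj_L2 Linf_mult_L2 \<psi> H2_L2 f)
    finally show "1 / (\<bar>C\<bar> + 1) * nrm f \<le> nrm (proj (\<lambda>\<gamma>. \<psi> \<gamma> * f \<gamma>))"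
      by (simp add: divide_le_eq mult.commute add_nonneg_pos)
  qed
qed

text \<open>Instead of forming the adjoint of \<open>R\<close>, write \<open>f\<close> as the image
  of \<open>r\<close>, the function behind \<open>R (ft f)\<close>. Pairing with \<open>f\<close>
  and moving the symbol across expresses the squared norm of \<open>f\<close> by \<open>r\<close>
  and the operator with conjugated symbol, and \<open>r\<close> is bounded by
  \<open>f\<close>.\<close>

lemma right_inverse_adjoint_bounded_below:
  assumes \<psi>: "\<psi> \<in> Linf \<mu>" and inv: "right_invertible_op posCone (toeplitz \<psi>)"
  obtains \<epsilon> where "\<epsilon> > 0" "\<And>f. f \<in> H2 \<Longrightarrow> \<epsilon> * nrm f \<le> nrm (proj (\<lambda>\<gamma>. cnj (\<psi> \<gamma>) * f \<gamma>))"
proof -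
  obtain R where R: "bounded_op posCone R" "\<And>g. g \<in> l2space posCone \<Longrightarrow> toeplitz \<psi> (R g) = g"
    using inv by (auto simp: right_invertible_op_def)
  obtain C where C: "\<And>g. g \<in> l2space posCone \<Longrightarrow> l2norm (R g) \<le> C * l2norm g"
    using R(1) unfolding bounded_op_def by blast
  show ?thesis
  proof (rule that)
    show "1 / (\<bar>C\<bar> + 1) > 0" by (simp add: add_nonneg_pos)
    fix f assume f: "f \<in> H2"
    note g = fourier_H2_l2space[OF f] and fL = H2_L2[OF f]
    have "R (ft f) \<in> l2space posCone" using R(1) g unfolding bounded_op_def by blast
    then obtain r where r: "r \<in> H2" "R (ft f) = ft r" "l2norm (R (ft f)) = nrm r"
      by (rule l2space_posCone_cases)
    note rL = H2_L2[OF r(1)]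
    define z where "z = nrm (proj (\<lambda>\<gamma>. cnj (\<psi> \<gamma>) * f \<gamma>))"
    have zL: "(\<lambda>\<gamma>. cnj (\<psi> \<gamma>) * f \<gamma>) \<in> L2 \<mu>" by (intro Linf_mult_L2 Linf_cnj \<psi> fL)
    have mL: "(\<lambda>\<gamma>. \<psi> \<gamma> * r \<gamma>) \<in> L2 \<mu>" by (intro Linf_mult_L2 \<psi> rL)
    have "nrm r \<le> C * nrm f" using C[OF g] unfolding r(3) by (simp add: l2norm_fourier fL)
    also have "\<dots> \<le> (\<bar>C\<bar> + 1) * nrm f" by (intro mult_right_mono) auto
    finally have rle: "nrm r \<le> (\<bar>C\<bar> + 1) * nrm f" .
    have "ft (proj (\<lambda>\<gamma>. \<psi> \<gamma> * r \<gamma>)) = ft f"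
      using R(2)[OF g] unfolding r(2) toeplitz_fourier[OF \<psi> rL] .
    then have "AE \<gamma> in \<mu>. proj (\<lambda>\<gamma>. \<psi> \<gamma> * r \<gamma>) \<gamma> = f \<gamma>"
      by (intro L2_fourier_eq_imp_AE_eq proj_L2 mL fL) simp
    then have "ip f f = ip (proj (\<lambda>\<gamma>. \<psi> \<gamma> * r \<gamma>)) f"
      by (intro ip2_cong_AE L2_measurable proj_L2 mL fL) (auto elim: eventually_mono)
    also have "\<dots> = ip (\<lambda>\<gamma>. \<psi> \<gamma> * r \<gamma>) f" by (rule proj_ip2_left[OF mL f])
    also have "\<dots> = cnj (ip (\<lambda>\<gamma>. cnj (\<psi> \<gamma>) * f \<gamma>) r)"
      unfolding ip2_commute[of \<mu> _ r] by (simp add: ip2_def mult_ac)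
    also have "\<dots> = cnj (ip (proj (\<lambda>\<gamma>. cnj (\<psi> \<gamma>) * f \<gamma>)) r)" by (simp add: proj_ip2_left[OF zL r(1)])
    finally have "(nrm f)\<^sup>2 = cmod (ip (proj (\<lambda>\<gamma>. cnj (\<psi> \<gamma>) * f \<gamma>)) r)"
      unfolding ip2_self by (metis complex_mod_cnj norm_of_real abs_power2)
    also have "\<dots> \<le> z * nrm r" unfolding z_def by (intro ip2_Cauchy_Schwarz proj_L2 zL rL)
    also have "\<dots> \<le> z * ((\<bar>C\<bar> + 1) * nrm f)" by (intro mult_left_mono rle) (simp add: z_def)
    finally have le: "nrm f * nrm f \<le> (z * (\<bar>C\<bar> + 1)) * nrm f" by (simp add: power2_eq_square mult_ac)
    have "nrm f \<le> z * (\<bar>C\<bar> + 1)"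
    proof (cases "nrm f = 0")
      case True
      then show ?thesis by (simp add: z_def)
    next
      case False
      then have "0 < nrm f" using norm2_nonneg[of \<mu> f] by linarith
      then show ?thesis by (rule mult_right_le_imp_le[OF le])
    qed
    then show "1 / (\<bar>C\<bar> + 1) * nrm f \<le> nrm (proj (\<lambda>\<gamma>. cnj (\<psi> \<gamma>) * f \<gamma>))"
      unfolding z_def[symmetric] by (simp add: divide_le_eq mult.commute add_nonneg_pos)
  qed
qed

end

context unimodular_symbol
begin

section \<open>Invertibility criteria for unimodular symbols\<close>

lemma phi_Linf: "\<phi> \<in> Linf \<mu>"
  using phi_unimodular by (auto simp: Linf_def intro!: exI[of _ 1] elim: eventually_mono)

text \<open>Multiplying \<open>\<phi> - h\<close> by \<open>cnj \<phi>\<close> preserves the modulus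
  and replaces \<open>\<phi>\<close> by 1; the other form is its complex conjugate.\<close>

lemma one_minus_cnj_mult:
  assumes "AE \<gamma> in \<mu>. cmod (\<phi> \<gamma> - h \<gamma>) \<le> \<rho>"
  shows "AE \<gamma> in \<mu>. cmod (1 - cnj (h \<gamma>) * \<phi> \<gamma>) \<le> \<rho>" "AE \<gamma> in \<mu>. cmod (1 - cnj (\<phi> \<gamma>) * h \<gamma>) \<le> \<rho>"
proof -
  show *: "AE \<gamma> in \<mu>. cmod (1 - cnj (\<phi> \<gamma>) * h \<gamma>) \<le> \<rho>"
    using assms phi_unimodular
  proof eventually_elim
    case (elim \<gamma>)
    have "cnj (\<phi> \<gamma>) * \<phi> \<gamma> = 1" using complex_norm_square[of "\<phi> \<gamma>"] elim(2) by (simp add: mult.commute)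
    then have "1 - cnj (\<phi> \<gamma>) * h \<gamma> = cnj (\<phi> \<gamma>) * (\<phi> \<gamma> - h \<gamma>)" by (simp add: right_diff_distrib)
    then show ?case using elim by (simp add: norm_mult)
  qed
  have "cmod (1 - cnj a * b) = cmod (1 - cnj b * a)" for a b
    using complex_mod_cnj[of "1 - cnj a * b"] by (simp add: mult.commute)
  with * show "AE \<gamma> in \<mu>. cmod (1 - cnj (h \<gamma>) * \<phi> \<gamma>) \<le> \<rho>" by simp
qed

lemma left_invertible_toeplitz_iff:
  "left_invertible_op posCone (toeplitz \<phi>) \<longleftrightarrow> dist_Hinf \<mu> \<phi> < 1"
proof
  assume "left_invertible_op posCone (toeplitz \<phi>)"
  then obtain \<epsilon> where "\<epsilon> > 0" "\<And>f. f \<in> H2 \<Longrightarrow> \<epsilon> * nrm f \<le> nrm (proj (\<lambda>\<gamma>. \<phi> \<gamma> * f \<gamma>))"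
    using left_inverse_bounded_below[OF phi_Linf] by blast
  then obtain h \<rho> where "h \<in> Hinf \<mu>" "\<rho> < 1" "AE \<gamma> in \<mu>. cmod (\<phi> \<gamma> - h \<gamma>) \<le> \<rho>"
    by (rule nehari_bounded_below)
  then show "dist_Hinf \<mu> \<phi> < 1"
    unfolding dist_Hinf_less_one_iff[OF phi_measurable] by blast
next
  assume "dist_Hinf \<mu> \<phi> < 1"
  then obtain h \<rho> where h: "h \<in> Hinf \<mu>" "\<rho> < 1" "AE \<gamma> in \<mu>. cmod (\<phi> \<gamma> - h \<gamma>) \<le> \<rho>"
    unfolding dist_Hinf_less_one_iff[OF phi_measurable] by blast
  note hc = Linf_cnj[OF Hinf_Linf[OF h(1)]]
  obtain S where S: "bounded_op posCone S"
    "\<And>g. g \<in> l2space posCone \<Longrightarrow> S (toeplitz (\<lambda>\<gamma>. cnj (h \<gamma>) * \<phi> \<gamma>) g) = g"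
    "\<And>g. g \<in> l2space posCone \<Longrightarrow> toeplitz (\<lambda>\<gamma>. cnj (h \<gamma>) * \<phi> \<gamma>) (S g) = g"
    using toeplitz_near_one_invertible[OF Linf_mult[OF hc phi_Linf] h(2) one_minus_cnj_mult(1)[OF h(3)]]
      unfolding invertible_op_def by blast
  \<comment> \<open>The conjugate-analytic factor splits off on the left, so \<open>S\<close> after
    the operator with symbol \<open>cnj (h \<gamma>)\<close> is the left inverse.\<close>
  have "S (toeplitz (\<lambda>\<gamma>. cnj (h \<gamma>)) (toeplitz \<phi> g)) = g" if "g \<in> l2space posCone" for g
    using S(2)[OF that] toeplitz_cnj_analytic_mult[OF h(1) phi_Linf that] by simp
  then show "left_invertible_op posCone (toeplitz \<phi>)"
    unfolding left_invertible_op_def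
    using bounded_op_toeplitz[OF phi_Linf] bounded_op_compose[OF S(1) bounded_op_toeplitz[OF hc]] by blast
qed

text \<open>A right inverse of the operator bounds the one with symbol \<open>cnj \<phi>\<close>
  from below, so Nehari's theorem applies to the conjugate symbol. Conversely, an \<open>h\<close>
  close to \<open>cnj \<phi>\<close> is analytic and splits off on the right.\<close>

lemma right_invertible_toeplitz_iff:
  "right_invertible_op posCone (toeplitz \<phi>) \<longleftrightarrow> dist_Hinf \<mu> (\<lambda>\<gamma>. cnj (\<phi> \<gamma>)) < 1"
proof -
  interpret conj: unimodular_symbol \<mu> "\<lambda>\<gamma>. cnj (\<phi> \<gamma>)"
    by unfold_locales (use phi_unimodular in auto)
  show ?thesis
  proof
    assume "right_invertible_op posCone (toeplitz \<phi>)"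
    then obtain \<epsilon> where "\<epsilon> > 0" "\<And>f. f \<in> H2 \<Longrightarrow> \<epsilon> * nrm f \<le> nrm (proj (\<lambda>\<gamma>. cnj (\<phi> \<gamma>) * f \<gamma>))"
      using right_inverse_adjoint_bounded_below[OF phi_Linf] by blast
    then obtain h \<rho> where "h \<in> Hinf \<mu>" "\<rho> < 1" "AE \<gamma> in \<mu>. cmod (cnj (\<phi> \<gamma>) - h \<gamma>) \<le> \<rho>"
      by (rule conj.nehari_bounded_below)
    then show "dist_Hinf \<mu> (\<lambda>\<gamma>. cnj (\<phi> \<gamma>)) < 1"
      unfolding dist_Hinf_less_one_iff[OF conj.phi_measurable] by blast
  next
    assume "dist_Hinf \<mu> (\<lambda>\<gamma>. cnj (\<phi> \<gamma>)) < 1"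
    then obtain h \<rho> where h: "h \<in> Hinf \<mu>" "\<rho> < 1" "AE \<gamma> in \<mu>. cmod (cnj (\<phi> \<gamma>) - h \<gamma>) \<le> \<rho>"
      unfolding dist_Hinf_less_one_iff[OF conj.phi_measurable] by blast
    note hL = Hinf_Linf[OF h(1)]
    have "AE \<gamma> in \<mu>. cmod (1 - \<phi> \<gamma> * h \<gamma>) \<le> \<rho>" using conj.one_minus_cnj_mult(2)[OF h(3)] by simp
    then obtain S where S: "bounded_op posCone S"
      "\<And>g. g \<in> l2space posCone \<Longrightarrow> S (toeplitz (\<lambda>\<gamma>. \<phi> \<gamma> * h \<gamma>) g) = g"
      "\<And>g. g \<in> l2space posCone \<Longrightarrow> toeplitz (\<lambda>\<gamma>. \<phi> \<gamma> * h \<gamma>) (S g) = g"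
      using toeplitz_near_one_invertible[OF Linf_mult[OF phi_Linf hL] h(2)]
      unfolding invertible_op_def by blast
    have "toeplitz \<phi> (toeplitz h (S g)) = g" if g: "g \<in> l2space posCone" for g
    proof -
      have "S g \<in> l2space posCone" using S(1) g unfolding bounded_op_def by blast
      then show ?thesis using S(3)[OF g] toeplitz_mult_analytic[OF h(1) phi_Linf, of "S g"] by simp
    qed
    then show "right_invertible_op posCone (toeplitz \<phi>)"
      unfolding right_invertible_op_def
      using bounded_op_toeplitz[OF phi_Linf] bounded_op_compose[OF bounded_op_toeplitz[OF hL] S(1)] by blast
  qed
qed

text \<open>Left invertibility supplies \<open>h\<close>, right invertibility makes the operator
  with symbol \<open>cnj \<phi>\<close> injective. Near-one invertibility solves for an
  \<open>f\<close> such that this operator takes \<open>h f\<close> and 1 to the same value, whence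
  \<open>h f = 1\<close>.\<close>

lemma invertible_toeplitz_near_invertible:
  assumes inv: "invertible_op posCone (toeplitz \<phi>)"
  obtains h f \<rho> where "h \<in> Hinf \<mu>" "f \<in> Hinf \<mu>" "AE \<gamma> in \<mu>. h \<gamma> * f \<gamma> = 1" "\<rho> < 1"
    "AE \<gamma> in \<mu>. cmod (\<phi> \<gamma> - h \<gamma>) \<le> \<rho>"
proof -
  have "left_invertible_op posCone (toeplitz \<phi>)" and right: "right_invertible_op posCone (toeplitz \<phi>)"
    using inv by (auto simp: invertible_op_def left_invertible_op_def right_invertible_op_def)
  then obtain h \<rho> where h: "h \<in> Hinf \<mu>" "\<rho> < 1" "AE \<gamma> in \<mu>. cmod (\<phi> \<gamma> - h \<gamma>) \<le> \<rho>"
    unfolding left_invertible_toeplitz_iff dist_Hinf_less_one_iff[OF phi_measurable] by blast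
  obtain \<epsilon> where \<epsilon>: "\<epsilon> > 0" "\<And>f. f \<in> H2 \<Longrightarrow> \<epsilon> * nrm f \<le> nrm (proj (\<lambda>\<gamma>. cnj (\<phi> \<gamma>) * f \<gamma>))"
    using right_inverse_adjoint_bounded_below[OF phi_Linf right] by blast
  note pc = Linf_cnj[OF phi_Linf] and hL = Hinf_Linf[OF h(1)]
  define \<psi> where "\<psi> = (\<lambda>\<gamma>. cnj (\<phi> \<gamma>) * h \<gamma>)"
  have \<psi>: "\<psi> \<in> Linf \<mu>" unfolding \<psi>_def by (rule Linf_mult[OF pc hL])
  have "AE \<gamma> in \<mu>. cmod (1 - \<psi> \<gamma>) \<le> \<rho>" unfolding \<psi>_def by (rule one_minus_cnj_mult(2)[OF h(3)])
  then obtain S where S: "bounded_op posCone S" "\<And>g. g \<in> l2space posCone \<Longrightarrow> S (toeplitz \<psi> g) = g"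
    "\<And>g. g \<in> l2space posCone \<Longrightarrow> toeplitz \<psi> (S g) = g"
    using toeplitz_near_one_invertible[OF \<psi> h(2)] unfolding invertible_op_def by blast
  define y where "y = ft (proj (\<lambda>\<gamma>. cnj (\<phi> \<gamma>) * 1))"
  have cL: "(\<lambda>\<gamma>. cnj (\<phi> \<gamma>) * 1) \<in> L2 \<mu>" by (rule Linf_mult_L2[OF pc one_L2])
  have y: "y \<in> l2space posCone" unfolding y_def by (intro fourier_H2_l2space proj_H2 cL)
  have "S y \<in> l2space posCone" using S(1) y unfolding bounded_op_def by blast
  then obtain f where f: "f \<in> H2" "S y = ft f" by (rule l2space_posCone_cases)
  have hf: "(\<lambda>\<gamma>. h \<gamma> * f \<gamma>) \<in> H2" by (rule Hinf_mult_H2[OF h(1) f(1)])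
  have hcL: "(\<lambda>\<gamma>. cnj (\<phi> \<gamma>) * (h \<gamma> * f \<gamma>)) \<in> L2 \<mu>" by (rule Linf_mult_L2[OF pc H2_L2[OF hf]])
  have "ft (proj (\<lambda>\<gamma>. cnj (\<phi> \<gamma>) * (h \<gamma> * f \<gamma>))) = y"
    using S(3)[OF y] unfolding f(2) toeplitz_fourier[OF \<psi> H2_L2[OF f(1)]] by (simp add: \<psi>_def mult.assoc)
  then have eq: "ft (proj (\<lambda>\<gamma>. cnj (\<phi> \<gamma>) * (h \<gamma> * f \<gamma>))) \<xi> = ft (proj (\<lambda>\<gamma>. cnj (\<phi> \<gamma>) * 1)) \<xi>" for \<xi>
    by (simp add: y_def)
  define d where "d = (\<lambda>\<gamma>. h \<gamma> * f \<gamma> - 1)"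
  have d: "d \<in> H2" unfolding d_def by (rule H2_diff[OF hf one_H2])
  have dL: "(\<lambda>\<gamma>. cnj (\<phi> \<gamma>) * d \<gamma>) \<in> L2 \<mu>" by (rule Linf_mult_L2[OF pc H2_L2[OF d]])
  have "(\<lambda>\<gamma>. cnj (\<phi> \<gamma>) * d \<gamma>) = (\<lambda>\<gamma>. cnj (\<phi> \<gamma>) * (h \<gamma> * f \<gamma>) - cnj (\<phi> \<gamma>) * 1)"
    by (simp add: d_def right_diff_distrib)
  then have "ft (proj (\<lambda>\<gamma>. cnj (\<phi> \<gamma>) * d \<gamma>)) \<xi> = 0" for \<xi>
    using eq[of \<xi>] fourier_diff[OF hcL cL, of \<xi>] fourier_proj[OF dL, of \<xi>] fourier_proj[OF hcL, of \<xi>]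
      fourier_proj[OF cL, of \<xi>] by (simp split: if_splits)
  then have "AE \<gamma> in \<mu>. proj (\<lambda>\<gamma>. cnj (\<phi> \<gamma>) * d \<gamma>) \<gamma> = 0"
    by (intro fourier_zero_AE_zero L2_integrable proj_L2 dL)
  then have "nrm (proj (\<lambda>\<gamma>. cnj (\<phi> \<gamma>) * d \<gamma>)) = 0"
    using norm2_eq_0_iff[OF proj_L2[OF dL]] by simp
  then have "\<epsilon> * nrm d \<le> 0" using \<epsilon>(2)[OF d] by simp
  then have "nrm d = 0" using \<epsilon>(1) norm2_nonneg[of \<mu> d] by (simp add: mult_le_0_iff)
  then have "AE \<gamma> in \<mu>. d \<gamma> = 0" using norm2_eq_0_iff[OF H2_L2[OF d]] by simp
  then have one: "AE \<gamma> in \<mu>. h \<gamma> * f \<gamma> = 1" by (simp add: d_def)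
  \<comment> \<open>Boundedness promotes \<open>f\<close> from \<open>H2\<close> to
    \<open>Hinf\<close>: since \<open>\<phi>\<close> is unimodular, \<open>h\<close> has modulus at
    least \<open>1 - \<rho>\<close>, and \<open>f\<close> is its inverse.\<close>
  have "AE \<gamma> in \<mu>. cmod (f \<gamma>) \<le> 1 / (1 - \<rho>)"
    using one h(3) phi_unimodular
  proof eventually_elim
    case (elim \<gamma>)
    have "1 - \<rho> \<le> cmod (h \<gamma>)" using norm_triangle_ineq2[of "\<phi> \<gamma>" "h \<gamma>"] elim(2,3) by linarith
    moreover have "cmod (h \<gamma>) * cmod (f \<gamma>) = 1" using arg_cong[OF elim(1), of cmod] by (simp add: norm_mult)
    ultimately have "(1 - \<rho>) * cmod (f \<gamma>) \<le> 1" by (metis mult_right_mono norm_ge_zero)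
    then show ?case using h(2) by (simp add: field_simps)
  qed
  then have "f \<in> Hinf \<mu>"
    using f(1) L2_measurable[OF H2_L2[OF f(1)]] by (auto simp: Hinf_def Linf_def H2_def posCone_def)
  then show ?thesis using that h one by blast
qed

text \<open>The operator \<open>T\<close> with symbol \<open>cnj (\<psi> \<gamma>)\<close> composed
  with that of \<open>\<phi>\<close> has a symbol close to 1. This alone gives a left inverse; the
  inverse \<open>\<theta>\<close> makes \<open>T\<close> injective, which allows \<open>T\<close> to
  be cancelled and turns the same map into a right inverse.\<close>

lemma near_invertible_invertible_toeplitz:
  assumes \<psi>: "\<psi> \<in> Hinf \<mu>" and \<theta>: "\<theta> \<in> Hinf \<mu>" "AE \<gamma> in \<mu>. \<psi> \<gamma> * \<theta> \<gamma> = 1"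
    and \<rho>: "\<rho> < 1" "AE \<gamma> in \<mu>. cmod (\<phi> \<gamma> - \<psi> \<gamma>) \<le> \<rho>"
  shows "invertible_op posCone (toeplitz \<phi>)"
proof -
  note pc = Linf_cnj[OF Hinf_Linf[OF \<psi>]] and cc = Linf_cnj[OF Hinf_Linf[OF \<theta>(1)]]
  define T where "T = toeplitz (\<lambda>\<gamma>. cnj (\<psi> \<gamma>))"
  obtain S where S: "bounded_op posCone S"
    "\<And>g. g \<in> l2space posCone \<Longrightarrow> S (toeplitz (\<lambda>\<gamma>. cnj (\<psi> \<gamma>) * \<phi> \<gamma>) g) = g"
    "\<And>g. g \<in> l2space posCone \<Longrightarrow> toeplitz (\<lambda>\<gamma>. cnj (\<psi> \<gamma>) * \<phi> \<gamma>) (S g) = g"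
    using toeplitz_near_one_invertible[OF Linf_mult[OF pc phi_Linf] \<rho>(1) one_minus_cnj_mult(1)[OF \<rho>(2)]]
      unfolding invertible_op_def by blast
  have comp: "toeplitz (\<lambda>\<gamma>. cnj (\<psi> \<gamma>) * \<phi> \<gamma>) g = T (toeplitz \<phi> g)" if "g \<in> l2space posCone" for g
    unfolding T_def using toeplitz_cnj_analytic_mult[OF \<psi> phi_Linf that] by simp
  have TT: "T g \<in> l2space posCone" if "g \<in> l2space posCone" for g
    unfolding T_def by (rule toeplitz_l2space[OF pc that])
  have one: "AE \<gamma> in \<mu>. cnj (\<theta> \<gamma>) * cnj (\<psi> \<gamma>) = 1"
    using \<theta>(2)
  proof eventually_elim
    case (elim \<gamma>)
    have "cnj (\<theta> \<gamma>) * cnj (\<psi> \<gamma>) = cnj (\<psi> \<gamma> * \<theta> \<gamma>)" by (simp add: mult.commute)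
    then show ?case by (simp only: elim complex_cnj_one)
  qed
  have inj: "toeplitz (\<lambda>\<gamma>. cnj (\<theta> \<gamma>)) (T g) = g" if g: "g \<in> l2space posCone" for g
    unfolding T_def using toeplitz_cnj_analytic_mult[OF \<theta>(1) pc g] toeplitz_one[OF Linf_mult[OF cc pc] one g] by simp
  \<comment> \<open>Both sides have the same image under \<open>T\<close>, and \<open>T\<close> is
    injective.\<close>
  have right: "toeplitz \<phi> (S (T g)) = g" if g: "g \<in> l2space posCone" for g
  proof -
    have s: "S (T g) \<in> l2space posCone" using S(1) TT[OF g] unfolding bounded_op_def by blast
    have "T (toeplitz \<phi> (S (T g))) = T g" using S(3)[OF TT[OF g]] comp[OF s] by simp
    then show ?thesis using inj[OF toeplitz_l2space[OF phi_Linf s]] inj[OF g] by simp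
  qed
  have left: "S (T (toeplitz \<phi> g)) = g" if "g \<in> l2space posCone" for g
    using S(2)[OF that] comp[OF that] by simp
  have "bounded_op posCone (\<lambda>g. S (T g))"
    by (rule bounded_op_compose[OF S(1)]) (simp add: T_def bounded_op_toeplitz[OF pc])
  then show ?thesis
    unfolding invertible_op_def using bounded_op_toeplitz[OF phi_Linf] left right by blast
qed

lemma invertible_toeplitz_iff:
  "invertible_op posCone (toeplitz \<phi>) \<longleftrightarrow>
    (\<exists>\<psi>\<in>Hinf \<mu>. (\<exists>\<theta>\<in>Hinf \<mu>. AE \<gamma> in \<mu>. \<psi> \<gamma> * \<theta> \<gamma> = 1) \<and> linf_norm \<mu> (\<lambda>\<gamma>. \<phi> \<gamma> - \<psi> \<gamma>) < 1)"
proof -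
  have norm: "linf_norm \<mu> (\<lambda>\<gamma>. \<phi> \<gamma> - \<psi> \<gamma>) < 1 \<longleftrightarrow> (\<exists>\<rho><1. AE \<gamma> in \<mu>. cmod (\<phi> \<gamma> - \<psi> \<gamma>) \<le> \<rho>)"
    if "\<psi> \<in> Hinf \<mu>" for \<psi>
    using Linf_measurable[OF Hinf_Linf[OF that]] by (intro linf_norm_less_one_iff) simp
  show ?thesis
  proof
    assume "invertible_op posCone (toeplitz \<phi>)"
    then obtain h f \<rho> where "h \<in> Hinf \<mu>" "f \<in> Hinf \<mu>" "AE \<gamma> in \<mu>. h \<gamma> * f \<gamma> = 1" "\<rho> < 1"
      "AE \<gamma> in \<mu>. cmod (\<phi> \<gamma> - h \<gamma>) \<le> \<rho>"
      by (rule invertible_toeplitz_near_invertible)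
    with norm show "\<exists>\<psi>\<in>Hinf \<mu>. (\<exists>\<theta>\<in>Hinf \<mu>. AE \<gamma> in \<mu>. \<psi> \<gamma> * \<theta> \<gamma> = 1) \<and> linf_norm \<mu> (\<lambda>\<gamma>. \<phi> \<gamma> - \<psi> \<gamma>) < 1"
      by blast
  next
    assume "\<exists>\<psi>\<in>Hinf \<mu>. (\<exists>\<theta>\<in>Hinf \<mu>. AE \<gamma> in \<mu>. \<psi> \<gamma> * \<theta> \<gamma> = 1) \<and> linf_norm \<mu> (\<lambda>\<gamma>. \<phi> \<gamma> - \<psi> \<gamma>) < 1"
    then obtain \<psi> \<theta> where \<psi>: "\<psi> \<in> Hinf \<mu>" "\<theta> \<in> Hinf \<mu>" "AE \<gamma> in \<mu>. \<psi> \<gamma> * \<theta> \<gamma> = 1"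
      "linf_norm \<mu> (\<lambda>\<gamma>. \<phi> \<gamma> - \<psi> \<gamma>) < 1" by blast
    then obtain \<rho> where "\<rho> < 1" "AE \<gamma> in \<mu>. cmod (\<phi> \<gamma> - \<psi> \<gamma>) \<le> \<rho>" using norm by blast
    with \<psi> show "invertible_op posCone (toeplitz \<phi>)" by (intro near_invertible_invertible_toeplitz)
  qed
qed

end

theorem mainTheorem10:
  fixes \<mu> :: "('x::linordered_ab_group_add \<Rightarrow> complex) measure"
    and k :: "'x \<Rightarrow> complex"
    and kc :: "('x \<Rightarrow> complex) \<Rightarrow> complex"
  assumes "haar \<mu>"
    and "k \<in> l2space UNIV"
    and "is_check \<mu> k kc"
    and "kc \<in> Linf \<mu>"
    and "AE \<gamma> in \<mu>. cmod (kc \<gamma>) = 1"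
  shows "(left_invertible_op posCone (wienerHopf k) \<longleftrightarrow> dist_Hinf \<mu> kc < 1)
       \<and> (right_invertible_op posCone (wienerHopf k) \<longleftrightarrow> dist_Hinf \<mu> (\<lambda>\<gamma>. cnj (kc \<gamma>)) < 1)
       \<and> (invertible_op posCone (wienerHopf k) \<longleftrightarrow>
            (\<exists>\<psi>\<in>Hinf \<mu>. (\<exists>\<phi>\<in>Hinf \<mu>. AE \<gamma> in \<mu>. \<psi> \<gamma> * \<phi> \<gamma> = 1)
                 \<and> linf_norm \<mu> (\<lambda>\<gamma>. kc \<gamma> - \<psi> \<gamma>) < 1))"
proof -
  interpret prob_space \<mu> using assms(1) by (simp add: haar_def)
  interpret unimodular_symbol \<mu> kc
    by unfold_locales (use assms in \<open>auto simp: Linf_def\<close>)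
  note kc = assms(4) is_check_imp_fourier[OF assms(3)]
  have eq: "wienerHopf k g = toeplitz kc g" if "g \<in> l2space posCone" for g
    by (rule wienerHopf_eq_toeplitz[OF kc that])
  have "left_invertible_op posCone (wienerHopf k) = left_invertible_op posCone (toeplitz kc)"
    "right_invertible_op posCone (wienerHopf k) = right_invertible_op posCone (toeplitz kc)"
    "invertible_op posCone (wienerHopf k) = invertible_op posCone (toeplitz kc)"
    by - (rule invertible_op_cong, erule eq)+
  then show ?thesis
    by (simp only: left_invertible_toeplitz_iff right_invertible_toeplitz_iff invertible_toeplitz_iff)
qed

end
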